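(* Let $T_{r,m}$ ($r\ge 1$, $m\ge 2$ integers) denote the Brown-Thompson groups and $T=T_{1,2}$ the Thompson group. (i) For all integers $r\ge1$ and $m\ge2$: every rational element of $\mathbb S^1=\mathbb R/\mathbb Z$ is realized as the rotation number of a unique conjugacy class of finite-order elements of $T_{r,m}$ if and only if $m=2$. (ii) The group $T$ is not isomorphic to any of the groups $T_{r,m}$ with $m\neq 2$. (iii) If $m\neq 2$ and $r\not\equiv 0 \pmod{m-1}$, then every group morphism from $T$ to $T_{r,m}$ is trivial.
   Context: For an integer $r\ge 1$, $\mathbb S_r=\mathbb R/r\mathbb Z$ is the circle of length $r$, and $\mathbb S^1=\mathbb S_1$. A homeomorphism $f$ of $\mathbb S_r$ is piecewise affine if there are a finite subdivision $0=a_0<a_1<\dots<a_p=r$ and a lift $\tilde f$ of $f$ to $\mathbb R$ such that $\tilde f(x)=\lambda_i x+\beta_i$ on each $[a_i,a_{i+1}]$, with $\lambda_i,\beta_i\in\mathbb R$. The $a_i$ are called the break points of $f$ (so the point $0=r$ of the circle always counts as a break point) and the $\lambda_i$ its slopes. $PL^+(\mathbb S_r)$ is the group of orientation-preserving piecewise affine homeomorphisms of $\mathbb S_r$. For integers $r\ge1$, $m\ge2$, put $\langle m\rangle=\{m^s: s\in\mathbb Z\}$ and $\mathbb Z[\frac1m]=\{N m^s: N,s\in\mathbb Z\}$. The Brown-Thompson group $T_{r,m}$ is the group of all $f\in PL^+(\mathbb S_r)$ whose slopes lie in $\langle m\rangle$, whose break points lie in $\mathbb Z[\frac1m]$, and such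 that the images under $f$ of its break points lie in $\mathbb Z[\frac1m]$ (modulo $r$). In particular $f(0)\in\mathbb Z[\frac1m]$ modulo $r$. The Thompson group is $T=T_{1,2}$. The rotation number of an orientation-preserving homeomorphism $f$ of $\mathbb S_r$ is $\rho(f)=\lim_{n\to\infty}\frac{\tilde f^n(0)}{rn}\pmod 1\in\mathbb S^1$, where $\tilde f$ is any lift of $f$ to $\mathbb R$; it does not depend on the lift, and it is invariant under conjugation by orientation-preserving homeomorphisms. *)

theory Defs
  imports "HOL-Analysis.Analysis" "HOL-Algebra.Bij" "HOL-Library.Real_Mod" "HOL-Number_Theory.Cong"
begin

text \<open>A point of \<open>\<real>/r\<int>\<close> is a residue class, i.e. a set of reals.\<close>

definition circle_proj :: "nat \<Rightarrow> real \<Rightarrow> real set" where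
  "circle_proj r x = {y. [x = y] (rmod real r)}"

definition circle :: "nat \<Rightarrow> real set set" where
  "circle r = range (circle_proj r)"

text \<open>The quotient topology; see \<open>openin_circle_top\<close> below.\<close>

definition circle_top :: "nat \<Rightarrow> real set topology" where
  "circle_top r = topology (\<lambda>U. U \<subseteq> circle r \<and> open (circle_proj r -` U))"

lemma openin_circle_top:
  "openin (circle_top r) U \<longleftrightarrow> U \<subseteq> circle r \<and> open (circle_proj r -` U)"
proof -
  have "istopology (\<lambda>U. U \<subseteq> circle r \<and> open (circle_proj r -` U))"
    unfolding istopology_def by (auto simp: vimage_Int vimage_Union intro!: open_UN)
  then show ?thesis
    by (simp add: circle_top_def topology_inverse')
qed

lemma topspace_circle_top: "topspace (circle_top r) = circle r"
proof -
  have "openin (circle_top r) (circle r)"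
    by (simp add: openin_circle_top circle_def vimage_def)
  then show ?thesis
    by (metis openin_circle_top openin_subset openin_topspace subset_antisym)
qed

lemma circle_proj_eq_iff: "circle_proj r x = circle_proj r y \<longleftrightarrow> [x = y] (rmod real r)"
  unfolding circle_proj_def by (auto intro: rcong_sym rcong_trans)

lemma quotient_map_circle_proj: "quotient_map euclidean (circle_top r) (circle_proj r)"
  unfolding quotient_map_def
  by (auto simp: topspace_circle_top openin_circle_top vimage_def circle_def)

definition is_lift :: "nat \<Rightarrow> (real set \<Rightarrow> real set) \<Rightarrow> (real \<Rightarrow> real) \<Rightarrow> bool" where
  "is_lift r f F \<longleftrightarrow>
     continuous_on UNIV F \<and> (\<forall>x. f (circle_proj r x) = circle_proj r (F x))"

definition orientation_preserving :: "nat \<Rightarrow> (real set \<Rightarrow> real set) \<Rightarrow> bool" where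
  "orientation_preserving r f \<longleftrightarrow> (\<exists>F. is_lift r f F \<and> strict_mono F)"

text \<open>
  \<open>PL_data r f p a l \<beta>\<close>: the subdivision \<open>0 = a 0 < \<dots> < a p = r\<close> together with the slopes
  \<open>l i\<close> and intercepts \<open>\<beta> i\<close> (for \<open>i < p\<close>) exhibits \<open>f\<close> as piecewise affine.
\<close>

definition PL_data ::
  "nat \<Rightarrow> (real set \<Rightarrow> real set) \<Rightarrow> nat \<Rightarrow> (nat \<Rightarrow> real) \<Rightarrow> (nat \<Rightarrow> real) \<Rightarrow> (nat \<Rightarrow> real) \<Rightarrow> bool"
where
  "PL_data r f p a l \<beta> \<longleftrightarrow>
     a 0 = 0 \<and> a p = real r \<and> (\<forall>i<p. a i < a (Suc i)) \<and>
     (\<exists>F. is_lift r f F \<and> (\<forall>i<p. \<forall>x\<in>{a i..a (Suc i)}. F x = l i * x + \<beta> i))"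

text \<open>
  Maps of the circle are taken extensional, as in \<^const>\<open>Bij\<close>, so that equality of maps on the
  circle is equality of HOL functions.
\<close>

definition PL_plus :: "nat \<Rightarrow> (real set \<Rightarrow> real set) set" where
  "PL_plus r =
     {f \<in> extensional (circle r).
        homeomorphic_map (circle_top r) (circle_top r) f \<and> orientation_preserving r f \<and>
        (\<exists>p a l \<beta>. PL_data r f p a l \<beta>)}"

definition int_powers :: "nat \<Rightarrow> real set" where
  "int_powers m = {real m powi s | s :: int. True}"

definition Z_inverse :: "nat \<Rightarrow> real set" where
  "Z_inverse m = {of_int N * real m powi s | N s :: int. True}"

definition Brown_Thompson :: "nat \<Rightarrow> nat \<Rightarrow> (real set \<Rightarrow> real set) monoid" where
  "Brown_Thompson r m = (BijGroup (circle r)) \<lparr>carrier :=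
     {f \<in> PL_plus r. \<exists>p a l \<beta>. PL_data r f p a l \<beta> \<and>
        (\<forall>i<p. l i \<in> int_powers m) \<and>
        (\<forall>i\<le>p. a i \<in> Z_inverse m) \<and>
        (\<forall>i\<le>p. f (circle_proj r (a i)) \<in> circle_proj r ` Z_inverse m)}\<rparr>"

definition Thompson_T :: "(real set \<Rightarrow> real set) monoid" where
  "Thompson_T = Brown_Thompson 1 2"

text \<open>
  Meaningful for orientation-preserving homeomorphisms, where the value does not depend on the
  chosen lift.  It is a point of \<open>\<real>/\<int>\<close>, i.e. an element of \<^term>\<open>circle 1\<close>.
\<close>

definition rotation_number :: "nat \<Rightarrow> (real set \<Rightarrow> real set) \<Rightarrow> real set" where
  "rotation_number r f =
     (let F = (SOME F. is_lift r f F)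
      in circle_proj 1 (lim (\<lambda>n. (F ^^ n) 0 / (real r * real n))))"

definition finite_order :: "('a, 'b) monoid_scheme \<Rightarrow> 'a \<Rightarrow> bool" where
  "finite_order G x \<longleftrightarrow> (\<exists>n::nat. n > 0 \<and> x [^]\<^bsub>G\<^esub> n = \<one>\<^bsub>G\<^esub>)"

definition conjugacy_classes :: "('a, 'b) monoid_scheme \<Rightarrow> 'a set set" where
  "conjugacy_classes G =
     (\<lambda>x. {g \<otimes>\<^bsub>G\<^esub> x \<otimes>\<^bsub>G\<^esub> inv\<^bsub>G\<^esub> g | g. g \<in> carrier G}) ` carrier G"

end

theory Submission
  imports Defs
begin

text \<open>
  We work with lifts to the line. An orientation-preserving piecewise affine homeomorphism \<open>F\<close> of the
  line with slopes in \<open>\<langle>m\<rangle>\<close>, breaks in \<open>\<int>[1/m]\<close> and \<open>F(\<int>[1/m]) = \<int>[1/m]\<close> preserves lengths of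
  intervals with ends in \<open>\<int>[1/m]\<close> modulo \<open>(m - 1) \<int>[1/m]\<close>, and this is the only obstruction to
  mapping one such interval onto another.

  An element of finite order with rotation number \<open>p/q\<close> is a power of one with a lift \<open>A\<close> satisfying
  \<open>A\<^sup>q(x) = x + r\<close>. The class of \<open>L = A(0)\<close> in \<open>\<int>[1/m] / (m - 1) = \<int> / (m - 1)\<close> is a conjugacy
  invariant, and \<open>q L\<close> must be congruent to \<open>r\<close>. For \<open>m = 2\<close> the condition is void and all such \<open>A\<close>
  are conjugate. For \<open>m > 2\<close> and \<open>q = m - 1\<close> there is no such \<open>A\<close> unless \<open>m - 1\<close> divides \<open>r\<close>, and
  then \<open>L = 1\<close> and \<open>L = 2\<close> both occur. This proves (i). It also proves (ii), because in \<open>T\<close> any two cyclic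
  subgroups of order \<open>m - 1\<close> are conjugate.

  If \<open>m - 1\<close> does not divide \<open>r\<close>, then a homomorphism from \<open>T\<close> kills a nontrivial power of an element
  of order \<open>m - 1\<close>, so (iii) follows from the simplicity of \<open>T\<close>. For the latter, elements supported in
  an interval displaced by an element of the kernel commute modulo the kernel. Hence a generator \<open>X\<close> of
  Thompson's group \<open>F\<close> on a small interval and its copies on the two halves have the same image, and
  the pentagon relation \<open>X X = X\<^sub>r X X\<^sub>l\<close> makes it trivial. Tree rotations generate \<open>F\<close>, so the kernel
  contains every element fixing an interval, and these generate \<open>T\<close>.
\<close>

text \<open>The congruence on lengths comes from \<open>m\<close> being 1 modulo
  \<open>m - 1\<close>: every slope is a unit congruent to 1. As \<open>m\<close> and
  \<open>m - 1\<close> are coprime, inverting \<open>m\<close> adds no congruences between integers,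
  whence the quotient \<int> / (m - 1). Iteration puts the \<open>n\<close>-th iterate of 0 in the
  class of \<open>n * L\<close>, so \<open>q = m - 1\<close> is the exponent at which this class
  vanishes whatever \<open>L\<close> is: existence is then decided by \<open>r\<close> alone, and
  \<open>L\<close> is no longer determined.

  An isomorphism need not respect rotation numbers, so (ii) has to be tested on cyclic subgroups.
  The normalization \<open>A^q(x) = x + r\<close> singles out one generator of such a subgroup, and
  conjugacy of subgroups becomes conjugacy of these generators.

  Finite subdivisions behave badly under composition and gluing. Homeomorphisms are therefore
  described by one-sided germs at every point, and compactness is used once to recover
  subdivisions.\<close>

abbreviation finv :: "(real \<Rightarrow> real) \<Rightarrow> real \<Rightarrow> real" where
  "finv F \<equiv> inv_into UNIV F"

text \<open>The sign \<open>d\<close> is 1 or -1 and picks the side. It multiplies \<open>h\<close>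
  on both sides of the equation, so \<open>s\<close> is the true slope in either case and each fact
  about germs is proved once.\<close>

definition germ :: "real \<Rightarrow> (real \<Rightarrow> real) \<Rightarrow> real \<Rightarrow> real \<Rightarrow> bool" where
  "germ d F x s \<longleftrightarrow> (\<exists>e>0. \<forall>h\<in>{0..e}. F (x + d * h) = F x + s * (d * h))"

abbreviation "germ_left \<equiv> germ (- 1)"
abbreviation "germ_right \<equiv> germ 1"

abbreviation PL_germs :: "nat \<Rightarrow> (real \<Rightarrow> real) \<Rightarrow> real \<Rightarrow> bool" where
  "PL_germs m F x \<equiv> \<exists>s\<in>int_powers m. \<exists>t\<in>int_powers m. germ_left F x s \<and> germ_right F x t \<and>
     (s = t \<or> x \<in> Z_inverse m)"

text \<open>A local condition, which composition, inversion, gluing and periodic extension preserve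
  directly; \<open>affine_chain\<close> recovers subdivisions. The equivalence, rather than an
  implication, gives closure under inverses.\<close>

definition PL_homeo :: "nat \<Rightarrow> (real \<Rightarrow> real) set" where
  "PL_homeo m = {F. strict_mono F \<and> surj F \<and> (\<forall>x. F x \<in> Z_inverse m \<longleftrightarrow> x \<in> Z_inverse m) \<and>
     (\<forall>x. PL_germs m F x)}"

lemma germI:
  assumes "e > 0" "\<And>h. 0 \<le> h \<Longrightarrow> h \<le> e \<Longrightarrow> F (x + d * h) = F x + s * (d * h)"
  shows "germ d F x s"
  unfolding germ_def using assms by (meson atLeastAtMost_iff)

lemma germE:
  assumes "germ d F x s"
  obtains e where "e > 0" "\<And>h. 0 \<le> h \<Longrightarrow> h \<le> e \<Longrightarrow> F (x + d * h) = F x + s * (d * h)"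
  using assms unfolding germ_def by (meson atLeastAtMost_iff)

lemma germ_leftE:
  assumes "germ_left F x s"
  obtains e where "e > 0" "\<And>y. x - e \<le> y \<Longrightarrow> y \<le> x \<Longrightarrow> F y = F x + s * (y - x)"
proof -
  obtain e where e: "e > 0" "\<And>h. 0 \<le> h \<Longrightarrow> h \<le> e \<Longrightarrow> F (x + - 1 * h) = F x + s * (- 1 * h)"
    using germE[OF assms] by blast
  have "F y = F x + s * (y - x)" if "x - e \<le> y" "y \<le> x" for y
    using e(2)[of "x - y"] that by simp
  then show ?thesis using that e(1) by blast
qed

lemma germ_rightE:
  assumes "germ_right F x s"
  obtains e where "e > 0" "\<And>y. x \<le> y \<Longrightarrow> y \<le> x + e \<Longrightarrow> F y = F x + s * (y - x)"
proof -
  obtain e where e: "e > 0" "\<And>h. 0 \<le> h \<Longrightarrow> h \<le> e \<Longrightarrow> F (x + 1 * h) = F x + s * (1 * h)"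
    using germE[OF assms] by blast
  have "F y = F x + s * (y - x)" if "x \<le> y" "y \<le> x + e" for y
    using e(2)[of "y - x"] that by simp
  then show ?thesis using that e(1) by blast
qed

lemma germ_cong:
  assumes "germ d F x s" "e > 0" "\<And>h. 0 \<le> h \<Longrightarrow> h \<le> e \<Longrightarrow> F (x + d * h) = G (x + d * h)"
  shows "germ d G x s"
proof -
  obtain e' where e': "e' > 0" "\<And>h. 0 \<le> h \<Longrightarrow> h \<le> e' \<Longrightarrow> F (x + d * h) = F x + s * (d * h)"
    using germE[OF assms(1)] by blast
  show ?thesis
  proof (rule germI[of "min e e'"])
    fix h assume "0 \<le> h" "h \<le> min e e'"
    then show "G (x + d * h) = G x + s * (d * h)"
      using e'(2)[of h] assms(3)[of h] assms(3)[of 0] assms(2) by simp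
  qed (use e'(1) assms(2) in simp)
qed

lemma germ_comp:
  assumes "germ d F (G x) s" "germ d G x t" "t > 0"
  shows "germ d (F \<circ> G) x (s * t)"
proof -
  obtain e where e: "e > 0" "\<And>h. 0 \<le> h \<Longrightarrow> h \<le> e \<Longrightarrow> F (G x + d * h) = F (G x) + s * (d * h)"
    using germE[OF assms(1)] by blast
  obtain e' where e': "e' > 0" "\<And>h. 0 \<le> h \<Longrightarrow> h \<le> e' \<Longrightarrow> G (x + d * h) = G x + t * (d * h)"
    using germE[OF assms(2)] by blast
  show ?thesis
  proof (rule germI[of "min e' (e / t)"])
    fix h assume h: "0 \<le> h" "h \<le> min e' (e / t)"
    then have "t * h \<le> e" using assms(3) by (simp add: field_simps)
    then have "F (G x + d * (t * h)) = F (G x) + s * (d * (t * h))" using h assms(3) by (intro e(2)) auto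
    moreover have "G (x + d * h) = G x + d * (t * h)" using e'(2)[of h] h by (simp add: mult.left_commute)
    ultimately show "(F \<circ> G) (x + d * h) = (F \<circ> G) x + s * t * (d * h)"
      by (simp add: mult.assoc mult.left_commute)
  qed (use e(1) e'(1) assms(3) in simp)
qed

lemma germ_inv:
  assumes "germ d F x s" "s > 0" "inj F"
  shows "germ d (finv F) (F x) (1 / s)"
proof -
  obtain e where e: "e > 0" "\<And>h. 0 \<le> h \<Longrightarrow> h \<le> e \<Longrightarrow> F (x + d * h) = F x + s * (d * h)"
    using germE[OF assms(1)] by blast
  show ?thesis
  proof (rule germI[of "s * e"])
    fix h assume "0 \<le> h" "h \<le> s * e"
    then have "0 \<le> h / s" "h / s \<le> e" using assms(2) by (simp_all add: field_simps)
    then have "F (x + d * (h / s)) = F x + s * (d * (h / s))" by (rule e(2))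
    also have "s * (d * (h / s)) = d * h" using assms(2) by simp
    finally have "finv F (F x + d * h) = x + d * (h / s)" using assms(3) by (metis inv_f_f)
    then show "finv F (F x + d * h) = finv F (F x) + 1 / s * (d * h)" using assms(3) by simp
  qed (use e(1) assms(2) in simp)
qed

lemma germ_shift:
  assumes "germ d F x s" "\<And>y. F (y + c) = F y + c'"
  shows "germ d F (x + c) s"
proof -
  obtain e where e: "e > 0" "\<And>h. 0 \<le> h \<Longrightarrow> h \<le> e \<Longrightarrow> F (x + d * h) = F x + s * (d * h)"
    using germE[OF assms(1)] by blast
  show ?thesis
  proof (rule germI[OF e(1)])
    fix h assume "0 \<le> h" "h \<le> e"
    then show "F (x + c + d * h) = F (x + c) + s * (d * h)"
      using e(2)[of h] assms(2)[of x] assms(2)[of "x + d * h"] by (simp add: algebra_simps)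
  qed
qed

section \<open>The ring \<int>[1/m] and the group of slopes\<close>

locale PL_base =
  fixes m :: nat
  assumes m_ge_2: "m \<ge> 2"
begin

abbreviation "D \<equiv> Z_inverse m"
abbreviation "slopes \<equiv> int_powers m"

lemma int_powers_pos: "s \<in> slopes \<Longrightarrow> s > 0"
  using m_ge_2 by (auto simp: int_powers_def)

lemma int_powers_mult:
  assumes "s \<in> slopes" "t \<in> slopes"
  shows "s * t \<in> slopes"
proof -
  obtain j k where "s = real m powi j" "t = real m powi k"
    using assms unfolding int_powers_def by auto
  then have "s * t = real m powi (j + k)" using m_ge_2 by (simp add: power_int_add)
  then show ?thesis unfolding int_powers_def by blast
qed

lemma one_int_powers: "1 \<in> slopes"
  unfolding int_powers_def by (auto intro: exI[of _ 0])

lemma int_powers_inverse: "s \<in> slopes \<Longrightarrow> 1 / s \<in> slopes"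
proof -
  assume "s \<in> slopes"
  then obtain k where "s = real m powi k" unfolding int_powers_def by auto
  then have "1 / s = real m powi (- k)" by (simp add: power_int_minus divide_inverse)
  then show ?thesis unfolding int_powers_def by blast
qed

lemma power_int_powers: "real m ^ n \<in> slopes"
proof -
  have "real m ^ n = real m powi (int n)" by simp
  then show ?thesis unfolding int_powers_def by blast
qed

text \<open>Clearing denominators with a natural exponent turns closure under the ring operations
  into integer arithmetic.\<close>

lemma Z_inverse_iff: "x \<in> D \<longleftrightarrow> (\<exists>N::int. \<exists>n::nat. x * real m ^ n = of_int N)"
proof
  assume "x \<in> D"
  then obtain N s where x: "x = of_int N * real m powi s" unfolding Z_inverse_def by auto
  show "\<exists>N::int. \<exists>n::nat. x * real m ^ n = of_int N"
  proof (cases "s \<ge> 0")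
    case True
    then have "x * real m ^ 0 = of_int (N * int m ^ nat s)" using x by (simp add: power_int_def)
    then show ?thesis by blast
  next
    case False
    then have "x = of_int N * inverse (real m ^ nat (- s))" using x by (simp add: power_int_def power_inverse)
    then have "x * real m ^ nat (- s) = of_int N" using m_ge_2 by simp
    then show ?thesis by blast
  qed
next
  assume "\<exists>N::int. \<exists>n::nat. x * real m ^ n = of_int N"
  then obtain N n where "x * real m ^ n = of_int N" by blast
  then have "x = of_int N * inverse (real m ^ n)" using m_ge_2 by (simp add: field_simps)
  then have "x = of_int N * real m powi (- int n)"
    by (simp add: power_int_minus)
  then show "x \<in> D" unfolding Z_inverse_def by blast
qed

lemma Z_inverse_add [intro]: "x \<in> D \<Longrightarrow> y \<in> D \<Longrightarrow> x + y \<in> D"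
proof -
  assume "x \<in> D" "y \<in> D"
  then obtain N n M k where "x * real m ^ n = of_int N" "y * real m ^ k = of_int M"
    unfolding Z_inverse_iff by blast
  moreover have "(x + y) * real m ^ (n + k) = (x * real m ^ n) * real m ^ k + (y * real m ^ k) * real m ^ n"
    by (simp add: algebra_simps power_add)
  ultimately have "(x + y) * real m ^ (n + k) = of_int (N * int m ^ k + M * int m ^ n)"
    by simp
  then show ?thesis unfolding Z_inverse_iff by blast
qed

lemma Z_inverse_mult [intro]: "x \<in> D \<Longrightarrow> y \<in> D \<Longrightarrow> x * y \<in> D"
proof -
  assume "x \<in> D" "y \<in> D"
  then obtain N n M k where "x * real m ^ n = of_int N" "y * real m ^ k = of_int M"
    unfolding Z_inverse_iff by blast
  moreover have "(x * y) * real m ^ (n + k) = (x * real m ^ n) * (y * real m ^ k)"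
    by (simp add: algebra_simps power_add)
  ultimately have "(x * y) * real m ^ (n + k) = of_int (N * M)"
    by simp
  then show ?thesis unfolding Z_inverse_iff by blast
qed

lemma Z_inverse_of_int [simp, intro]: "of_int N \<in> D"
proof -
  have "of_int N * real m ^ 0 = of_int N" by simp
  then show ?thesis unfolding Z_inverse_iff by blast
qed

lemma Z_inverse_of_nat [simp, intro]: "real N \<in> D"
  using Z_inverse_of_int[of "int N"] by simp

lemma Z_inverse_0 [simp, intro]: "0 \<in> D" using Z_inverse_of_int[of 0] by simp
lemma Z_inverse_1 [simp, intro]: "1 \<in> D" using Z_inverse_of_int[of 1] by simp
lemma Z_inverse_numeral [simp, intro]: "numeral n \<in> D"
  using Z_inverse_of_int[of "numeral n"] by simp

lemma Z_inverse_minus [intro]: "x \<in> D \<Longrightarrow> - x \<in> D"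
  using Z_inverse_mult[of "-1" x] Z_inverse_of_int[of "-1"] by simp

lemma Z_inverse_diff [intro]: "x \<in> D \<Longrightarrow> y \<in> D \<Longrightarrow> x - y \<in> D"
  using Z_inverse_add[of x "- y"] Z_inverse_minus[of y] by simp

lemma Z_inverse_int_powers: "s \<in> slopes \<Longrightarrow> s \<in> D"
  unfolding int_powers_def Z_inverse_def by clarsimp (metis mult_1 of_int_1)

lemma Z_inverse_mult_int_powers_iff:
  "s \<in> slopes \<Longrightarrow> s * x \<in> D \<longleftrightarrow> x \<in> D"
proof -
  assume s: "s \<in> slopes"
  have "x = (1 / s) * (s * x)" using int_powers_pos[OF s] by simp
  then show ?thesis
    by (metis Z_inverse_int_powers Z_inverse_mult int_powers_inverse s)
qed

lemma Z_inverse_add_iff: "y \<in> D \<Longrightarrow> x + y \<in> D \<longleftrightarrow> x \<in> D"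
  using Z_inverse_diff[of "x + y" y] by auto

lemma Z_inverse_add_iff': "y \<in> D \<Longrightarrow> y + x \<in> D \<longleftrightarrow> x \<in> D"
  using Z_inverse_add_iff[of y x] by (simp add: add.commute)

lemma small_power:
  assumes "e > 0" obtains n where "1 / real m ^ n < e"
proof -
  obtain n where "(1 / real m) ^ n < e"
    using real_arch_pow_inv[of e "1 / real m"] assms m_ge_2 by auto
  then show ?thesis using that by (simp add: power_divide)
qed

lemma Z_inverse_dense:
  assumes "a < b" obtains x where "x \<in> D" "a < x" "x < b"
proof -
  obtain n where n: "1 / real m ^ n < b - a" using small_power[of "b - a"] assms by auto
  have p: "real m ^ n > 0" using m_ge_2 by simp
  define N where "N = \<lfloor>a * real m ^ n\<rfloor> + 1"
  have 1: "a * real m ^ n < of_int N" "of_int N \<le> a * real m ^ n + 1"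
    unfolding N_def by linarith+
  define x where "x = of_int N / real m ^ n"
  have "x * real m ^ n = of_int N" using p by (simp add: x_def)
  then have "x \<in> D" unfolding Z_inverse_iff by blast
  moreover have "a < x" using 1 p by (simp add: x_def field_simps)
  moreover have "x < b"
  proof -
    have "x \<le> a + 1 / real m ^ n" using 1(2) p by (simp add: x_def field_simps)
    then show ?thesis using n by simp
  qed
  ultimately show ?thesis using that by blast
qed

section \<open>Piecewise affine homeomorphisms of the line\<close>

lemma PL_homeoD:
  assumes "F \<in> PL_homeo m"
  shows "strict_mono F" "surj F" "inj F" "bij F" "F x \<in> D \<longleftrightarrow> x \<in> D"
  using assms strict_mono_imp_inj_on[of F] unfolding PL_homeo_def bij_def by auto

lemma PL_homeo_germ:
  assumes "F \<in> PL_homeo m"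
  obtains s t where "s \<in> slopes" "t \<in> slopes" "germ_left F x s" "germ_right F x t"
    "s = t \<or> x \<in> D"
  using assms unfolding PL_homeo_def by blast

lemma PL_homeoI:
  assumes "strict_mono F" "surj F" "\<And>x. F x \<in> D \<longleftrightarrow> x \<in> D"
    "\<And>x. PL_germs m F x"
  shows "F \<in> PL_homeo m"
  using assms unfolding PL_homeo_def by blast

lemma PL_homeo_comp:
  assumes F: "F \<in> PL_homeo m" and G: "G \<in> PL_homeo m"
  shows "F \<circ> G \<in> PL_homeo m"
proof (rule PL_homeoI)
  show "strict_mono (F \<circ> G)"
    using PL_homeoD(1)[OF F] PL_homeoD(1)[OF G] by (simp add: strict_mono_def)
  show "surj (F \<circ> G)" by (rule comp_surj[OF PL_homeoD(2)[OF G] PL_homeoD(2)[OF F]])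
  show "(F \<circ> G) x \<in> D \<longleftrightarrow> x \<in> D" for x
    using PL_homeoD(5)[OF F] PL_homeoD(5)[OF G] by simp
  show "PL_germs m (F \<circ> G) x" for x
  proof -
    obtain s t where st: "s \<in> slopes" "t \<in> slopes" "germ_left G x s" "germ_right G x t"
    "s = t \<or> x \<in> D" using PL_homeo_germ[OF G] by blast
    obtain s' t' where st': "s' \<in> slopes" "t' \<in> slopes" "germ_left F (G x) s'"
      "germ_right F (G x) t'" "s' = t' \<or> G x \<in> D" using PL_homeo_germ[OF F] by blast
    show ?thesis
      using germ_comp[OF st'(3) st(3)] germ_comp[OF st'(4) st(4)] st(1,2,5) st'(1,2,5)
        int_powers_mult PL_homeoD(5)[OF G] int_powers_pos by metis
  qed
qed

lemma PL_homeo_inv: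
  assumes F: "F \<in> PL_homeo m"
  shows "finv F \<in> PL_homeo m"
proof (rule PL_homeoI)
  have FF: "F (finv F x) = x" for x using PL_homeoD(2)[OF F] by (simp add: surj_f_inv_f)
  show "strict_mono (finv F)"
    using PL_homeoD(1)[OF F] FF by (metis strict_mono_def strict_mono_less)
  show "surj (finv F)" using PL_homeoD(3)[OF F] by (simp add: inj_imp_surj_inv)
  show "finv F x \<in> D \<longleftrightarrow> x \<in> D" for x
    using PL_homeoD(5)[OF F, of "finv F x"] FF by simp
  show "PL_germs m (finv F) x" for x
  proof -
    obtain s t where st: "s \<in> slopes" "t \<in> slopes" "germ_left F (finv F x) s"
      "germ_right F (finv F x) t" "s = t \<or> finv F x \<in> D" using PL_homeo_germ[OF F] by blast
    show ?thesis
      using germ_inv[OF st(3)] germ_inv[OF st(4)] st(1,2,5) FF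
        int_powers_inverse PL_homeoD(3)[OF F] int_powers_pos PL_homeoD(5)[OF F, of "finv F x"] by metis
  qed
qed

lemma PL_homeo_affine:
  assumes "s \<in> slopes" "b \<in> D"
  shows "(\<lambda>x. s * x + b) \<in> PL_homeo m"
proof (rule PL_homeoI)
  have s: "s > 0" using int_powers_pos assms(1) .
  show "strict_mono (\<lambda>x. s * x + b)" using s by (simp add: strict_mono_def)
  show "surj (\<lambda>x. s * x + b)"
  proof (rule surjI)
    fix y show "s * ((y - b) / s) + b = y" using s by simp
  qed
  show "s * x + b \<in> D \<longleftrightarrow> x \<in> D" for x
    using Z_inverse_add_iff[OF assms(2)] Z_inverse_mult_int_powers_iff[OF assms(1)] by simp
  have "germ_left (\<lambda>x. s * x + b) x s" "germ_right (\<lambda>x. s * x + b) x s" for x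
    by (rule germI[of 1]; simp add: algebra_simps)+
  then show "PL_germs m (\<lambda>x. s * x + b) x" for x using assms(1) by blast
qed

lemma PL_homeo_translation: "b \<in> D \<Longrightarrow> (\<lambda>x. x + b) \<in> PL_homeo m"
  using PL_homeo_affine[OF one_int_powers] by simp

lemma PL_homeo_id: "(\<lambda>x. x) \<in> PL_homeo m"
  using PL_homeo_translation[of 0] by simp

text \<open>A new break can appear only at \<open>a\<close>, and it is admissible because
  \<open>a\<close> lies in \<int>[1/m].\<close>

lemma PL_homeo_glue:
  assumes F: "F \<in> PL_homeo m" and G: "G \<in> PL_homeo m" and a: "a \<in> D" "F a = G a"
  shows "(\<lambda>x. if x \<le> a then F x else G x) \<in> PL_homeo m" (is "?K \<in> _")
proof (rule PL_homeoI)
  note sF = PL_homeoD(1)[OF F] and sG = PL_homeoD(1)[OF G]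
  show "strict_mono ?K"
  proof (rule strict_monoI)
    fix x y :: real assume "x < y"
    moreover have "F x \<le> F a" if "x \<le> a" using sF that by (simp add: strict_mono_less_eq)
    moreover have "F a < G y" if "\<not> y \<le> a" using sG that a(2) by (simp add: strict_mono_less)
    ultimately show "?K x < ?K y" using sF sG by (fastforce simp: strict_mono_less)
  qed
  show "surj ?K"
  proof (rule surjI)
    fix y show "?K (if y \<le> F a then finv F y else finv G y) = y"
    proof (cases "y \<le> F a")
      case True
      have "F (finv F y) = y" using PL_homeoD(2)[OF F] by (simp add: surj_f_inv_f)
      then have "finv F y \<le> a" using sF True by (metis strict_mono_less_eq)
      then show ?thesis using True \<open>F (finv F y) = y\<close> by simp
    next
      case False
      have "G (finv G y) = y" using PL_homeoD(2)[OF G] by (simp add: surj_f_inv_f)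
      then have "\<not> finv G y \<le> a" using sG False a(2) by (metis strict_mono_less_eq)
      then show ?thesis using False \<open>G (finv G y) = y\<close> by simp
    qed
  qed
  show "?K x \<in> D \<longleftrightarrow> x \<in> D" for x
    using PL_homeoD(5)[OF F] PL_homeoD(5)[OF G] by simp
  fix x
  obtain s t where st: "s \<in> slopes" "t \<in> slopes" "germ_left F x s" "germ_right F x t"
    "s = t \<or> x \<in> D" using PL_homeo_germ[OF F] by blast
  obtain s' t' where st': "s' \<in> slopes" "t' \<in> slopes" "germ_left G x s'"
      "germ_right G x t'" "s' = t' \<or> x \<in> D" using PL_homeo_germ[OF G] by blast
  have 1: "germ_left ?K x s" if "x \<le> a"
    by (rule germ_cong[OF st(3), of 1]) (use that in auto)
  have 2: "germ_right ?K x t" if "x < a"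
    by (rule germ_cong[OF st(4), of "a - x"]) (use that in auto)
  have 3: "germ_left ?K x s'" if "x > a"
    by (rule germ_cong[OF st'(3), of "(x - a) / 2"]) (use that in \<open>auto simp: field_simps\<close>)
  have 4: "germ_right ?K x t'" if "x \<ge> a"
    by (rule germ_cong[OF st'(4), of 1]) (use that a(2) order_antisym in fastforce)+
  show "PL_germs m ?K x"
    using 1 2 3 4 st(1,2,5) st'(1,2,5) a(1)
    by (metis linorder_neq_iff order_less_imp_le order_refl)
qed


text \<open>Stretching the last unit interval by the slope \<open>m\<close> adds
  \<open>m - 1\<close> to the length; this is done \<open>k\<close> times.\<close>

lemma PL_homeo_ex_fix0_integer:
  assumes "N \<ge> 1"
  shows "\<exists>F\<in>PL_homeo m. F 0 = 0 \<and> F (real N) = real (N + k * (m - 1))"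
proof (induction k)
  case 0
  then show ?case using PL_homeo_id by (intro bexI[of _ "\<lambda>x. x"]) auto
next
  case (Suc k)
  then obtain F where F: "F \<in> PL_homeo m" "F 0 = 0" "F (real N) = real (N + k * (m - 1))" by blast
  define M where "M = N + k * (m - 1)"
  \<comment> \<open>The second intercept makes the branches meet at \<open>M - 1\<close>, the left
    end of the last unit interval.\<close>
  define G where "G = (\<lambda>x. if x \<le> real M - 1 then x else real m * x + (real M - 1) * (1 - real m))"
  have "(real M - 1) \<in> D" by (intro Z_inverse_diff) auto
  moreover have "(real M - 1) * (1 - real m) \<in> D"
    by (intro Z_inverse_diff Z_inverse_mult) auto
  ultimately have G: "G \<in> PL_homeo m" unfolding G_def
    using power_int_powers[of 1]
    by (intro PL_homeo_glue PL_homeo_affine PL_homeo_id) (auto simp: algebra_simps)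
  have "M \<ge> 1" using assms M_def by simp
  then have "G 0 = 0" by (simp add: G_def)
  moreover have "G (real M) = real (N + Suc k * (m - 1))"
  proof -
    have "N + Suc k * (m - 1) = M + (m - 1)" by (simp add: M_def)
    then have "real (N + Suc k * (m - 1)) = real M + (real m - 1)"
      using m_ge_2 by (simp add: of_nat_diff)
    then show ?thesis by (simp add: G_def algebra_simps)
  qed
  ultimately show ?case
    using PL_homeo_comp[OF G F(1)] F(2,3) M_def by (intro bexI[of _ "G \<circ> F"]) auto
qed

text \<open>A dilation by a large power of \<open>m\<close> makes \<open>u\<close>, \<open>v\<close>
  and \<open>z\<close> integers at once; conjugating the integer case by it gives the map.\<close>

lemma PL_homeo_ex_fix0:
  assumes "u \<in> D" "v \<in> D" "0 < u" "u \<le> v" "z \<in> D"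
    "v - u = (real m - 1) * z"
  shows "\<exists>F\<in>PL_homeo m. F 0 = 0 \<and> F u = v"
proof -
  obtain N1 M1 Z1 n1 n2 n3 where n: "u * real m ^ n1 = of_int N1" "v * real m ^ n2 = of_int M1"
    "z * real m ^ n3 = of_int Z1"
    using assms(1,2,5) unfolding Z_inverse_iff by blast
  define s where "s = real m ^ (n1 + n2 + n3)"
  define N where "N = nat (N1 * int m ^ (n2 + n3))"
  define k where "k = nat (Z1 * int m ^ (n1 + n2))"
  have s: "s \<in> slopes" "s > 0" unfolding s_def using power_int_powers int_powers_pos by blast+
  have us: "s * u = of_int (N1 * int m ^ (n2 + n3))"
    using n(1) by (simp add: s_def power_add mult.assoc mult.commute mult.left_commute)
  have zs: "s * z = of_int (Z1 * int m ^ (n1 + n2))"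
    using n(3) by (simp add: s_def power_add mult.assoc mult.commute mult.left_commute)
  have "s * u > 0" using s assms by simp
  then have N: "s * u = real N" "N \<ge> 1" using us unfolding N_def by linarith+
  have "(real m - 1) * z \<ge> 0" using assms by simp
  then have "z \<ge> 0" using m_ge_2 by (auto simp: zero_le_mult_iff)
  then have "s * z \<ge> 0" using s by simp
  then have k: "s * z = real k" using zs unfolding k_def by linarith
  have "s * (v - u) = s * ((real m - 1) * z)" using assms(6) by simp
  then have "s * v = s * u + (real m - 1) * (s * z)" by (simp add: algebra_simps)
  then have "s * v = real (N + k * (m - 1))" using N k m_ge_2 by (simp add: of_nat_diff)
  moreover obtain F where F: "F \<in> PL_homeo m" "F 0 = 0" "F (real N) = real (N + k * (m - 1))"
    using PL_homeo_ex_fix0_integer N(2) by blast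
  ultimately have "F (s * u) = s * v" using N by simp
  define S where "S = (\<lambda>x. s * x + 0)"
  have S: "S \<in> PL_homeo m" unfolding S_def using PL_homeo_affine[OF s(1) Z_inverse_0] .
  have "finv S \<circ> (F \<circ> S) \<in> PL_homeo m" using F(1) S PL_homeo_comp PL_homeo_inv by blast
  moreover have "(finv S \<circ> (F \<circ> S)) 0 = finv S (S 0)" using F(2) by (simp add: S_def)
  moreover have "(finv S \<circ> (F \<circ> S)) u = finv S (S v)" using \<open>F (s * u) = s * v\<close> by (simp add: S_def)
  moreover have "finv S (S w) = w" for w using PL_homeoD(3)[OF S] by simp
  ultimately show ?thesis by (intro bexI[of _ "finv S \<circ> (F \<circ> S)"]) simp_all
qed

lemma PL_homeo_interval:
  assumes "a \<in> D" "b \<in> D" "c \<in> D" "d \<in> D"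
    "a < b" "c < d" "z \<in> D" "(d - c) - (b - a) = (real m - 1) * z"
  obtains F where "F \<in> PL_homeo m" "F a = c" "F b = d"
proof -
  have "\<exists>F\<in>PL_homeo m. F 0 = 0 \<and> F (b - a) = d - c"
  proof (cases "b - a \<le> d - c")
    case True
    then show ?thesis
      using PL_homeo_ex_fix0[of "b - a" "d - c" z] assms by (simp add: Z_inverse_diff)
  next
    \<comment> \<open>Only lengthening maps have been built; a shortening one is the inverse of such
      a map, with \<open>z\<close> changing sign.\<close>
    case False
    have "(b - a) - (d - c) = (real m - 1) * (- z)" using assms(8) by (simp add: algebra_simps)
    then obtain F where F: "F \<in> PL_homeo m" "F 0 = 0" "F (d - c) = b - a"
      using PL_homeo_ex_fix0[of "d - c" "b - a" "- z"] assms False by (auto simp: Z_inverse_diff Z_inverse_minus)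
    have "finv F (F w) = w" for w using PL_homeoD(3)[OF F(1)] by simp
    from this[of 0] this[of "d - c"] show ?thesis using F PL_homeo_inv by (intro bexI[of _ "finv F"]) simp_all
  qed
  then obtain F where F: "F \<in> PL_homeo m" "F 0 = 0" "F (b - a) = d - c" by blast
  have "(\<lambda>x. x + c) \<circ> (F \<circ> (\<lambda>x. x + - a)) \<in> PL_homeo m"
    using F(1) assms by (intro PL_homeo_comp PL_homeo_translation) auto
  then show ?thesis using that F by fastforce
qed

subsection \<open>Periodic extension\<close>

text \<open>The fundamental domain is \<open>[a, a + c)\<close>. The periods \<open>c\<close> and
  \<open>d\<close> may differ, because these extensions also serve as conjugacies between
  translations by different amounts.\<close>

definition periodic_ext :: "real \<Rightarrow> real \<Rightarrow> real \<Rightarrow> (real \<Rightarrow> real) \<Rightarrow> real \<Rightarrow> real" where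
  "periodic_ext a c d F x = F (x - c * of_int \<lfloor>(x - a) / c\<rfloor>) + d * of_int \<lfloor>(x - a) / c\<rfloor>"

lemma periodic_ext_shift:
  assumes "c > 0"
  shows "periodic_ext a c d F (x + c) = periodic_ext a c d F x + d"
proof -
  have "(x + c - a) / c = (x - a) / c + 1" using assms by (simp add: field_simps)
  then have "\<lfloor>(x + c - a) / c\<rfloor> = \<lfloor>(x - a) / c\<rfloor> + 1" by simp
  then show ?thesis by (simp add: periodic_ext_def algebra_simps)
qed

text \<open>The closed right end is included, since the two neighbouring formulas agree there by
  \<open>F (a + c) = F a + d\<close>. The germs at the seams depend on this.\<close>

lemma periodic_ext_eq_shifted:
  assumes "c > 0" "F (a + c) = F a + d" "a + c * of_int n \<le> x" "x \<le> a + c * of_int (n + 1)"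
  shows "periodic_ext a c d F x = F (x - c * of_int n) + d * of_int n"
proof (cases "x = a + c * of_int (n + 1)")
  case True
  then have "(x - a) / c = of_int (n + 1)" using assms(1) by simp
  then have "\<lfloor>(x - a) / c\<rfloor> = n + 1" by linarith
  then have "periodic_ext a c d F x = F a + d * of_int (n + 1)"
    using True by (simp add: periodic_ext_def)
  moreover have "x - c * of_int n = a + c" using True by (simp add: algebra_simps)
  ultimately show ?thesis using assms(2) by (simp add: algebra_simps)
next
  case False
  then have "of_int n \<le> (x - a) / c" "(x - a) / c < of_int n + 1"
    using assms by (simp_all add: field_simps)
  then have "\<lfloor>(x - a) / c\<rfloor> = n" by linarith
  then show ?thesis by (simp add: periodic_ext_def)
qed

lemma periodic_ext_eq:
  assumes "c > 0" "F (a + c) = F a + d" "a \<le> x" "x \<le> a + c"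
  shows "periodic_ext a c d F x = F x"
  using periodic_ext_eq_shifted[of c F a d 0 x] assms by simp

text \<open>On each translate of the fundamental domain the extension is a homeomorphism
  \<open>K n\<close> of the same kind. Only the left germ at a seam needs the neighbour
  \<open>K (n - 1)\<close>, and the seams lie in \<int>[1/m].\<close>

lemma PL_homeo_periodic_ext:
  assumes F: "F \<in> PL_homeo m" and D: "a \<in> D" "c \<in> D" "d \<in> D"
    and c: "c > 0" and eq: "F (a + c) = F a + d"
  shows "periodic_ext a c d F \<in> PL_homeo m" (is "?K \<in> _")
proof (rule PL_homeoI)
  note sF = PL_homeoD(1)[OF F]
  have d: "d > 0" using strict_monoD[OF sF, of a "a + c"] eq c by simp
  define K where "K n = (\<lambda>x. x + d * of_int n) \<circ> (F \<circ> (\<lambda>x. x + - (c * of_int n)))" for n :: int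
  have K: "K n \<in> PL_homeo m" for n
    unfolding K_def using F D by (intro PL_homeo_comp PL_homeo_translation) auto
  have KK: "?K x = K n x" if "a + c * of_int n \<le> x" "x \<le> a + c * of_int (n + 1)" for n x
    using periodic_ext_eq_shifted[of c F a d n x, OF c eq that] by (simp add: K_def)
  have fl: "a + c * of_int \<lfloor>(x - a) / c\<rfloor> \<le> x" "x < a + c * of_int (\<lfloor>(x - a) / c\<rfloor> + 1)" for x
  proof -
    have "of_int \<lfloor>(x - a) / c\<rfloor> \<le> (x - a) / c" "(x - a) / c < of_int (\<lfloor>(x - a) / c\<rfloor> + 1)" by linarith+
    then have "of_int \<lfloor>(x - a) / c\<rfloor> * c \<le> x - a" "x - a < of_int (\<lfloor>(x - a) / c\<rfloor> + 1) * c"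
      using c by (simp_all only: pos_le_divide_eq pos_divide_less_eq)
    then show "a + c * of_int \<lfloor>(x - a) / c\<rfloor> \<le> x" "x < a + c * of_int (\<lfloor>(x - a) / c\<rfloor> + 1)"
      by (simp_all only: mult.commute)
  qed
  show "strict_mono ?K"
  proof (rule strict_monoI)
    fix x y :: real assume xy: "x < y"
    define p where "p = \<lfloor>(x - a) / c\<rfloor>"
    define q where "q = \<lfloor>(y - a) / c\<rfloor>"
    have x: "?K x = K p x" "x < a + c * of_int (p + 1)" using KK fl[of x] p_def by auto
    have y: "?K y = K q y" "a + c * of_int q \<le> y" using KK fl[of y] q_def by auto
    have pq: "p \<le> q" unfolding p_def q_def using xy c by (intro floor_mono divide_right_mono) auto
    show "?K x < ?K y"
    proof (cases "p = q")
      case True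
      then show ?thesis using x y xy strict_monoD[OF PL_homeoD(1)[OF K]] by simp
    next
      case False
      have "x - c * of_int p < a + c" using x(2) by (simp add: algebra_simps)
      then have "F (x - c * of_int p) < F a + d" using sF eq by (metis strict_mono_less)
      then have "K p x < F a + d * (of_int p + 1)" by (simp add: K_def algebra_simps)
      also have "\<dots> \<le> F a + d * of_int q" using d pq False by (simp add: of_int_add[symmetric] del: of_int_add)
      also have "F a \<le> F (y - c * of_int q)" using y(2) sF by (simp add: strict_mono_less_eq)
      then have "F a + d * of_int q \<le> K q y" by (simp add: K_def)
      finally show ?thesis using x y by simp
    qed
  qed
  show "surj ?K"
  proof (unfold surj_def, rule allI)
    fix y
    define n where "n = \<lfloor>(y - F a) / d\<rfloor>"
    have "of_int n \<le> (y - F a) / d" "(y - F a) / d < of_int (n + 1)" unfolding n_def by linarith+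
    then have n: "F a \<le> y - d * of_int n" "y - d * of_int n < F (a + c)"
      using d eq by (simp_all add: field_simps)
    define w where "w = finv F (y - d * of_int n)"
    have w: "F w = y - d * of_int n" using PL_homeoD(2)[OF F] by (simp add: w_def surj_f_inv_f)
    then have "a \<le> w" "w < a + c" using n sF by (metis strict_mono_less_eq, metis strict_mono_less)
    then have "?K (w + c * of_int n) = K n (w + c * of_int n)"
      by (intro KK) (auto simp: algebra_simps)
    then have "y = ?K (w + c * of_int n)" using w by (simp add: K_def)
    then show "\<exists>x. y = ?K x" by blast
  qed
  show "?K x \<in> D \<longleftrightarrow> x \<in> D" for x
    using KK[of "\<lfloor>(x - a) / c\<rfloor>" x] fl[of x] PL_homeoD(5)[OF K] by simp
  show "PL_germs m ?K x" for x
  proof -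
    define n where "n = \<lfloor>(x - a) / c\<rfloor>"
    have n: "a + c * of_int n \<le> x" "x < a + c * of_int (n + 1)" using fl[of x] n_def by auto
    obtain s t where st: "s \<in> slopes" "t \<in> slopes" "germ_left (K n) x s"
      "germ_right (K n) x t" "s = t \<or> x \<in> D" using PL_homeo_germ[OF K] by blast
    obtain s' t' where st': "s' \<in> slopes" "t' \<in> slopes" "germ_left (K (n - 1)) x s'"
      "germ_right (K (n - 1)) x t'" "s' = t' \<or> x \<in> D" using PL_homeo_germ[OF K] by blast
    have 1: "germ_right ?K x t"
      by (rule germ_cong[OF st(4), of "a + c * of_int (n + 1) - x"]) (use n KK[of n] in auto)
    show ?thesis
    proof (cases "x = a + c * of_int n")
      case False
      have "germ_left ?K x s"
        by (rule germ_cong[OF st(3), of "x - (a + c * of_int n)"]) (use n KK[of n] False in auto)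
      then show ?thesis using 1 st by blast
    next
      case True
      have "x \<in> D" using True D by auto
      moreover have "germ_left ?K x s'"
        by (rule germ_cong[OF st'(3), of c]) (use KK[of "n - 1"] True c in \<open>auto simp: algebra_simps\<close>)
      ultimately show ?thesis using 1 st st' by blast
    qed
  qed
qed

subsection \<open>Finite subdivisions\<close>

text \<open>Subdivisions are chains for the reflexive transitive closure of this relation: they
  concatenate by transitivity, and sums over pieces become inductions.\<close>

definition affine_step :: "(real \<Rightarrow> real) \<Rightarrow> real \<Rightarrow> real \<Rightarrow> bool" where
  "affine_step F x y \<longleftrightarrow> x < y \<and> x \<in> D \<and> y \<in> D \<and>
     (\<exists>s\<in>slopes. \<forall>w\<in>{x..y}. F w = F x + s * (w - x))"

text \<open>The expansion may be centred at any \<open>t\<close>, even one outside \<int>[1/m]; the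
  case \<open>x = y\<close> is the empty chain.\<close>

lemma affine_stepI:
  assumes "x \<le> y" "x \<in> D" "y \<in> D" "s \<in> slopes"
    "\<And>w. x \<le> w \<Longrightarrow> w \<le> y \<Longrightarrow> F w = b + s * (w - t)"
  shows "(affine_step F)\<^sup>*\<^sup>* x y"
proof (cases "x = y")
  case False
  have "F w = F x + s * (w - x)" if "w \<in> {x..y}" for w
  proof -
    have "F w = b + s * (w - t)" "F x = b + s * (x - t)" using assms(1,5) that by auto
    then show ?thesis by (simp add: algebra_simps)
  qed
  moreover have "x < y" using False assms(1) by simp
  ultimately have "affine_step F x y" unfolding affine_step_def using assms(2-4) by blast
  then show ?thesis by blast
qed simp

text \<open>Compactness of \<open>[x, y]\<close>, in the form of Bolzano's principle: the two germs
  at a point give chains near it.\<close>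

lemma affine_chain:
  assumes F: "F \<in> PL_homeo m" and xy: "x \<in> D" "y \<in> D" "x \<le> y"
  shows "(affine_step F)\<^sup>*\<^sup>* x y"
proof -
  define P where "P u v \<longleftrightarrow> (\<exists>h>0. \<forall>x\<in>D. \<forall>y\<in>D.
    u - h \<le> x \<and> x \<le> y \<and> y \<le> v + h \<longrightarrow> (affine_step F)\<^sup>*\<^sup>* x y)" for u v :: real
  \<comment> \<open>The slack \<open>h\<close> allows chains to be joined near \<open>v\<close> even if \<open>v\<close> itself is not in \<open>\<int>[1/m]\<close>.\<close>
  have "P x y" using xy(3)
  proof (induction rule: Bolzano)
    case (trans u v w)
    obtain h where h: "h > 0" "\<And>x y. x \<in> D \<Longrightarrow> y \<in> D \<Longrightarrow> u - h \<le> x \<Longrightarrow> x \<le> y \<Longrightarrow>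
      y \<le> v + h \<Longrightarrow> (affine_step F)\<^sup>*\<^sup>* x y" using trans(1) unfolding P_def by blast
    obtain k where k: "k > 0" "\<And>x y. x \<in> D \<Longrightarrow> y \<in> D \<Longrightarrow> v - k \<le> x \<Longrightarrow> x \<le> y \<Longrightarrow>
      y \<le> w + k \<Longrightarrow> (affine_step F)\<^sup>*\<^sup>* x y" using trans(2) unfolding P_def by blast
    define l where "l = min h k"
    have l: "l > 0" "l \<le> h" "l \<le> k" using h k by (auto simp: l_def)
    obtain z where z: "z \<in> D" "v - l < z" "z < v + l"
      using Z_inverse_dense[of "v - l" "v + l"] l by auto
    show ?case unfolding P_def
    proof (intro exI[of _ l] conjI ballI impI)
      fix x y assume xy: "x \<in> D" "y \<in> D" "u - l \<le> x \<and> x \<le> y \<and> y \<le> w + l"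
      consider "y \<le> z" | "z \<le> x" | "x \<le> z" "z \<le> y" by linarith
      then show "(affine_step F)\<^sup>*\<^sup>* x y"
      proof cases
        case 3
        have "(affine_step F)\<^sup>*\<^sup>* x z" using h(2)[of x z] xy z l 3 by auto
        moreover have "(affine_step F)\<^sup>*\<^sup>* z y" using k(2)[of z y] xy z l 3 by auto
        ultimately show ?thesis by simp
      qed (use h(2)[of x y] k(2)[of x y] xy z l in auto)
    qed (use l in simp)
  next
    case (local t)
    obtain s s' where s: "s \<in> slopes" "s' \<in> slopes" "germ_left F t s"
      "germ_right F t s'" "s = s' \<or> t \<in> D" using PL_homeo_germ[OF F] by blast
    obtain e where e: "e > 0" "\<And>y. t - e \<le> y \<Longrightarrow> y \<le> t \<Longrightarrow> F y = F t + s * (y - t)"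
      using germ_leftE[OF s(3)] by blast
    obtain e' where e': "e' > 0" "\<And>y. t \<le> y \<Longrightarrow> y \<le> t + e' \<Longrightarrow> F y = F t + s' * (y - t)"
      using germ_rightE[OF s(4)] by blast
    define l where "l = min e e'"
    have l: "l > 0" "l \<le> e" "l \<le> e'" using e(1) e'(1) by (simp_all add: l_def)
    have main: "(affine_step F)\<^sup>*\<^sup>* x y"
      if xy: "x \<in> D" "y \<in> D" "x \<le> y" "t - l \<le> x" "y \<le> t + l" for x y
    proof -
      \<comment> \<open>A chain across \<open>t\<close> breaks there if \<open>t\<close> lies in
        \<int>[1/m]; otherwise \<open>s = s'\<close> and a single step runs over
        \<open>t\<close>.\<close>
      consider "y \<le> t" | "t \<le> x" | "x < t" "t < y" "t \<in> D" | "x < t" "t < y" "s = s'"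
        using s(5) by linarith
      then show ?thesis
      proof cases
        case 1
        have "F w = F t + s * (w - t)" if "x \<le> w" "w \<le> y" for w
          by (rule e(2)) (use that l xy 1 in linarith)+
        then show ?thesis by (rule affine_stepI[OF xy(3,1,2) s(1)])
      next
        case 2
        have "F w = F t + s' * (w - t)" if "x \<le> w" "w \<le> y" for w
          by (rule e'(2)) (use that l xy 2 in linarith)+
        then show ?thesis by (rule affine_stepI[OF xy(3,1,2) s(2)])
      next
        case 3
        have "F w = F t + s * (w - t)" if "x \<le> w" "w \<le> t" for w
          by (rule e(2)) (use that l xy 3 in linarith)+
        then have "(affine_step F)\<^sup>*\<^sup>* x t"
          by (rule affine_stepI[OF less_imp_le[OF 3(1)] xy(1) 3(3) s(1)])
        moreover have "F w = F t + s' * (w - t)" if "t \<le> w" "w \<le> y" for w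
          by (rule e'(2)) (use that l xy 3 in linarith)+
        then have "(affine_step F)\<^sup>*\<^sup>* t y"
          by (rule affine_stepI[OF less_imp_le[OF 3(2)] 3(3) xy(2) s(2)])
        ultimately show ?thesis by simp
      next
        case 4
        have "F w = F t + s * (w - t)" if "x \<le> w" "w \<le> y" for w
        proof (cases "w \<le> t")
          case True
          show ?thesis by (rule e(2)) (use that l xy True in linarith)+
        next
          case False
          show ?thesis unfolding 4(3) by (rule e'(2)) (use that l xy False in linarith)+
        qed
        then show ?thesis by (rule affine_stepI[OF xy(3,1,2) s(1)])
      qed
    qed
    show ?case
    \<comment> \<open>Half of \<open>l\<close> bounds the length of \<open>[a, b]\<close> and half
      is the slack, so everything stays within \<open>l\<close> of \<open>t\<close>.\<close>
    proof (intro exI[of _ "l / 2"] conjI allI impI)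
      fix a b assume ab: "a \<le> t \<and> t \<le> b \<and> b - a < l / 2"
      show "P a b" unfolding P_def
        by (intro exI[of _ "l / 2"] conjI ballI impI main) (use ab l in auto)
    qed (use l in simp)
  qed
  then show ?thesis unfolding P_def using xy by fastforce
qed

section \<open>Lengths modulo m - 1\<close>

lemma int_powers_minus_1:
  assumes "s \<in> slopes" obtains z where "z \<in> D" "s - 1 = (real m - 1) * z"
proof -
  have geo: "real m ^ n - 1 = (real m - 1) * (\<Sum>i<n. real m ^ i)" for n
    by (simp add: power_diff_1_eq)
  have geoD: "(\<Sum>i<n. real m ^ i) \<in> D" for n
    using Z_inverse_of_nat[of "\<Sum>i<n. m ^ i"] by simp
  obtain k where k: "s = real m powi k" using assms unfolding int_powers_def by auto
  show ?thesis
  proof (cases "k \<ge> 0")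
    case True
    then show ?thesis using that[of "\<Sum>i<nat k. real m ^ i"] geo[of "nat k"] geoD[of "nat k"] k by (simp add: power_int_def)
  next
    case False
    then have "s * real m ^ nat (- k) = 1" using k m_ge_2 by (simp add: power_int_def power_inverse)
    \<comment> \<open>A negative exponent reduces to a positive one by factoring out the unit
      \<open>- s\<close>.\<close>
    then have "s - 1 = (- s) * (real m ^ nat (- k) - 1)" by (simp add: algebra_simps)
    also have "\<dots> = (real m - 1) * ((- s) * (\<Sum>i<nat (- k). real m ^ i))" by (simp add: geo)
    finally show ?thesis using that geoD Z_inverse_int_powers[OF assms] by blast
  qed
qed

text \<open>Congruence modulo the ideal generated by \<open>m - 1\<close> in \<int>[1/m]; only the
  difference has to lie in that ring.\<close>

definition mod_cong :: "real \<Rightarrow> real \<Rightarrow> bool" where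
  "mod_cong x y \<longleftrightarrow> (\<exists>z\<in>D. y - x = (real m - 1) * z)"

lemma mod_cong_refl [simp]: "mod_cong x x"
  unfolding mod_cong_def by (intro bexI[of _ 0]) auto

lemma mod_cong_sym: "mod_cong x y \<Longrightarrow> mod_cong y x"
  unfolding mod_cong_def by (metis Z_inverse_minus minus_diff_eq mult_minus_right)

lemma mod_cong_add: "mod_cong x y \<Longrightarrow> mod_cong x' y' \<Longrightarrow> mod_cong (x + x') (y + y')"
proof -
  assume "mod_cong x y" "mod_cong x' y'"
  then obtain z z' where "z \<in> D" "y - x = (real m - 1) * z" "z' \<in> D" "y' - x' = (real m - 1) * z'"
    unfolding mod_cong_def by blast
  then show ?thesis unfolding mod_cong_def
    by (intro bexI[of _ "z + z'"]) (auto simp: algebra_simps)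
qed

lemma mod_cong_minus: "mod_cong x y \<Longrightarrow> mod_cong (- x) (- y)"
  unfolding mod_cong_def
proof (elim bexE)
  fix z assume "z \<in> D" "y - x = (real m - 1) * z"
  then show "\<exists>z\<in>D. - y - - x = (real m - 1) * z"
    by (intro bexI[of _ "- z"]) (auto simp: algebra_simps)
qed

lemma mod_cong_trans: "mod_cong x y \<Longrightarrow> mod_cong y z \<Longrightarrow> mod_cong x z"
  using mod_cong_add[of "x" "y" "0" "z - y"] unfolding mod_cong_def by simp

text \<open>A denominator \<open>m ^ n\<close> is coprime to \<open>m - 1\<close> and can be
  cancelled.\<close>

lemma mod_cong_int: "mod_cong (of_int i) (of_int j) \<longleftrightarrow> (int m - 1) dvd (j - i)"
proof
  assume "mod_cong (of_int i) (of_int j)"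
  then obtain z where z: "z \<in> D" "of_int j - of_int i = (real m - 1) * z"
    unfolding mod_cong_def by blast
  obtain N n where N: "z * real m ^ n = of_int N" using z(1) unfolding Z_inverse_iff by blast
  have "of_int ((j - i) * int m ^ n) = (of_int j - of_int i) * real m ^ n" by simp
  also have "\<dots> = (real m - 1) * (z * real m ^ n)" using z(2) by simp
  also have "\<dots> = of_int ((int m - 1) * N)" unfolding N by simp
  finally have "(j - i) * int m ^ n = (int m - 1) * N" by linarith
  then have "(int m - 1) dvd (j - i) * int m ^ n" by simp
  moreover have "coprime (int m - 1) (int m ^ n)"
    by (intro coprime_power_right_iff[THEN iffD2] disjI1)
       (metis coprime_diff_one_left)
  ultimately show "(int m - 1) dvd (j - i)" by (simp add: coprime_dvd_mult_left_iff)
next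
  assume "(int m - 1) dvd (j - i)"
  then obtain k where "j - i = (int m - 1) * k" by blast
  then have "of_int j - of_int i = (real m - 1) * of_int k"
    by (metis of_int_1 of_int_diff of_int_mult of_int_of_nat_eq)
  then show "mod_cong (of_int i) (of_int j)" unfolding mod_cong_def by blast
qed

text \<open>The change of length is \<open>(s - 1) * (y - x)\<close>, and \<open>s - 1\<close> is
  divisible by \<open>m - 1\<close>.\<close>

lemma affine_step_length: "affine_step F x y \<Longrightarrow> mod_cong (y - x) (F y - F x)"
proof -
  assume "affine_step F x y"
  then obtain s where s: "s \<in> slopes" "F y = F x + s * (y - x)" "x \<in> D" "y \<in> D"
    unfolding affine_step_def by (metis atLeastAtMost_iff less_imp_le order_refl)
  obtain z where z: "z \<in> D" "s - 1 = (real m - 1) * z" using int_powers_minus_1[OF s(1)] .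
  have "F y - F x - (y - x) = (s - 1) * (y - x)" using s(2) by (simp add: algebra_simps)
  also have "\<dots> = (real m - 1) * (z * (y - x))" using z by simp
  finally show ?thesis unfolding mod_cong_def using z s by blast
qed

lemma PL_homeo_length:
  assumes F: "F \<in> PL_homeo m" and xy: "x \<in> D" "y \<in> D"
  shows "mod_cong (y - x) (F y - F x)"
proof -
  have le: "mod_cong (y - x) (F y - F x)" if xy: "x \<in> D" "y \<in> D" "x \<le> y" for x y
    using affine_chain[OF F xy]
  proof (induction)
    case (step y z)
    show ?case using mod_cong_add[OF step.IH affine_step_length[OF step.hyps(2)]] by simp
  qed simp
  show ?thesis
  proof (cases "x \<le> y")
    case False
    then show ?thesis using mod_cong_minus[OF le[of y x]] xy by simp
  qed (use le xy in blast)
qed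

end

subsection \<open>Lifts\<close>

lemma circle_proj_eq: "circle_proj r x = circle_proj r y \<longleftrightarrow> (\<exists>n::int. y = x + real r * of_int n)"
  unfolding circle_proj_eq_iff rcong_altdef by (simp add: mult.commute)

lemma circle_proj_in_circle [simp]: "circle_proj r x \<in> circle r"
  by (simp add: circle_def)

text \<open>The difference of two lifts, divided by \<open>r\<close>, is continuous and integer
  valued, hence constant on the connected line.\<close>

lemma lifts_differ_by_multiple:
  assumes r: "r \<ge> 1" and F: "is_lift r f F" and H: "is_lift r f H"
  obtains k :: int where "\<And>x. F x = H x + real r * of_int k"
proof -
  have c: "continuous_on UNIV F" "continuous_on UNIV H" using F H by (auto simp: is_lift_def)
  have "circle_proj r (H x) = circle_proj r (F x)" for x using F H unfolding is_lift_def by metis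
  then have "\<exists>n::int. F x = H x + real r * of_int n" for x unfolding circle_proj_eq by blast
  then obtain n where n: "\<And>x. F x = H x + real r * of_int (n x :: int)" by metis
  then have nn: "(\<lambda>x. of_int (n x)) = (\<lambda>x. (F x - H x) / real r)" using r by (auto simp: fun_eq_iff field_simps)
  have "(\<lambda>x::real. real_of_int (n x)) constant_on UNIV"
  proof (rule continuous_discrete_range_constant)
    show "continuous_on UNIV (\<lambda>x. real_of_int (n x))" unfolding nn using c r by (intro continuous_intros) auto
    fix x :: real
    have "1 \<le> norm (real_of_int (n y) - real_of_int (n x))" if "real_of_int (n y) \<noteq> real_of_int (n x)" for y
    proof -
      have "1 \<le> \<bar>n y - n x\<bar>" using that by simp
      then have "1 \<le> real_of_int \<bar>n y - n x\<bar>" by linarith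
      then show ?thesis by simp
    qed
    then show "\<exists>e>0. \<forall>y. y \<in> UNIV \<and> real_of_int (n y) \<noteq> real_of_int (n x) \<longrightarrow>
        e \<le> norm (real_of_int (n y) - real_of_int (n x))" by (intro exI[of _ 1]) auto
  qed auto
  then obtain c where "\<And>x. real_of_int (n x) = c" unfolding constant_on_def by auto
  then have "n x = n 0" for x by (metis of_int_eq_iff)
  then have "F x = H x + real r * of_int (n 0)" for x using n[of x] by simp
  then show ?thesis by (rule that)
qed

lemma strict_mono_surj_continuous:
  fixes F :: "real \<Rightarrow> real"
  assumes "strict_mono F" "surj F" shows "continuous_on UNIV F"
  using assms by (intro continuous_onI_mono) (auto simp: strict_mono_less_eq)

lemma periodic_int:
  fixes F :: "real \<Rightarrow> real"
  assumes "\<And>x. F (x + c) = F x + d"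
  shows "F (x + c * of_int n) = F x + d * of_int n"
proof (induction n rule: int_induct[of _ 0])
  case (step1 i)
  have "F (x + c * of_int (i + 1)) = F ((x + c * of_int i) + c)" by (simp add: algebra_simps)
  also have "\<dots> = F (x + c * of_int i) + d" by (rule assms)
  finally show ?case using step1 by (simp add: algebra_simps)
next
  case (step2 i)
  have "F (x + c * of_int i) = F ((x + c * of_int (i - 1)) + c)" by (simp add: algebra_simps)
  also have "\<dots> = F (x + c * of_int (i - 1)) + d" by (rule assms)
  finally show ?case using step2 by (simp add: algebra_simps)
qed auto

text \<open>The representative chosen by \<open>SOME\<close> does not matter once \<open>F\<close>
  commutes with translation by \<open>r\<close>; the restriction to the circle matches the
  extensional maps of the group.\<close>

definition induced :: "nat \<Rightarrow> (real \<Rightarrow> real) \<Rightarrow> real set \<Rightarrow> real set" where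
  "induced r F = (\<lambda>c\<in>circle r. circle_proj r (F (SOME x. circle_proj r x = c)))"

lemma induced_circle_proj:
  assumes "\<And>x. F (x + real r) = F x + real r"
  shows "induced r F (circle_proj r x) = circle_proj r (F x)"
proof -
  define y where "y = (SOME y. circle_proj r y = circle_proj r x)"
  have "circle_proj r y = circle_proj r x" unfolding y_def by (rule someI[of _ x]) simp
  then obtain n :: int where "x = y + real r * of_int n" unfolding circle_proj_eq by blast
  then have "F x = F y + real r * of_int n" using periodic_int[of F, OF assms] by simp
  then have "circle_proj r (F y) = circle_proj r (F x)" unfolding circle_proj_eq by blast
  then show ?thesis unfolding induced_def y_def by simp
qed

lemma induced_unique:
  assumes "f \<in> extensional (circle r)" "\<And>x. F (x + real r) = F x + real r"
    "\<And>x. f (circle_proj r x) = circle_proj r (F x)"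
  shows "f = induced r F"
proof (rule extensionalityI[OF assms(1)])
  show "induced r F \<in> extensional (circle r)" by (simp add: induced_def)
  fix c assume "c \<in> circle r"
  then obtain x where "c = circle_proj r x" unfolding circle_def by blast
  then show "f c = induced r F c" using assms(3) induced_circle_proj[of F r x, OF assms(2)] by simp
qed

lemma subdivision_right:
  fixes a :: "nat \<Rightarrow> real"
  shows "a 0 \<le> x \<Longrightarrow> x < a p \<Longrightarrow> \<exists>i<p. a i \<le> x \<and> x < a (Suc i)"
proof (induction p)
  case (Suc p) then show ?case by (cases "x < a p") (auto simp: less_Suc_eq)
qed simp

locale Brown_Thompson_lifts = PL_base m for m +
  fixes r :: nat
  assumes r_ge_1: "r \<ge> 1"
begin

text \<open>The Brown-Thompson group is the quotient of this group by the translations by multiples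
  of \<open>r\<close>, so all computations can take place on the line.\<close>

definition lifts :: "(real \<Rightarrow> real) set" where
  "lifts = {F \<in> PL_homeo m. \<forall>x. F (x + real r) = F x + real r}"

lemma liftsD: assumes "F \<in> lifts" shows "F \<in> PL_homeo m" "F (x + real r) = F x + real r"
  using assms by (auto simp: lifts_def)

lemma lifts_int: "F \<in> lifts \<Longrightarrow> F (x + real r * of_int n) = F x + real r * of_int n"
  by (rule periodic_int) (simp add: liftsD)

lemma liftsI: "F \<in> PL_homeo m \<Longrightarrow> (\<And>x. F (x + real r) = F x + real r) \<Longrightarrow> F \<in> lifts"
  by (simp add: lifts_def)

lemma lifts_id: "(\<lambda>x. x) \<in> lifts" by (simp add: lifts_def PL_homeo_id)

lemma lifts_comp: "F \<in> lifts \<Longrightarrow> H \<in> lifts \<Longrightarrow> F \<circ> H \<in> lifts"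
  by (simp add: lifts_def PL_homeo_comp)

lemma lifts_inv: assumes F: "F \<in> lifts" shows "finv F \<in> lifts"
proof (rule liftsI)
  note b = PL_homeoD(2,3)[OF liftsD(1)[OF F]]
  show "finv F \<in> PL_homeo m" using F liftsD(1) PL_homeo_inv by blast
  fix x
  have "F (finv F x + real r) = x + real r" using liftsD(2)[OF F] b(1) by (simp add: surj_f_inv_f)
  then show "finv F (x + real r) = finv F x + real r" using b(2) by (metis inv_f_f)
qed

lemma lifts_translation: "b \<in> D \<Longrightarrow> (\<lambda>x. x + b) \<in> lifts"
  by (intro liftsI PL_homeo_translation) auto

lemma lifts_funpow: "F \<in> lifts \<Longrightarrow> F ^^ n \<in> lifts"
proof (induction n)
  case 0 then show ?case using lifts_id by (simp add: id_def)
next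
  case (Suc n) then show ?case by (simp only: funpow.simps lifts_comp)
qed

lemma finv_lifts [simp]: "F \<in> lifts \<Longrightarrow> finv F (F x) = x" "F \<in> lifts \<Longrightarrow> F (finv F x) = x"
  using PL_homeoD(2,3)[OF liftsD(1)] by (auto simp: surj_f_inv_f)

lemma is_lift_induced: assumes F: "F \<in> lifts" shows "is_lift r (induced r F) F"
  unfolding is_lift_def
  using strict_mono_surj_continuous PL_homeoD(1,2)[OF liftsD(1)[OF F]] induced_circle_proj[of F r] liftsD(2)[OF F]
  by auto

lemma affine_chain_subdivision:
  assumes "(affine_step F)\<^sup>*\<^sup>* x y" "x \<in> D"
  shows "\<exists>p a l b. a 0 = x \<and> a p = y \<and> (\<forall>i<p. a i < a (Suc i)) \<and> (\<forall>i\<le>p. a i \<in> D) \<and>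
    (\<forall>i<p. l i \<in> slopes) \<and> (\<forall>i<p. \<forall>w\<in>{a i..a (Suc i)}. F w = l i * w + b i)"
  using assms(1)
proof (induction)
  case base
  show ?case by (rule exI[of _ 0], rule exI[of _ "\<lambda>_. x"]) (use assms(2) in auto)
next
  case (step y z)
  then obtain p a l b where h: "a 0 = x" "a p = y" "\<forall>i<p. a i < a (Suc i)" "\<forall>i\<le>p. a i \<in> D"
    "\<forall>i<p. l i \<in> slopes" "\<forall>i<p. \<forall>w\<in>{a i..a (Suc i)}. F w = l i * w + b i" by blast
  obtain s where s: "y < z" "z \<in> D" "s \<in> slopes" "\<forall>w\<in>{y..z}. F w = F y + s * (w - y)"
    using step.hyps(2) unfolding affine_step_def by blast
  have lin: "F w = s * w + (F y - s * y)" if "w \<in> {y..z}" for w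
    using bspec[OF s(4) that] by (simp add: algebra_simps)
  show ?case
  proof (rule exI[of _ "Suc p"], rule exI[of _ "a(Suc p := z)"], rule exI[of _ "l(p := s)"],
      rule exI[of _ "b(p := F y - s * y)"], intro conjI allI impI)
    show "(a(Suc p := z)) 0 = x" "(a(Suc p := z)) (Suc p) = z" using h(1) by auto
    fix i
    show "(a(Suc p := z)) i < (a(Suc p := z)) (Suc i)" if "i < Suc p"
      using that h(2,3) s(1) by (auto simp: less_Suc_eq)
    show "(a(Suc p := z)) i \<in> D" if "i \<le> Suc p"
      using that h(4) s(2) by (auto simp: le_Suc_eq)
    show "(l(p := s)) i \<in> slopes" if "i < Suc p"
      using that h(5) s(3) by (auto simp: less_Suc_eq)
    show "\<forall>w\<in>{(a(Suc p := z)) i..(a(Suc p := z)) (Suc i)}. F w = (l(p := s)) i * w + (b(p := F y - s * y)) i"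
      if i: "i < Suc p"
    proof (cases "i = p")
      case True
      show ?thesis
      proof
        fix w assume "w \<in> {(a(Suc p := z)) i..(a(Suc p := z)) (Suc i)}"
        then have "w \<in> {y..z}" using True h(2) by simp
        then have "F w = s * w + (F y - s * y)" by (rule lin)
        then show "F w = (l(p := s)) i * w + (b(p := F y - s * y)) i" unfolding True by simp
      qed
    next
      case False
      then have "i < p" using i by simp
      then show ?thesis using h(6) by simp
    qed
  qed
qed

lemma induced_homeomorphic:
  assumes F: "F \<in> lifts"
  shows "homeomorphic_map (circle_top r) (circle_top r) (induced r F)"
proof -
  have cont: "continuous_map (circle_top r) (circle_top r) (induced r H)" if H: "H \<in> lifts" for H
  proof -
    have "induced r H \<circ> circle_proj r = circle_proj r \<circ> H"
      using induced_circle_proj[of H r] liftsD(2)[OF H] by auto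
    moreover have "continuous_map euclidean (circle_top r) (circle_proj r \<circ> H)"
      using is_lift_induced[OF H] quotient_imp_continuous_map[OF quotient_map_circle_proj]
      by (intro continuous_map_compose[of _ euclidean]) (auto simp: is_lift_def)
    ultimately show ?thesis
      using continuous_compose_quotient_map_eq[OF quotient_map_circle_proj] by metis
  qed
  have inv: "induced r (finv H) (induced r H c) = c" "induced r H (induced r (finv H) c) = c"
    if H: "H \<in> lifts" and c: "c \<in> circle r" for H c
  proof -
    obtain x where "c = circle_proj r x" using c unfolding circle_def by blast
    then show "induced r (finv H) (induced r H c) = c" "induced r H (induced r (finv H) c) = c"
      using H lifts_inv[OF H] by (simp_all add: induced_circle_proj liftsD(2))
  qed
  show ?thesis unfolding homeomorphic_map_maps homeomorphic_maps_def
    using cont F lifts_inv[OF F] inv by (intro exI[of _ "induced r (finv F)"]) (auto simp: topspace_circle_top)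
qed

lemma induced_in_carrier:
  assumes F: "F \<in> lifts"
  shows "induced r F \<in> carrier (Brown_Thompson r m)"
proof -
  have r: "0 \<le> real r" using r_ge_1 by simp
  note FH = liftsD(1)[OF F]
  obtain p a l b where h: "a 0 = 0" "a p = real r" "\<forall>i<p. a i < a (Suc i)" "\<forall>i\<le>p. a i \<in> D"
    "\<forall>i<p. l i \<in> slopes" "\<forall>i<p. \<forall>w\<in>{a i..a (Suc i)}. F w = l i * w + b i"
    using affine_chain_subdivision[OF affine_chain[OF FH Z_inverse_0 Z_inverse_of_nat r]] by blast
  have data: "PL_data r (induced r F) p a l b"
    unfolding PL_data_def using h is_lift_induced[OF F] by blast
  have im: "induced r F (circle_proj r (a i)) \<in> circle_proj r ` D" if "i \<le> p" for i
    using is_lift_induced[OF F] h(4) that PL_homeoD(5)[OF FH] unfolding is_lift_def by auto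
  have "orientation_preserving r (induced r F)"
    unfolding orientation_preserving_def using is_lift_induced[OF F] PL_homeoD(1)[OF FH] by blast
  then have "induced r F \<in> PL_plus r"
    unfolding PL_plus_def using induced_homeomorphic[OF F] data by (auto simp: induced_def)
  then show ?thesis unfolding Brown_Thompson_def using data h im by auto
qed

text \<open>The data describe a lift on \<open>[0, r]\<close> only. Comparison with an increasing
  lift makes it increasing, injectivity of \<open>f\<close> forces degree 1, and periodicity then
  carries slopes and breaks to the whole line.\<close>

lemma Brown_Thompson_induced:
  assumes f: "f \<in> carrier (Brown_Thompson r m)"
  obtains F where "F \<in> lifts" "f = induced r F"
proof -
  have r: "real r > 0" using r_ge_1 by simp
  obtain p a l b where data: "PL_data r f p a l b" and l: "\<And>i. i < p \<Longrightarrow> l i \<in> slopes"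
    and aD: "\<And>i. i \<le> p \<Longrightarrow> a i \<in> D"
    and faD: "\<And>i. i \<le> p \<Longrightarrow> f (circle_proj r (a i)) \<in> circle_proj r ` D"
    and f': "f \<in> extensional (circle r)" "homeomorphic_map (circle_top r) (circle_top r) f"
      "orientation_preserving r f"
    using f unfolding Brown_Thompson_def PL_plus_def by auto
  obtain F where a: "a 0 = 0" "a p = real r" "\<And>i. i < p \<Longrightarrow> a i < a (Suc i)"
    and lift: "is_lift r f F" and aff: "\<And>i x. i < p \<Longrightarrow> a i \<le> x \<Longrightarrow> x \<le> a (Suc i) \<Longrightarrow> F x = l i * x + b i"
    using data unfolding PL_data_def by (metis atLeastAtMost_iff)
  obtain F0 where F0: "is_lift r f F0" "strict_mono F0" using f'(3) unfolding orientation_preserving_def by blast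
  obtain k0 where "\<And>x. F x = F0 x + real r * of_int k0"
    using lifts_differ_by_multiple[OF r_ge_1 lift F0(1)] by blast
  then have mono: "strict_mono F" using F0(2) by (simp add: strict_mono_def)
  have cont: "continuous_on UNIV F" and fF: "\<And>x. f (circle_proj r x) = circle_proj r (F x)"
    using lift unfolding is_lift_def by auto
  have inj: "inj_on f (circle r)" using f'(2) by (simp add: homeomorphic_eq_everything_map topspace_circle_top)
  have "circle_proj r (x + real r) = circle_proj r x" for x
    unfolding circle_proj_eq by (rule exI[of _ "-1"]) simp
  then have "f (circle_proj r x) = circle_proj r (F (x + real r))" for x using fF by metis
  moreover have "continuous_on UNIV (\<lambda>x. F (x + real r))"
    by (rule continuous_on_compose2[OF cont]) (auto intro!: continuous_intros)
  ultimately have "is_lift r f (\<lambda>x. F (x + real r))"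
    unfolding is_lift_def by blast
  then obtain k where k: "\<And>x. F (x + real r) = F x + real r * of_int k"
    using lifts_differ_by_multiple[OF r_ge_1 _ lift] by blast
  \<comment> \<open>The degree is positive by monotonicity. If it were at least 2, the value
    \<open>F 0 + r\<close> would be taken strictly between 0 and \<open>r\<close>, at a second
    preimage of the image of the base point.\<close>
  have "k = 1"
  proof -
    have "F 0 < F (0 + real r)" using mono r by (simp add: strict_mono_less)
    then have "real r * of_int k > 0" using k[of 0] by simp
    then have "k > 0" using r by (simp add: zero_less_mult_iff)
    moreover have False if "k \<ge> 2"
    proof -
      have "real r * 2 \<le> real r * of_int k" using that r by (intro mult_left_mono) auto
      then have "F 0 \<le> F 0 + real r" "F 0 + real r \<le> F (real r)" using k[of 0] r by auto
      then obtain y where y: "0 \<le> y" "y \<le> real r" "F y = F 0 + real r"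
        using IVT'[of F 0 "F 0 + real r" "real r"] continuous_on_subset[OF cont] r by auto
      have "circle_proj r (F 0) = circle_proj r (F y)" unfolding circle_proj_eq y by (rule exI[of _ 1]) simp
      then have "circle_proj r 0 = circle_proj r y" using fF inj by (metis circle_proj_in_circle inj_onD)
      then obtain n :: int where n: "y = real r * of_int n" unfolding circle_proj_eq by auto
      have "y \<noteq> 0" using y r by auto
      moreover have "y \<noteq> real r"
      proof
        assume "y = real r"
        then have "F 0 + real r = F 0 + real r * of_int k" using k[of 0] y by simp
        then show False using that r by simp
      qed
      ultimately have "0 < y" "y < real r" using y by linarith+
      then have "0 < real r * of_int n" "real r * of_int n < real r * 1" using n by simp_all
      then have "0 < n" "n < 1" using r by (simp_all add: zero_less_mult_iff)
      then show False by simp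
    qed
    ultimately show ?thesis by force
  qed
  then have per: "F (x + real r) = F x + real r" for x using k by simp
  have surj: "surj F"
  proof (unfold surj_def, rule allI)
    fix y
    define n where "n = \<lfloor>(y - F 0) / real r\<rfloor>"
    have "of_int n \<le> (y - F 0) / real r" "(y - F 0) / real r < of_int n + 1" unfolding n_def by linarith+
    then have "F 0 \<le> y - real r * of_int n" "y - real r * of_int n \<le> F (real r)"
      using r per[of 0] by (simp_all add: field_simps)
    then obtain x where "F x = y - real r * of_int n"
      using IVT'[of F 0 "y - real r * of_int n" "real r"] continuous_on_subset[OF cont] r by auto
    then have "y = F (x + real r * of_int n)" using periodic_int[of F, OF per] by simp
    then show "\<exists>x. y = F x" by blast
  qed
  have FaD: "F (a i) \<in> D" if i: "i \<le> p" for i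
  proof -
    obtain d where d: "d \<in> D" "circle_proj r d = circle_proj r (F (a i))" using faD[OF i] fF by auto
    then obtain n :: int where "F (a i) = d + real r * of_int n" unfolding circle_proj_eq by blast
    then show ?thesis using d(1) by auto
  qed
  have affa: "F x = F (a i) + l i * (x - a i)" if "i < p" "a i \<le> x" "x \<le> a (Suc i)" for i x
    using aff[OF that] aff[of i "a i"] a(3)[of i] that by (simp add: algebra_simps)
  \<comment> \<open>Every point is translated into \<open>[0, r)\<close>. The pieces are half-open,
    so the right germ at \<open>x'\<close> always comes from piece \<open>i\<close>.\<close>
  have red: "\<exists>n::int. \<exists>x' i. x = x' + real r * of_int n \<and> i < p \<and> a i \<le> x' \<and> x' < a (Suc i)" for x
  proof -
    define n where "n = \<lfloor>x / real r\<rfloor>"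
    have "of_int n \<le> x / real r" "x / real r < of_int n + 1" unfolding n_def by linarith+
    then have "0 \<le> x - real r * of_int n" "x - real r * of_int n < real r" using r by (simp_all add: field_simps)
    then obtain i where "i < p" "a i \<le> x - real r * of_int n" "x - real r * of_int n < a (Suc i)"
      using subdivision_right[of a "x - real r * of_int n" p] a by auto
    then show ?thesis by (intro exI[of _ n] exI[of _ "x - real r * of_int n"] exI[of _ i]) auto
  qed
  have "F \<in> PL_homeo m"
  proof (rule PL_homeoI[OF mono surj])
    fix x
    obtain n :: int and x' i where x: "x = x' + real r * of_int n" and i: "i < p" "a i \<le> x'" "x' < a (Suc i)"
      using red by blast
    have Fx: "F x = F x' + real r * of_int n" unfolding x by (rule periodic_int[of F, OF per])
    have rn: "real r * of_int n \<in> D" by auto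
    have "x \<in> D \<longleftrightarrow> x' \<in> D" unfolding x by (rule Z_inverse_add_iff[OF rn])
    moreover have "x' \<in> D \<longleftrightarrow> x' - a i \<in> D"
      using Z_inverse_add_iff[of "- a i" x'] aD[of i] i by auto
    moreover have "F x' \<in> D \<longleftrightarrow> x' - a i \<in> D"
      using affa[of i x'] i Z_inverse_add_iff'[OF FaD[of i]] Z_inverse_mult_int_powers_iff[OF l[of i]] by simp
    moreover have "F x \<in> D \<longleftrightarrow> F x' \<in> D" unfolding Fx by (rule Z_inverse_add_iff[OF rn])
    ultimately show "F x \<in> D \<longleftrightarrow> x \<in> D" by simp
    have gl: "germ_left F y (l j)" if "j < p" "a j < y" "y \<le> a (Suc j)" for j y
    proof (rule germI[of "y - a j"])
      fix h assume "0 \<le> h" "h \<le> y - a j"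
      then show "F (y + - 1 * h) = F y + l j * (- 1 * h)"
        using affa[of j "y - h"] affa[of j y] that by (simp add: algebra_simps)
    qed (use that in simp)
    have "germ_right F x' (l i)"
    proof (rule germI[of "a (Suc i) - x'"])
      fix h assume "0 \<le> h" "h \<le> a (Suc i) - x'"
      then show "F (x' + 1 * h) = F x' + l i * (1 * h)"
        using affa[of i "x' + h"] affa[of i x'] i by (simp add: algebra_simps)
    qed (use i in simp)
    then have right: "germ_right F x (l i)" unfolding x by (rule germ_shift) (rule periodic_int[of F, OF per])
    have "\<exists>j<p. germ_left F x' (l j) \<and> (l j = l i \<or> x' \<in> D)"
    proof (cases "a i < x'")
      case True
      then show ?thesis using gl[of i x'] i by auto
    next
      case False
      then have x': "x' = a i" using i by simp
      show ?thesis
      proof (cases i)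
        \<comment> \<open>At \<open>x' = 0\<close> the left germ comes from the last piece, whose
          end \<open>r\<close> is shifted back by one period.\<close>
        case 0
        have "germ_left F (a p) (l (p - 1))" using gl[of "p - 1" "a p"] a(3)[of "p - 1"] i by simp
        then have "germ_left F (a p + real r * of_int (- 1)) (l (p - 1))"
          by (rule germ_shift) (rule periodic_int[of F, OF per])
        then have "germ_left F x' (l (p - 1))" using x' 0 a by simp
        then show ?thesis using i x' aD[of i] by (intro exI[of _ "p - 1"]) auto
      next
        case (Suc j)
        then show ?thesis using gl[of j x'] i x' a(3)[of j] aD[of i] by (intro exI[of _ j]) auto
      qed
    qed
    then obtain j where j: "j < p" "germ_left F x' (l j)" "l j = l i \<or> x' \<in> D" by blast
    have left: "germ_left F x (l j)" unfolding x using j(2) by (rule germ_shift) (rule periodic_int[of F, OF per])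
    show "PL_germs m F x"
      using left right l[OF j(1)] l[OF i(1)] j(3) \<open>x \<in> D \<longleftrightarrow> x' \<in> D\<close> by blast
  qed
  then have "F \<in> lifts" using per by (rule liftsI)
  moreover have "f = induced r F" using f'(1) per fF by (rule induced_unique)
  ultimately show ?thesis by (rule that)
qed

lemma carrier_Brown_Thompson: "carrier (Brown_Thompson r m) = induced r ` lifts"
  using induced_in_carrier Brown_Thompson_induced by (metis (no_types, lifting) image_iff subsetI subset_antisym)

lemma induced_Bij: "F \<in> lifts \<Longrightarrow> induced r F \<in> Bij (circle r)"
  using induced_homeomorphic[of F]
  by (auto simp: Bij_def bij_betw_def homeomorphic_eq_everything_map topspace_circle_top induced_def)

lemma mult_Brown_Thompson:
  assumes F: "F \<in> lifts" and H: "H \<in> lifts"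
  shows "induced r F \<otimes>\<^bsub>Brown_Thompson r m\<^esub> induced r H = induced r (F \<circ> H)"
proof -
  have "induced r F \<otimes>\<^bsub>Brown_Thompson r m\<^esub> induced r H = compose (circle r) (induced r F) (induced r H)"
    using induced_Bij[OF F] induced_Bij[OF H] by (simp add: Brown_Thompson_def BijGroup_def)
  also have "\<dots> = induced r (F \<circ> H)"
    by (rule induced_unique)
      (use F H in \<open>simp_all add: compose_extensional compose_eq induced_circle_proj liftsD(2)\<close>)
  finally show ?thesis .
qed

lemma one_Brown_Thompson: "\<one>\<^bsub>Brown_Thompson r m\<^esub> = induced r (\<lambda>x. x)"
proof -
  have "\<one>\<^bsub>Brown_Thompson r m\<^esub> = (\<lambda>x\<in>circle r. x)" by (simp add: Brown_Thompson_def BijGroup_def)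
  also have "\<dots> = induced r (\<lambda>x. x)" by (rule induced_unique) auto
  finally show ?thesis .
qed

lemma finv_comp: "F \<in> lifts \<Longrightarrow> finv F \<circ> F = (\<lambda>x. x)" "F \<in> lifts \<Longrightarrow> F \<circ> finv F = (\<lambda>x. x)"
  by auto

lemma group_Brown_Thompson: "group (Brown_Thompson r m)"
proof (rule groupI)
  show "\<exists>y\<in>carrier (Brown_Thompson r m). y \<otimes>\<^bsub>Brown_Thompson r m\<^esub> x = \<one>\<^bsub>Brown_Thompson r m\<^esub>"
    if x: "x \<in> carrier (Brown_Thompson r m)" for x
  proof -
    obtain F where F: "F \<in> lifts" "x = induced r F" using Brown_Thompson_induced[OF x] by blast
    then show ?thesis
      using induced_in_carrier[OF lifts_inv[OF F(1)]] mult_Brown_Thompson[OF lifts_inv[OF F(1)] F(1)]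
      by (auto simp: one_Brown_Thompson finv_comp)
  qed
qed (auto simp: carrier_Brown_Thompson mult_Brown_Thompson one_Brown_Thompson lifts_comp lifts_id comp_assoc comp_id[unfolded id_def] id_comp[unfolded id_def])

lemma inv_Brown_Thompson:
  assumes "F \<in> lifts" shows "inv\<^bsub>Brown_Thompson r m\<^esub> (induced r F) = induced r (finv F)"
  using group.inv_equality[OF group_Brown_Thompson, of "induced r (finv F)" "induced r F"] assms lifts_inv[OF assms]
  by (simp add: carrier_Brown_Thompson mult_Brown_Thompson one_Brown_Thompson finv_comp)

lemma pow_Brown_Thompson:
  assumes "F \<in> lifts" shows "induced r F [^]\<^bsub>Brown_Thompson r m\<^esub> n = induced r (F ^^ n)"
proof (induction n)
  case 0
  show ?case by (simp add: one_Brown_Thompson id_def)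
next
  case (Suc n)
  have "induced r F [^]\<^bsub>Brown_Thompson r m\<^esub> Suc n = induced r (F ^^ n) \<otimes>\<^bsub>Brown_Thompson r m\<^esub> induced r F"
    using Suc by simp
  then show ?case using mult_Brown_Thompson[OF lifts_funpow[OF assms] assms] by (simp only: funpow_Suc_right)
qed

lemma induced_eq_iff:
  assumes "F \<in> lifts" "H \<in> lifts"
  shows "induced r F = induced r H \<longleftrightarrow> (\<exists>k::int. \<forall>x. F x = H x + real r * of_int k)"
proof
  assume "induced r F = induced r H"
  then show "\<exists>k::int. \<forall>x. F x = H x + real r * of_int k"
    using lifts_differ_by_multiple[OF r_ge_1] is_lift_induced assms by metis
next
  assume "\<exists>k::int. \<forall>x. F x = H x + real r * of_int k"
  then have "circle_proj r (F x) = circle_proj r (H x)" for x unfolding circle_proj_eq[of r "F x"]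
    by (metis circle_proj_eq)
  then show "induced r F = induced r H"
    by (intro induced_unique) (use assms in \<open>simp_all add: induced_circle_proj liftsD(2)\<close>, simp add: induced_def)
qed

lemma induced_eq_one_iff:
  assumes "F \<in> lifts"
  shows "induced r F = \<one>\<^bsub>Brown_Thompson r m\<^esub> \<longleftrightarrow> (\<exists>k::int. \<forall>x. F x = x + real r * of_int k)"
  unfolding one_Brown_Thompson using induced_eq_iff[OF assms lifts_id] by simp

end

subsection \<open>Elements of finite order\<close>

lemma circle_proj_1_of_nat_fraction:
  assumes "x \<in> \<rat>"
  obtains p q :: nat where "p \<ge> 1" "q \<ge> 1" "coprime p q" "circle_proj 1 x = circle_proj 1 (real p / real q)"
proof -
  obtain a b :: int where ab: "b > 0" "coprime a b" "x = of_int a / of_int b"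
    using assms by (metis Rats_cases')
  \<comment> \<open>Since \<open>b\<close> is at least 1, adding \<open>b * N\<close> makes the
    numerator positive; the fraction changes by the integer \<open>N\<close>.\<close>
  define N where "N = \<bar>a\<bar> + 1"
  have "1 * N \<le> b * N" using ab(1) by (intro mult_right_mono) (auto simp: N_def)
  then have pos: "a + b * N \<ge> 1" using N_def by linarith
  have "coprime (a + b * N) b" using ab(2) by (metis coprime_iff_gcd_eq_1 gcd_add_mult gcd.commute mult.commute add.commute)
  then have "coprime (nat (a + b * N)) (nat b)" using pos ab(1) by (simp add: coprime_int_iff[symmetric] del: coprime_int_iff)
  moreover have "real (nat (a + b * N)) / real (nat b) = x + of_int N"
    using pos ab by (simp add: field_simps)
  then have "circle_proj 1 x = circle_proj 1 (real (nat (a + b * N)) / real (nat b))"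
    unfolding circle_proj_eq by (intro exI[of _ N]) simp
  ultimately show ?thesis using that[of "nat (a + b * N)" "nat b"] pos ab(1) by linarith
qed

lemma coprime_nat_bezout_pos:
  assumes "coprime p q" "p \<ge> 1" "(q::nat) \<ge> 1"
  obtains s u where "s * p = 1 + q * u"
proof -
  obtain x where "[p * x = 1] (mod q)" using cong_solve_coprime_nat[OF assms(1)] by auto
  \<comment> \<open>Adding \<open>q\<close> keeps the residue and makes the product at least 1, so
    the natural subtraction below is exact.\<close>
  then have "[(x + q) * p = 1] (mod q)" by (simp add: cong_def algebra_simps)
  moreover have ge: "(x + q) * p \<ge> 1" using assms by simp
  ultimately have "q dvd (x + q) * p - 1" using cong_altdef_nat[OF ge] by (simp add: cong_sym_eq)
  then obtain u where "(x + q) * p - 1 = q * u" by blast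
  then show ?thesis using that[of "x + q" u] ge by linarith
qed

context group
begin

lemma inv_mult_cancel_left:
  assumes "g \<in> carrier G" "z \<in> carrier G"
  shows "inv g \<otimes> (g \<otimes> z) = z" "g \<otimes> (inv g \<otimes> z) = z"
  using assms by (simp_all add: m_assoc[symmetric])

lemma conj_pow:
  assumes "x \<in> carrier G" "g \<in> carrier G"
  shows "(g \<otimes> x \<otimes> inv g) [^] (n::nat) = g \<otimes> x [^] n \<otimes> inv g"
proof (induction n)
  case (Suc n)
  have "(g \<otimes> x \<otimes> inv g) [^] Suc n = (g \<otimes> x [^] n \<otimes> inv g) \<otimes> (g \<otimes> x \<otimes> inv g)" using Suc by simp
  also have "\<dots> = g \<otimes> x [^] n \<otimes> (inv g \<otimes> g) \<otimes> x \<otimes> inv g" using assms by (simp add: m_assoc inv_mult_cancel_left)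
  also have "\<dots> = g \<otimes> x [^] Suc n \<otimes> inv g" using assms by (simp add: m_assoc)
  finally show ?case .
qed (use assms in simp)

lemma conjugacy_class_eq:
  assumes "x \<in> carrier G" "c \<in> carrier G" "y = c \<otimes> x \<otimes> inv c"
  shows "{g \<otimes> y \<otimes> inv g | g. g \<in> carrier G} = {g \<otimes> x \<otimes> inv g | g. g \<in> carrier G}"
proof (intro Set.set_eqI iffI)
  fix z assume "z \<in> {g \<otimes> y \<otimes> inv g | g. g \<in> carrier G}"
  then obtain g where g: "g \<in> carrier G" "z = g \<otimes> y \<otimes> inv g" by blast
  then have "z = (g \<otimes> c) \<otimes> x \<otimes> inv (g \<otimes> c)" using assms by (simp add: inv_mult_group m_assoc)
  then show "z \<in> {g \<otimes> x \<otimes> inv g | g. g \<in> carrier G}" using g assms by blast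
next
  fix z assume "z \<in> {g \<otimes> x \<otimes> inv g | g. g \<in> carrier G}"
  then obtain g where g: "g \<in> carrier G" "z = g \<otimes> x \<otimes> inv g" by blast
  have "x = inv c \<otimes> y \<otimes> c" using assms by (simp add: m_assoc inv_mult_cancel_left)
  then have "z = (g \<otimes> inv c) \<otimes> y \<otimes> inv (g \<otimes> inv c)" using g assms by (simp add: inv_mult_group m_assoc inv_mult_cancel_left)
  then show "z \<in> {g \<otimes> y \<otimes> inv g | g. g \<in> carrier G}" using g assms by blast
qed

end

lemma funpow_shift:
  fixes F :: "real \<Rightarrow> real"
  assumes "\<And>x n. F (x + c * of_int n) = F x + c * of_int n"
  shows "((\<lambda>x. F x + c * of_int j) ^^ n) x = (F ^^ n) x + c * of_int (j * int n)"
proof (induction n)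
  case (Suc n)
  then show ?case using assms[of "(F ^^ n) x" "j * int n"] by (simp add: algebra_simps)
qed simp

lemma funpow_translation:
  assumes "\<And>x. (F ^^ q) x = x + (c::real)"
  shows "(F ^^ (q * k)) x = x + c * real k"
proof (induction k)
  case (Suc k)
  have "(F ^^ (q * Suc k)) x = (F ^^ q) ((F ^^ (q * k)) x)" by (simp add: funpow_add)
  then show ?case using Suc assms by (simp add: algebra_simps)
qed simp

text \<open>A point moved up or down by an increasing map keeps moving in that direction and never
  returns.\<close>

lemma funpow_fixed_point:
  assumes H: "strict_mono (H :: real \<Rightarrow> real)" and n: "n > 0" "(H ^^ n) x = x"
  shows "H x = x"
proof (rule ccontr)
  assume "H x \<noteq> x"
  then consider "H x > x" | "H x < x" by linarith
  then show False
  proof cases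
    case 1
    have "(H ^^ Suc k) x > x" for k
      by (induction k) (use 1 in simp, simp, metis 1 H less_trans strict_mono_less)
    then show False using n by (metis Suc_pred less_irrefl)
  next
    case 2
    have "(H ^^ Suc k) x < x" for k
      by (induction k) (use 2 in simp, simp, metis 2 H less_trans strict_mono_less)
    then show False using n by (metis Suc_pred less_irrefl)
  qed
qed

section \<open>Roots of the translation by r\<close>

context Brown_Thompson_lifts
begin

abbreviation "T \<equiv> Brown_Thompson r m"

lemma r_pos: "real r > 0" using r_ge_1 by simp

text \<open>Translation by \<open>c\<close> is a \<open>q\<close>-th root of translation by
  \<open>c * q\<close>. The congruence supplies a conjugacy \<open>K\<close> from period
  \<open>c * q\<close> to period \<open>r\<close>; as \<open>K 0 = 0\<close>, the value
  \<open>A 0 = K c\<close> keeps the class of \<open>c\<close>.\<close>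

lemma translation_root:
  assumes c: "c \<in> D" "c > 0" and q: "q \<ge> 1" and cong: "mod_cong (c * real q) (real r)"
  obtains A where "A \<in> lifts" "\<And>x. (A ^^ q) x = x + real r" "mod_cong c (A 0)"
proof -
  obtain z where z: "z \<in> D" "real r - c * real q = (real m - 1) * z"
    using cong unfolding mod_cong_def by blast
  define b where "b = c * real q"
  have b: "b > 0" "b \<in> D" using c q by (auto simp: b_def)
  obtain F where F: "F \<in> PL_homeo m" "F 0 = 0" "F b = real r"
    using PL_homeo_interval[of 0 b 0 "real r" z] b z r_pos by (auto simp: b_def)
  define K where "K = periodic_ext 0 b (real r) F"
  have KH: "K \<in> PL_homeo m" unfolding K_def using F b by (intro PL_homeo_periodic_ext) auto
  have Kper: "K (x + b) = K x + real r" for x unfolding K_def by (rule periodic_ext_shift[OF b(1)])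
  have K0: "K 0 = 0" unfolding K_def using periodic_ext_eq[of b F 0 "real r" 0] F b by simp
  have KK: "K (finv K x) = x" "finv K (K x) = x" for x
    using PL_homeoD(2,3)[OF KH] by (auto simp: surj_f_inv_f)
  define A where "A = K \<circ> ((\<lambda>x. x + c) \<circ> finv K)"
  have AH: "A \<in> PL_homeo m" unfolding A_def
    using KH c by (intro PL_homeo_comp PL_homeo_inv PL_homeo_translation)
  have invper: "finv K (x + real r) = finv K x + b" for x using Kper[of "finv K x"] KK by metis
  have "A (x + real r) = A x + real r" for x
    using Kper[of "finv K x + c"] by (simp add: A_def invper algebra_simps)
  then have "A \<in> lifts" using AH by (intro liftsI)
  moreover have pow: "(A ^^ n) x = K (finv K x + c * real n)" for n x
    by (induction n) (simp_all add: A_def KK algebra_simps)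
  have "(A ^^ q) x = x + real r" for x
    using pow[of q x] Kper[of "finv K x"] KK by (simp add: b_def)
  moreover have "finv K 0 = 0" using K0 KK by metis
  then have "A 0 = K c" by (simp add: A_def)
  then have "mod_cong c (A 0)" using PL_homeo_length[OF KH Z_inverse_0 c(1)] K0 by simp
  ultimately show ?thesis by (rule that)
qed

lemma lifts_shift: "F \<in> lifts \<Longrightarrow> (\<lambda>x. F x + real r * of_int j) \<in> lifts"
proof -
  assume F: "F \<in> lifts"
  have "(\<lambda>x. x + real r * of_int j) \<circ> F \<in> lifts" using F by (intro lifts_comp lifts_translation) auto
  then show ?thesis by (simp add: comp_def)
qed

lemma induced_shift: "F \<in> lifts \<Longrightarrow> induced r (\<lambda>x. F x + real r * of_int j) = induced r F"
  using induced_eq_iff[OF lifts_shift] by blast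

text \<open>Removing the expected translation from \<open>F ^^ q\<close> leaves an increasing map
  whose \<open>n\<close>-th power is the identity, hence the identity. So the fraction
  \<open>k / n\<close> may be replaced by any equal one.\<close>

lemma translation_power_reduce:
  assumes F: "F \<in> lifts" and n: "n > 0" "\<And>x. (F ^^ n) x = x + real r * of_int k"
    and eq: "k * int q = p * int n"
  shows "(F ^^ q) x = x + real r * of_int p"
proof -
  define H where "H = (\<lambda>x. (F ^^ q) x + real r * of_int (- p))"
  note Fq = lifts_funpow[OF F, of q]
  have H: "H \<in> lifts" unfolding H_def using lifts_shift[OF Fq] .
  have "(H ^^ n) x = ((F ^^ q) ^^ n) x + real r * of_int (- p * int n)"
    unfolding H_def using funpow_shift[of "F ^^ q" "real r" n "- p" x] lifts_int[OF Fq] by simp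
  also have "(F ^^ q) ^^ n = F ^^ (n * q)" by (simp add: funpow_mult mult.commute)
  also have "(F ^^ (n * q)) x = x + (real r * of_int k) * real q" by (rule funpow_translation[OF n(2)])
  also have "\<dots> + real r * of_int (- p * int n) = x"
  proof -
    have "of_int k * real q = of_int p * real n" using eq by (metis of_int_mult of_int_of_nat_eq)
    then have "real r * (of_int k * real q) = real r * (of_int p * real n)" by simp
    then show ?thesis by (simp add: algebra_simps)
  qed
  finally have "(H ^^ n) x = x" .
  then have "H x = x" using funpow_fixed_point[OF PL_homeoD(1)[OF liftsD(1)[OF H]] n(1)] by blast
  then show ?thesis by (simp add: H_def)
qed

text \<open>With \<open>s * p = 1 + q * u\<close>, the map \<open>F ^^ s\<close> shifted by
  \<open>- r * u\<close> translates by \<open>r * (s * p - q * u) = r\<close> after \<open>q\<close>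
  iterations, and its \<open>p\<close>-th power is \<open>F\<close>.\<close>

lemma translation_root_of_power:
  assumes F: "F \<in> lifts" and pq: "p \<ge> 1" "q \<ge> 1" "coprime p q"
    and Fq: "\<And>x. (F ^^ q) x = x + real r * real p"
  obtains A s where "A \<in> lifts" "\<And>x. (A ^^ q) x = x + real r" "induced r A = induced r (F ^^ s)" "A ^^ p = F"
proof -
  obtain s u where su: "s * p = 1 + q * u" using coprime_nat_bezout_pos[OF pq(3,1,2)] .
  define A where "A = (\<lambda>x. (F ^^ s) x + real r * of_int (- int u))"
  note Fs = lifts_funpow[OF F, of s]
  have A: "A \<in> lifts" unfolding A_def by (rule lifts_shift[OF Fs])
  have pow: "(A ^^ n) x = (F ^^ (s * n)) x - real r * (real u * real n)" for n x
    unfolding A_def using funpow_shift[of "F ^^ s" "real r" n "- int u" x] lifts_int[OF Fs]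
    by (simp add: funpow_mult mult.commute)
  have "(A ^^ q) x = x + real r" for x
  proof -
    have "(F ^^ (q * s)) x = x + real r * real p * real s" by (rule funpow_translation[OF Fq])
    moreover have "real p * real s = 1 + real q * real u" using su
      by (metis mult.commute of_nat_1 of_nat_add of_nat_mult)
    then have "real r * (real p * real s) = real r * (1 + real q * real u)" by simp
    ultimately show ?thesis using pow[of q x] by (simp add: algebra_simps)
  qed
  moreover have "A ^^ p = F"
  proof
    fix x
    have "(F ^^ (s * p)) x = F ((F ^^ (q * u)) x)" unfolding su by simp
    also have "(F ^^ (q * u)) x = x + real r * of_int (int p * int u)"
      using funpow_translation[OF Fq, of u x] by (simp add: algebra_simps)
    finally have "(F ^^ (s * p)) x = F x + real r * of_int (int p * int u)"
      by (simp only: lifts_int[OF F])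
    then show "(A ^^ p) x = F x" using pow[of p x] by (simp add: algebra_simps)
  qed
  moreover have "induced r A = induced r (F ^^ s)" unfolding A_def by (rule induced_shift[OF Fs])
  ultimately show ?thesis using that A by blast
qed

lemma rotation_number_translation_power:
  assumes F: "F \<in> lifts" and n: "n > 0" "\<And>x. (F ^^ n) x = x + real r * of_int k"
  shows "rotation_number r (induced r F) = circle_proj 1 (of_int k / real n)"
proof -
  \<comment> \<open>The chosen lift \<open>H\<close> adds an integer \<open>j\<close> to the
    translation number, which disappears modulo 1.\<close>
  define H where "H = (SOME H. is_lift r (induced r F) H)"
  have "is_lift r (induced r F) H" unfolding H_def by (rule someI[of _ F]) (rule is_lift_induced[OF F])
  then obtain j where "\<And>x. H x = F x + real r * of_int j"
    using lifts_differ_by_multiple[OF r_ge_1 _ is_lift_induced[OF F]] by blast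
  then have H: "H = (\<lambda>x. F x + real r * of_int j)" by auto
  define l where "l = k + j * int n"
  have Hn: "(H ^^ n) x = x + real r * of_int l" for x
    unfolding H using funpow_shift[of F "real r" n j x] lifts_int[OF F] n(2) by (simp add: l_def algebra_simps)
  \<comment> \<open>The deviation from linear growth depends only on \<open>N\<close> modulo
    \<open>n\<close>; it is bounded and vanishes after division by \<open>N\<close>.\<close>
  define u where "u N = (H ^^ N) 0 - real r * of_int l * real N / real n" for N
  have per: "u (N + n) = u N" for N
  proof -
    have HL: "H ^^ N \<in> lifts" unfolding H by (intro lifts_funpow lifts_shift F)
    have "(H ^^ (N + n)) 0 = (H ^^ N) ((H ^^ n) 0)" by (simp add: funpow_add)
    also have "\<dots> = (H ^^ N) 0 + real r * of_int l" using Hn[of 0] lifts_int[OF HL, of 0 l] by simp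
    finally show ?thesis using n(1) by (simp add: u_def field_simps)
  qed
  have perk: "u (i + n * d) = u i" for i d
  proof (induction d)
    case (Suc d)
    have "u (i + n * Suc d) = u ((i + n * d) + n)" by (simp add: algebra_simps)
    then show ?case using per Suc by simp
  qed simp
  have "u N = u (N mod n)" for N using perk[of "N mod n" "N div n"] by simp
  then have "range u \<subseteq> u ` {..<n}" using n(1) by (metis image_subsetI imageI lessThan_iff mod_less_divisor)
  then have "finite (range u)" using finite_subset by blast
  then have "bounded (range u)" by (rule finite_imp_bounded)
  then obtain B where B: "\<And>N. \<bar>u N\<bar> \<le> B" unfolding bounded_iff by auto
  have "(\<lambda>N. u N * (1 / (real r * real N))) \<longlonglongrightarrow> 0"
  proof (rule Lim_null_comparison)
    show "\<forall>\<^sub>F N in sequentially. norm (u N * (1 / (real r * real N))) \<le> B / real r * (1 / real N)"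
      by (intro always_eventually allI) (use B r_pos in \<open>simp add: abs_mult divide_right_mono\<close>)
    show "(\<lambda>N. B / real r * (1 / real N)) \<longlonglongrightarrow> 0"
      using tendsto_mult[OF tendsto_const[of "B / real r"] lim_1_over_n] by simp
  qed
  then have "(\<lambda>N. u N * (1 / (real r * real N)) + of_int l / real n) \<longlonglongrightarrow> 0 + of_int l / real n"
    by (intro tendsto_intros)
  moreover have "\<forall>\<^sub>F N in sequentially. u N * (1 / (real r * real N)) + of_int l / real n = (H ^^ N) 0 / (real r * real N)"
    using eventually_gt_at_top[of 0]
  proof eventually_elim
    case (elim N)
    then show ?case using r_pos n(1) by (simp add: u_def field_simps)
  qed
  ultimately have "(\<lambda>N. (H ^^ N) 0 / (real r * real N)) \<longlonglongrightarrow> 0 + of_int l / real n"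
    by (rule Lim_transform_eventually)
  then have "(\<lambda>N. (H ^^ N) 0 / (real r * real N)) \<longlonglongrightarrow> of_int l / real n" by simp
  then have "rotation_number r (induced r F) = circle_proj 1 (of_int l / real n)"
    unfolding rotation_number_def Let_def H_def[symmetric] by (simp add: limI)
  also have "\<dots> = circle_proj 1 (of_int k / real n)"
  proof -
    have "of_int k / real n = of_int l / real n + real 1 * of_int (- j)"
      using n(1) by (simp add: l_def field_simps)
    then show ?thesis unfolding circle_proj_eq by blast
  qed
  finally show ?thesis .
qed

lemma finite_orderE:
  assumes F: "F \<in> lifts" and fin: "finite_order T (induced r F)"
  obtains n k where "n > 0" "\<And>x. (F ^^ n) x = x + real r * of_int k"
proof -
  obtain n :: nat where n: "n > 0" "induced r F [^]\<^bsub>T\<^esub> n = \<one>\<^bsub>T\<^esub>" using fin unfolding finite_order_def by blast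
  then have "induced r (F ^^ n) = \<one>\<^bsub>T\<^esub>" using pow_Brown_Thompson[OF F] by simp
  then show ?thesis using induced_eq_one_iff[OF lifts_funpow[OF F]] that n(1) by blast
qed

lemma conj_induced:
  assumes "F \<in> lifts" "K \<in> lifts"
  shows "induced r K \<otimes>\<^bsub>T\<^esub> induced r F \<otimes>\<^bsub>T\<^esub> inv\<^bsub>T\<^esub> (induced r K) = induced r (K \<circ> F \<circ> finv K)"
  using assms by (simp add: inv_Brown_Thompson mult_Brown_Thompson lifts_comp lifts_inv)

lemma conj_funpow: "K \<in> lifts \<Longrightarrow> ((K \<circ> F \<circ> finv K) ^^ n) x = K ((F ^^ n) (finv K x))"
  by (induction n) auto

definition has_rotation :: "real set \<Rightarrow> (real set \<Rightarrow> real set) set \<Rightarrow> bool" where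
  "has_rotation \<theta> C \<longleftrightarrow> C \<in> conjugacy_classes T \<and>
     (\<forall>f\<in>C. finite_order T f \<and> rotation_number r f = \<theta>)"

definition conj_class :: "(real \<Rightarrow> real) \<Rightarrow> (real set \<Rightarrow> real set) set" where
  "conj_class F = {g \<otimes>\<^bsub>T\<^esub> induced r F \<otimes>\<^bsub>T\<^esub> inv\<^bsub>T\<^esub> g | g. g \<in> carrier T}"

lemma conj_class_eq: "F \<in> lifts \<Longrightarrow> conj_class F = {induced r (K \<circ> F \<circ> finv K) | K. K \<in> lifts}"
  unfolding conj_class_def
  by (simp add: Setcompr_eq_image carrier_Brown_Thompson image_image conj_induced cong: image_cong_simp)

lemma conj_class_self: "F \<in> lifts \<Longrightarrow> induced r F \<in> conj_class F"
proof -
  assume F: "F \<in> lifts"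
  interpret group T by (rule group_Brown_Thompson)
  have "induced r F = \<one>\<^bsub>T\<^esub> \<otimes>\<^bsub>T\<^esub> induced r F \<otimes>\<^bsub>T\<^esub> inv\<^bsub>T\<^esub> \<one>\<^bsub>T\<^esub>"
    using induced_in_carrier[OF F] by simp
  then show ?thesis unfolding conj_class_def by blast
qed

lemma has_rotation_conj_class:
  assumes F: "F \<in> lifts" and q: "q \<ge> 1" "\<And>x. (F ^^ q) x = x + real r * of_int p"
  shows "has_rotation (circle_proj 1 (of_int p / real q)) (conj_class F)"
  unfolding has_rotation_def
proof (intro conjI ballI)
  show "conj_class F \<in> conjugacy_classes T"
    unfolding conj_class_def conjugacy_classes_def using induced_in_carrier[OF F] by blast
  fix f assume "f \<in> conj_class F"
  then obtain K where K: "K \<in> lifts" "f = induced r (K \<circ> F \<circ> finv K)" using conj_class_eq[OF F] by blast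
  have L: "K \<circ> F \<circ> finv K \<in> lifts" using F K(1) by (intro lifts_comp lifts_inv)
  have pow: "((K \<circ> F \<circ> finv K) ^^ q) x = x + real r * of_int p" for x
    using K(1) q(2) lifts_int[OF K(1)] by (simp add: conj_funpow[OF K(1)])
  show "rotation_number r f = circle_proj 1 (of_int p / real q)"
    unfolding K(2) using rotation_number_translation_power[OF L _ pow] q(1) by simp
  have "f [^]\<^bsub>T\<^esub> q = \<one>\<^bsub>T\<^esub>"
    unfolding K(2) pow_Brown_Thompson[OF L] using induced_eq_one_iff[OF lifts_funpow[OF L]] pow by blast
  then show "finite_order T f" unfolding finite_order_def using q(1) by (intro exI[of _ q]) simp
qed

text \<open>The rotation number fixes \<open>k / n\<close> only modulo 1. Another lift makes it
  equal to \<open>p / q\<close>, and then \<open>n\<close> can be replaced by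
  \<open>q\<close>.\<close>

lemma has_rotationE:
  assumes C: "has_rotation (circle_proj 1 (real p / real q)) C" and q: "q \<ge> 1"
  obtains F where "F \<in> lifts" "C = conj_class F" "\<And>x. (F ^^ q) x = x + real r * real p"
proof -
  obtain f where f: "f \<in> carrier T" "C = {g \<otimes>\<^bsub>T\<^esub> f \<otimes>\<^bsub>T\<^esub> inv\<^bsub>T\<^esub> g | g. g \<in> carrier T}"
    using C unfolding has_rotation_def conjugacy_classes_def by blast
  obtain F where F: "F \<in> lifts" "f = induced r F" using Brown_Thompson_induced[OF f(1)] .
  then have CF: "C = conj_class F" using f(2) by (simp add: conj_class_def)
  then have fin: "finite_order T (induced r F)"
    and rot: "rotation_number r (induced r F) = circle_proj 1 (real p / real q)"
    using C conj_class_self[OF F(1)] unfolding has_rotation_def by auto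
  obtain n k where n: "n > 0" "\<And>x. (F ^^ n) x = x + real r * of_int k" using finite_orderE[OF F(1) fin] by blast
  have "circle_proj 1 (of_int k / real n) = circle_proj 1 (real p / real q)"
    using rotation_number_translation_power[OF F(1) n] rot by simp
  then obtain j :: int where j: "real p / real q = of_int k / real n + of_int j" unfolding circle_proj_eq by auto
  define F' where "F' = (\<lambda>x. F x + real r * of_int j)"
  have F': "F' \<in> lifts" unfolding F'_def by (rule lifts_shift[OF F(1)])
  have F'n: "(F' ^^ n) x = x + real r * of_int (k + j * int n)" for x
    unfolding F'_def using funpow_shift[of F "real r" n j x] lifts_int[OF F(1)] n(2) by (simp add: algebra_simps)
  have "(of_int k + of_int j * real n) * real q = real p * real n" using j n(1) q by (simp add: field_simps)
  then have "real_of_int ((k + j * int n) * int q) = real_of_int (int p * int n)" by simp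
  then have "(k + j * int n) * int q = int p * int n" by (rule of_int_eq_iff[THEN iffD1])
  then have "(F' ^^ q) x = x + real r * of_int (int p)" for x
    by (rule translation_power_reduce[OF F' n(1) F'n])
  moreover have "C = conj_class F'" unfolding CF conj_class_def F'_def using induced_shift[OF F(1)] by simp
  ultimately show ?thesis using that[OF F'] by simp
qed

text \<open>For \<open>m = 2\<close> there is no congruence obstruction, so a root \<open>A\<close> of the translation by \<open>r\<close> is conjugate,
  by a homeomorphism of the line, to the unit translation: prescribe the conjugacy on \<open>[0, 1]\<close>
  and extend it equivariantly.\<close>

lemma conj_unit_translation:
  assumes m2: "m = 2" and A: "A \<in> lifts" and q: "q \<ge> 1" "\<And>x. (A ^^ q) x = x + real r"
  obtains K where "K \<in> PL_homeo m" "\<And>x. K (x + 1) = A (K x)"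
proof -
  note AH = liftsD(1)[OF A]
  \<comment> \<open>Otherwise all iterates of 0 stay nonpositive, contrary to
    \<open>(A ^^ q) 0 = r\<close>.\<close>
  have A0: "A 0 > 0"
  proof (rule ccontr)
    assume "\<not> A 0 > 0"
    then have "A 0 \<le> 0" by simp
    then have "(A ^^ n) 0 \<le> 0" for n
      by (induction n) (simp, simp, metis \<open>A 0 \<le> 0\<close> PL_homeoD(1)[OF AH] order_trans strict_mono_less_eq)
    then show False using q(2)[of 0] r_pos by (metis add_0 not_le)
  qed
  have A0D: "A 0 \<in> D" using PL_homeoD(5)[OF AH] by simp
  \<comment> \<open>Equivariance is extended one unit at a time; \<open>n = q - 1\<close> gives the
    conjugacy on a full period \<open>[0, q]\<close>, with \<open>q\<close> sent to
    \<open>r\<close>.\<close>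
  have step: "\<exists>K\<in>PL_homeo m. K 0 = 0 \<and> K 1 = A 0 \<and> (\<forall>x. 0 \<le> x \<and> x \<le> real n \<longrightarrow> K (x + 1) = A (K x))" for n
  proof (induction n)
    case 0
    have "(A 0 - 0) - (1 - 0) = (real m - 1) * (A 0 - 1)" using m2 by simp
    then obtain K where "K \<in> PL_homeo m" "K 0 = 0" "K 1 = A 0"
      using PL_homeo_interval[of 0 1 0 "A 0" "A 0 - 1"] A0 A0D by (auto simp: Z_inverse_diff)
    then show ?case by (intro bexI[of _ K]) auto
  next
    case (Suc n)
    then obtain K where K: "K \<in> PL_homeo m" "K 0 = 0" "K 1 = A 0"
      "\<And>x. 0 \<le> x \<Longrightarrow> x \<le> real n \<Longrightarrow> K (x + 1) = A (K x)" by blast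
    define b where "b = real n + 1"
    \<comment> \<open>Past \<open>b\<close> the values are forced by equivariance; both formulas
      agree at \<open>b\<close>.\<close>
    define K' where "K' = (\<lambda>x. if x \<le> b then K x else (A \<circ> (K \<circ> (\<lambda>x. x + - 1))) x)"
    have "K b = A (K (b + - 1))" using K(4)[of "real n"] by (simp add: b_def)
    then have "K' \<in> PL_homeo m" unfolding K'_def
      using K(1) AH by (intro PL_homeo_glue PL_homeo_comp PL_homeo_translation) (auto simp: b_def)
    moreover have "K' 0 = 0" "K' 1 = A 0" using K by (auto simp: K'_def b_def)
    moreover have "K' (x + 1) = A (K' x)" if "0 \<le> x" "x \<le> real (Suc n)" for x
      using that K(4)[of x] by (auto simp: K'_def b_def)
    ultimately show ?case by blast
  qed
  obtain F where F: "F \<in> PL_homeo m" "F 0 = 0"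
    "\<And>x. 0 \<le> x \<Longrightarrow> x \<le> real (q - 1) \<Longrightarrow> F (x + 1) = A (F x)" using step[of "q - 1"] by blast
  have pow: "F (x + real i) = (A ^^ i) (F x)" if "0 \<le> x" "x + real i \<le> real q" for i x
    using that
  proof (induction i)
    case (Suc i)
    then have "F (x + real i + 1) = A (F (x + real i))" using q(1) by (intro F(3)) (auto simp: of_nat_diff)
    then show ?case using Suc by (simp add: algebra_simps)
  qed simp
  have Fq: "F (0 + real q) = F 0 + real r" using pow[of 0 q] q(2) by simp
  have q0: "real q > 0" using q(1) by simp
  define K where "K = periodic_ext 0 (real q) (real r) F"
  have K: "K \<in> PL_homeo m" unfolding K_def using F(1) Fq q0 by (intro PL_homeo_periodic_ext) auto
  have Kper: "K (x + real q) = K x + real r" for x unfolding K_def by (rule periodic_ext_shift[OF q0])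
  have KF: "K x = F x" if "0 \<le> x" "x \<le> real q" for x
    unfolding K_def using periodic_ext_eq[of "real q" F 0 "real r" x] Fq q0 that by simp
  have base: "K (x + 1) = A (K x)" if x: "0 \<le> x" "x \<le> real q" for x
  proof (cases "x \<le> real (q - 1)")
    case True
    then show ?thesis using KF[of x] KF[of "x + 1"] F(3)[of x] x q(1) by (simp add: of_nat_diff)
  next
    case False
    \<comment> \<open>In the last unit interval \<open>x + 1\<close> passes the end of the period:
      one period contributes \<open>r\<close>, which is the effect of \<open>A ^^ q\<close>.\<close>
    define y where "y = x - real (q - 1)"
    have y: "0 \<le> y" "y \<le> 1" "x = y + real (q - 1)" "x + 1 = y + real q"
      using False x q(1) by (auto simp: y_def of_nat_diff)
    have "1 \<le> real q" using q(1) by simp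
    then have Ky: "K y = F y" using KF[of y] y by linarith
    have "K (x + 1) = K y + real r" unfolding y(4) by (rule Kper)
    also have "\<dots> = (A ^^ Suc (q - 1)) (F y)" using q Ky by simp
    also have "\<dots> = A ((A ^^ (q - 1)) (F y))" by (simp only: funpow.simps comp_apply)
    also have "(A ^^ (q - 1)) (F y) = F x" unfolding y(3) by (rule pow[symmetric]) (use y x in linarith)+
    finally show ?thesis using KF[of x] x by simp
  qed
  have "K (x + 1) = A (K x)" for x
  proof -
    define n where "n = \<lfloor>x / real q\<rfloor>"
    define y where "y = x - real q * of_int n"
    have "of_int n \<le> x / real q" "x / real q < of_int n + 1" unfolding n_def by linarith+
    then have y: "0 \<le> y" "y \<le> real q" using q0 by (simp_all add: field_simps y_def)
    have "K (x + 1) = K (y + 1 + real q * of_int n)" by (simp add: y_def)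
    also have "\<dots> = K (y + 1) + real r * of_int n" by (rule periodic_int[of K, OF Kper])
    also have "\<dots> = A (K y + real r * of_int n)" using base[OF y] lifts_int[OF A] by simp
    also have "K y + real r * of_int n = K (y + real q * of_int n)" by (rule periodic_int[of K, OF Kper, symmetric])
    finally show ?thesis by (simp add: y_def)
  qed
  then show ?thesis using that K by blast
qed

text \<open>Both roots are conjugate to the unit translation. The composite conjugacy also
  intertwines their \<open>q\<close>-th powers, both translation by \<open>r\<close>, and is
  therefore a lift.\<close>

lemma translation_roots_conjugate:
  assumes m2: "m = 2" and A: "A \<in> lifts" and B: "B \<in> lifts"
    and q: "q \<ge> 1" "\<And>x. (A ^^ q) x = x + real r" "\<And>x. (B ^^ q) x = x + real r"
  obtains C where "C \<in> lifts" "B = C \<circ> A \<circ> finv C"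
proof -
  obtain K where K: "K \<in> PL_homeo m" "\<And>x. K (x + 1) = A (K x)" using conj_unit_translation[OF m2 A q(1,2)] by blast
  obtain L where L: "L \<in> PL_homeo m" "\<And>x. L (x + 1) = B (L x)" using conj_unit_translation[OF m2 B q(1,3)] by blast
  have KK: "K (finv K x) = x" "finv K (K x) = x" for x using PL_homeoD(2,3)[OF K(1)] by (auto simp: surj_f_inv_f)
  define C where "C = L \<circ> finv K"
  have CH: "C \<in> PL_homeo m" unfolding C_def using L(1) K(1) by (intro PL_homeo_comp PL_homeo_inv)
  have "finv K (A x) = finv K x + 1" for x using K(2)[of "finv K x"] KK by metis
  then have comm: "C (A x) = B (C x)" for x by (simp add: C_def L(2))
  have pow: "C ((A ^^ n) x) = (B ^^ n) (C x)" for n x by (induction n) (auto simp: comm)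
  have "C (x + real r) = C x + real r" for x using pow[of q x] q by simp
  then have C: "C \<in> lifts" using CH by (intro liftsI)
  moreover have "B = C \<circ> A \<circ> finv C" using C comm by (auto simp: fun_eq_iff)
  ultimately show ?thesis by (rule that)
qed

text \<open>Since \<open>B (C 0) = C (A 0)\<close>, it suffices to compare the displacement from 0
  to \<open>A 0\<close> under \<open>C\<close> with that from 0 to \<open>C 0\<close> under
  \<open>B\<close> and subtract.\<close>

lemma translation_root_invariant:
  assumes C: "C \<in> lifts" and A: "A \<in> lifts" and B: "B = C \<circ> A \<circ> finv C"
  shows "mod_cong (A 0) (B 0)"
proof -
  note CH = liftsD(1)[OF C] and AH = liftsD(1)[OF A]
  have BH: "B \<in> PL_homeo m" unfolding B using C A by (intro PL_homeo_comp PL_homeo_inv liftsD(1))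
  have D: "C 0 \<in> D" "A 0 \<in> D" using PL_homeoD(5)[OF CH] PL_homeoD(5)[OF AH] by auto
  have eq: "B (C 0) = C (A 0)" using C B by simp
  have 1: "mod_cong (A 0 - 0) (C (A 0) - C 0)" by (rule PL_homeo_length[OF CH Z_inverse_0 D(2)])
  have 2: "mod_cong (C 0 - 0) (B (C 0) - B 0)" by (rule PL_homeo_length[OF BH Z_inverse_0 D(1)])
  show ?thesis using mod_cong_add[OF 1 mod_cong_minus[OF 2]]  mod_cong_add[OF mod_cong_add[OF 1 mod_cong_minus[OF 2]] mod_cong_refl[of "C 0"]]
    unfolding eq by simp
qed

text \<open>The class of \<open>(A ^^ n) 0\<close> is that of \<open>n * A 0\<close>; at
  \<open>n = m - 1\<close> it vanishes, while the value is \<open>r\<close>.\<close>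

lemma translation_root_dvd:
  assumes A: "A \<in> lifts" and q: "\<And>x. (A ^^ (m - 1)) x = x + real r"
  shows "(m - 1) dvd r"
proof -
  note AH = liftsD(1)[OF A]
  have D: "A 0 \<in> D" using PL_homeoD(5)[OF AH] by auto
  have "(A ^^ n) 0 \<in> D \<and> mod_cong (real n * A 0) ((A ^^ n) 0)" for n
  proof (induction n)
    case (Suc n)
    then have n: "(A ^^ n) 0 \<in> D" "mod_cong (real n * A 0) ((A ^^ n) 0)" by auto
    have "mod_cong ((A ^^ n) 0 - 0) (A ((A ^^ n) 0) - A 0)" by (rule PL_homeo_length[OF AH Z_inverse_0 n(1)])
    then have "mod_cong (real n * A 0) (A ((A ^^ n) 0) - A 0)" using n(2) mod_cong_trans by simp
    then have "mod_cong (real n * A 0 + A 0) (A ((A ^^ n) 0) - A 0 + A 0)" by (rule mod_cong_add) simp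
    then show ?case using n PL_homeoD(5)[OF AH] by (simp add: algebra_simps)
  qed simp
  from this[of "m - 1"] have "mod_cong (real (m - 1) * A 0) (real r)" using q by simp
  moreover have "mod_cong 0 (real (m - 1) * A 0)" unfolding mod_cong_def
    using D m_ge_2 by (intro bexI[of _ "A 0"]) (auto simp: of_nat_diff)
  ultimately have "mod_cong 0 (real r)" using mod_cong_trans by blast
  then have "mod_cong (of_int 0) (of_int (int r))" by simp
  then have "int m - 1 dvd int r" unfolding mod_cong_int by simp
  moreover have "int m - 1 = int (m - 1)" using m_ge_2 by linarith
  ultimately show ?thesis using int_dvd_int_iff by metis
qed

lemma two_translation_roots:
  assumes "m > 2" "(m - 1) dvd r"
  obtains A B where "A \<in> lifts" "B \<in> lifts" "\<And>x. (A ^^ (m - 1)) x = x + real r"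
    "\<And>x. (B ^^ (m - 1)) x = x + real r" "\<And>C. C \<in> lifts \<Longrightarrow> B \<noteq> C \<circ> A \<circ> finv C"
proof -
  have im: "int (m - 1) = int m - 1" using m_ge_2 by linarith
  have m1: "m - 1 \<ge> 1" using m_ge_2 by simp
  \<comment> \<open>Both sides vanish modulo \<open>m - 1\<close>, so the construction applies to
    \<open>c = 1\<close> and \<open>c = 2\<close>, which are not congruent as
    \<open>m - 1 > 1\<close>.\<close>
  have cong: "mod_cong (real c * real (m - 1)) (real r)" for c
  proof -
    have "int m - 1 dvd int r - int c * int (m - 1)"
      using assms(2) unfolding im by (metis dvd_diff dvd_triv_right im int_dvd_int_iff)
    then have "mod_cong (of_int (int c * int (m - 1))) (of_int (int r))" unfolding mod_cong_int .
    then show ?thesis by simp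
  qed
  obtain A where A: "A \<in> lifts" "\<And>x. (A ^^ (m - 1)) x = x + real r" "mod_cong 1 (A 0)"
    using translation_root[OF Z_inverse_1 _ m1] cong[of 1] by force
  obtain B where B: "B \<in> lifts" "\<And>x. (B ^^ (m - 1)) x = x + real r" "mod_cong 2 (B 0)"
    using translation_root[OF Z_inverse_numeral _ m1, of "num.Bit0 num.One"] cong[of 2] by force
  have "B \<noteq> C \<circ> A \<circ> finv C" if "C \<in> lifts" for C
  proof
    assume "B = C \<circ> A \<circ> finv C"
    then have "mod_cong (A 0) (B 0)" by (rule translation_root_invariant[OF that A(1)])
    then have "mod_cong 1 2" using A(3) B(3) mod_cong_trans mod_cong_sym by blast
    then have "mod_cong (of_int 1) (of_int 2)" by simp
    then have "int m - 1 dvd 1" unfolding mod_cong_int by simp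
    then show False using assms(1) by (simp add: zdvd1_eq)
  qed
  then show ?thesis using that A B by blast
qed

text \<open>A suitable lift has translation by a positive multiple \<open>p\<close> of
  \<open>r\<close> as its \<open>q\<close>-th power. Exactness of the order makes \<open>p\<close>
  and \<open>q\<close> coprime, and Bezout gives a normalized generator of the same cyclic
  group.\<close>

lemma exact_order_translation_root:
  assumes y: "y \<in> carrier T" and q: "q \<ge> 1" "y [^]\<^bsub>T\<^esub> q = \<one>\<^bsub>T\<^esub>" "\<And>d. 0 < d \<Longrightarrow> d < q \<Longrightarrow> y [^]\<^bsub>T\<^esub> d \<noteq> \<one>\<^bsub>T\<^esub>"
  obtains A and s p :: nat where "A \<in> lifts" "\<And>x. (A ^^ q) x = x + real r"
    "induced r A = y [^]\<^bsub>T\<^esub> s" "y = induced r A [^]\<^bsub>T\<^esub> p"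
proof -
  obtain Y where Y: "Y \<in> lifts" "y = induced r Y" using Brown_Thompson_induced[OF y] .
  obtain k :: int where k: "\<And>x. (Y ^^ q) x = x + real r * of_int k"
    using q(2) induced_eq_one_iff[OF lifts_funpow[OF Y(1)]] pow_Brown_Thompson[OF Y(1)] Y(2) by metis
  \<comment> \<open>Large enough to make \<open>k + j * q\<close> positive whatever the sign of
    \<open>k\<close>.\<close>
  define j where "j = \<bar>k\<bar> + 1"
  define p where "p = nat (k + j * int q)"
  have "j * int q \<ge> j * 1" using q(1) unfolding j_def by (intro mult_left_mono) auto
  then have "k + j * int q \<ge> 1" using j_def by linarith
  then have p: "int p = k + j * int q" "p \<ge> 1" unfolding p_def by linarith+
  define Z where "Z = (\<lambda>x. Y x + real r * of_int j)"
  have Z: "Z \<in> lifts" unfolding Z_def by (rule lifts_shift[OF Y(1)])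
  have yZ: "y = induced r Z" unfolding Z_def Y(2) using induced_shift[OF Y(1)] by simp
  have Zq: "(Z ^^ q) x = x + real r * of_int (int p)" for x
    unfolding Z_def p(1) using funpow_shift[of Y "real r" q j x] lifts_int[OF Y(1)] k by (simp add: algebra_simps)
  \<comment> \<open>A common factor would make a power with exponent \<open>q' < q\<close>
    trivial.\<close>
  have "coprime p q"
  proof (rule ccontr)
    assume "\<not> coprime p q"
    then have g: "gcd p q \<noteq> 1" by (simp add: coprime_iff_gcd_eq_1)
    obtain q' where q': "q = gcd p q * q'" by (meson gcd_dvd2 dvdE)
    obtain p' where p': "p = gcd p q * p'" by (meson gcd_dvd1 dvdE)
    have "gcd p q \<noteq> 0" using q(1) by simp
    then have "gcd p q \<ge> 2" using g by linarith
    then have "2 * q' \<le> gcd p q * q'" by (rule mult_le_mono1)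
    then have "2 * q' \<le> q" using q' by simp
    moreover have "q' \<noteq> 0" using q' q(1) by (metis mult_0_right not_one_le_zero)
    ultimately have "0 < q'" "q' < q" by linarith+
    have "p * q' = p' * q" using p' q' by (metis mult.assoc mult.commute)
    then have "int p * int q' = int p' * int q" by (metis of_nat_mult)
    then have "(Z ^^ q') x = x + real r * of_int (int p')" for x
      using translation_power_reduce[OF Z _ Zq] q(1) by simp
    then have "y [^]\<^bsub>T\<^esub> q' = \<one>\<^bsub>T\<^esub>"
      unfolding yZ pow_Brown_Thompson[OF Z] using induced_eq_one_iff[OF lifts_funpow[OF Z]] by blast
    then show False using q(3) \<open>0 < q'\<close> \<open>q' < q\<close> by blast
  qed
  moreover have "(Z ^^ q) x = x + real r * real p" for x using Zq by simp
  ultimately obtain A s where A: "A \<in> lifts" "\<And>x. (A ^^ q) x = x + real r" "induced r A = induced r (Z ^^ s)" "A ^^ p = Z"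
    using translation_root_of_power[OF Z p(2) q(1)] by metis
  have "induced r A = y [^]\<^bsub>T\<^esub> s" unfolding yZ pow_Brown_Thompson[OF Z] by (rule A(3))
  moreover have "y = induced r A [^]\<^bsub>T\<^esub> p" unfolding yZ pow_Brown_Thompson[OF A(1)] A(4) ..
  ultimately show ?thesis using that A(1,2) by blast
qed

lemma translation_root_order:
  assumes A: "A \<in> lifts" and q: "q \<ge> 1" "\<And>x. (A ^^ q) x = x + real r"
  shows "induced r A [^]\<^bsub>T\<^esub> q = \<one>\<^bsub>T\<^esub>" "0 < d \<Longrightarrow> d < q \<Longrightarrow> induced r A [^]\<^bsub>T\<^esub> d \<noteq> \<one>\<^bsub>T\<^esub>"
proof -
  have "\<forall>x. (A ^^ q) x = x + real r * of_int 1" using q(2) by simp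
  then show "induced r A [^]\<^bsub>T\<^esub> q = \<one>\<^bsub>T\<^esub>"
    unfolding pow_Brown_Thompson[OF A] using induced_eq_one_iff[OF lifts_funpow[OF A]] by blast
  assume d: "0 < d" "d < q"
  show "induced r A [^]\<^bsub>T\<^esub> d \<noteq> \<one>\<^bsub>T\<^esub>"
  proof
    assume "induced r A [^]\<^bsub>T\<^esub> d = \<one>\<^bsub>T\<^esub>"
    then obtain k :: int where k: "\<And>x. (A ^^ d) x = x + real r * of_int k"
      unfolding pow_Brown_Thompson[OF A] using induced_eq_one_iff[OF lifts_funpow[OF A]] by blast
    \<comment> \<open>Computing the same iterate in two ways gives \<open>k * q = d\<close>,
      impossible for \<open>0 < d < q\<close>.\<close>
    have "(A ^^ (d * q)) 0 = 0 + real r * of_int k * real q" by (rule funpow_translation[OF k])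
    moreover have "(A ^^ (q * d)) 0 = 0 + real r * real d" by (rule funpow_translation[OF q(2)])
    ultimately have "real r * (of_int k * real q) = real r * real d" by (simp add: mult.commute mult.left_commute)
    then have "of_int k * real q = real d" using r_pos by simp
    then have "real_of_int (k * int q) = real_of_int (int d)" by simp
    then have "k * int q = int d" by (rule of_int_eq_iff[THEN iffD1])
    then have "int q dvd int d" by (metis dvd_triv_right)
    then show False using d by (simp add: int_dvd_int_iff nat_dvd_not_less)
  qed
qed

end

subsection \<open>Binary trees and the standard generator\<close>

text \<open>The standard generator of Thompson's group F: it carries \<open>[0, 1/4]\<close>,
  \<open>[1/4, 1/2]\<close>, \<open>[1/2, 1]\<close> affinely onto \<open>[0, 1/2]\<close>,
  \<open>[1/2, 3/4]\<close>, \<open>[3/4, 1]\<close>, a rotation of the tree with three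
  leaves.\<close>

definition X_std :: "real \<Rightarrow> real" where
  "X_std x = (if x \<le> 0 then x else if x \<le> 1/4 then 2 * x else if x \<le> 1/2 then x + 1/4
     else if x \<le> 1 then (x + 1) / 2 else x)"

definition X_at :: "real \<Rightarrow> real \<Rightarrow> real \<Rightarrow> real" where
  "X_at a l x = a + l * X_std ((x - a) / l)"

lemma X_std_bounds: "0 \<le> x \<Longrightarrow> x \<le> 1 \<Longrightarrow> 0 \<le> X_std x" "0 \<le> x \<Longrightarrow> x \<le> 1 \<Longrightarrow> X_std x \<le> 1"
  by (auto simp: X_std_def)

lemma X_std_outside: "x \<le> 0 \<or> 1 \<le> x \<Longrightarrow> X_std x = x"
  by (auto simp: X_std_def)

lemma X_at_outside:
  assumes "l > 0" "x \<le> a \<or> a + l \<le> x" shows "X_at a l x = x"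
proof -
  have "(x - a) / l \<le> 0 \<or> (x - a) / l \<ge> 1" using assms by (auto simp: field_simps divide_nonpos_pos)
  then have "X_std ((x - a) / l) = (x - a) / l" by (rule X_std_outside)
  then show ?thesis using assms(1) by (simp add: X_at_def)
qed

lemma X_at_inside:
  assumes "l > 0" "a \<le> x" "x \<le> a + l" shows "a \<le> X_at a l x" "X_at a l x \<le> a + l"
proof -
  have "0 \<le> (x - a) / l" "(x - a) / l \<le> 1" using assms by (auto simp: field_simps)
  then have "0 \<le> X_std ((x - a) / l)" "X_std ((x - a) / l) \<le> 1" by (rule X_std_bounds)+
  then have "0 \<le> l * X_std ((x - a) / l)" "l * X_std ((x - a) / l) \<le> l * 1"
    using assms(1) by (simp_all only: mult_le_cancel_left_pos) (simp add: mult_nonneg_nonneg)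
  then show "a \<le> X_at a l x" "X_at a l x \<le> a + l" by (simp_all add: X_at_def)
qed

lemma X_at_range:
  assumes "l > 0" "c \<le> a" "a + l \<le> d" "c \<le> x" "x \<le> d" shows "c \<le> X_at a l x" "X_at a l x \<le> d"
  using X_at_outside[of l x a] X_at_inside[of l a x] assms by linarith+

lemma X_at_conj: "l > 0 \<Longrightarrow> l' > 0 \<Longrightarrow> X_at (a + l * b) (l * l') (a + l * x) = a + l * X_at b l' x"
proof -
  assume l: "l > 0" "l' > 0"
  then have "(a + l * x - (a + l * b)) / (l * l') = (x - b) / l'" by (simp add: field_simps)
  then show ?thesis by (simp add: X_at_def algebra_simps)
qed

text \<open>The first two are conjugations by the generator, which is affine from
  \<open>[0, 1/4]\<close> onto \<open>[0, 1/2]\<close> and from \<open>[1/2, 1]\<close> onto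
  \<open>[3/4, 1]\<close>. The third is the pentagon relation.\<close>

lemma X_std_relations:
  "X_at 0 1 (X_at 0 (1/4) x) = X_at 0 (1/2) (X_at 0 1 x)"
  "X_at 0 1 (X_at (1/2) (1/2) x) = X_at (3/4) (1/4) (X_at 0 1 x)"
  "X_at 0 1 (X_at 0 1 x) = X_at (1/2) (1/2) (X_at 0 1 (X_at 0 (1/2) x))"
  unfolding X_at_def X_std_def by (auto simp: field_simps split: if_splits)

lemma X_relations:
  assumes l: "l > 0"
  shows "X_at a l (X_at a (l / 4) x) = X_at a (l / 2) (X_at a l x)"
    "X_at a l (X_at (a + l / 2) (l / 2) x) = X_at (a + l * 3 / 4) (l / 4) (X_at a l x)"
    "X_at a l (X_at a l x) = X_at (a + l / 2) (l / 2) (X_at a l (X_at a (l / 2) x))"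
proof -
  define y where "y = (x - a) / l"
  have x: "x = a + l * y" using l by (simp add: y_def)
  have 1: "X_at a l (a + l * z) = a + l * X_at 0 1 z" for z using X_at_conj[of l 1 a 0 z] l by simp
  have 2: "X_at a (l / 4) (a + l * z) = a + l * X_at 0 (1/4) z" for z using X_at_conj[of l "1/4" a 0 z] l by simp
  have 3: "X_at a (l / 2) (a + l * z) = a + l * X_at 0 (1/2) z" for z using X_at_conj[of l "1/2" a 0 z] l by simp
  have 4: "X_at (a + l / 2) (l / 2) (a + l * z) = a + l * X_at (1/2) (1/2) z" for z
    using X_at_conj[of l "1/2" a "1/2" z] l by simp
  have 5: "X_at (a + l * 3 / 4) (l / 4) (a + l * z) = a + l * X_at (3/4) (1/4) z" for z
    using X_at_conj[of l "1/4" a "3/4" z] l by simp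
  show "X_at a l (X_at a (l / 4) x) = X_at a (l / 2) (X_at a l x)"
    unfolding x 1 2 3 X_std_relations ..
  show "X_at a l (X_at (a + l / 2) (l / 2) x) = X_at (a + l * 3 / 4) (l / 4) (X_at a l x)"
    unfolding x 1 4 5 X_std_relations ..
  show "X_at a l (X_at a l x) = X_at (a + l / 2) (l / 2) (X_at a l (X_at a (l / 2) x))"
    unfolding x 1 3 4 by (simp only: X_std_relations(3)[of y])
qed

text \<open>\<open>tree_map n p\<close>: \<open>p\<close> maps the leaves of a binary tree subdividing \<open>[0, 1]\<close>, in order,
  affinely onto \<open>[0, 1], \<dots>, [n - 1, n]\<close>.\<close>

definition node_map :: "nat \<Rightarrow> (real \<Rightarrow> real) \<Rightarrow> (real \<Rightarrow> real) \<Rightarrow> real \<Rightarrow> real" where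
  "node_map a p q x = (if x \<le> 1/2 then p (2 * x) else real a + q (2 * x - 1))"

inductive tree_map :: "nat \<Rightarrow> (real \<Rightarrow> real) \<Rightarrow> bool" where
  leaf: "tree_map 1 (\<lambda>x. x)"
| node: "tree_map a p \<Longrightarrow> tree_map b q \<Longrightarrow> tree_map (a + b) (node_map a p q)"

text \<open>The letters are copies of the generator but not their inverses; a homeomorphism is
  therefore described later by two words \<open>u\<close> and \<open>v\<close>.\<close>

inductive X_word :: "(real \<Rightarrow> real) \<Rightarrow> bool" where
  X_word_id: "X_word (\<lambda>x. x)"
| X_word_step: "X_word g \<Longrightarrow> 0 \<le> a \<Longrightarrow> a + l \<le> 1 \<Longrightarrow> a \<in> Z_inverse 2 \<Longrightarrow> l \<in> int_powers 2 \<Longrightarrow>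
    X_word (X_at a l \<circ> g)"

text \<open>The right comb with \<open>n + 1\<close> leaves, whence the index \<open>n - 1\<close>
  for trees with \<open>n\<close> leaves.\<close>

fun vine :: "nat \<Rightarrow> real \<Rightarrow> real" where
  "vine 0 x = x"
| "vine (Suc n) x = node_map 1 (\<lambda>x. x) (vine n) x"

interpretation dyadic: PL_base 2 by unfold_locales simp

lemma half_int_powers: "l \<in> int_powers 2 \<Longrightarrow> l / 2 \<in> int_powers 2"
  using dyadic.int_powers_mult[of l "1 / 2"] dyadic.int_powers_inverse[of 2] dyadic.power_int_powers[of 1] by simp

lemma half_Z_inverse: "x \<in> Z_inverse 2 \<Longrightarrow> x / 2 \<in> Z_inverse 2"
  using dyadic.Z_inverse_mult[of x "1 / 2"] dyadic.Z_inverse_int_powers[OF half_int_powers[OF dyadic.one_int_powers]]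
  by simp

lemma X_word_comp: "X_word g \<Longrightarrow> X_word h \<Longrightarrow> X_word (g \<circ> h)"
proof (induction rule: X_word.induct)
  case X_word_id then show ?case by (simp add: comp_def)
next
  case (X_word_step g a l)
  then have "X_word (X_at a l \<circ> (g \<circ> h))" by (intro X_word.X_word_step)
  then show ?case by (simp only: comp_assoc)
qed

lemma X_word_X: "X_word (X_at 0 1)"
  using X_word_step[OF X_word_id, of 0 1] dyadic.one_int_powers by (simp add: comp_def)

lemma X_word_outside: "X_word g \<Longrightarrow> x \<le> 0 \<or> 1 \<le> x \<Longrightarrow> g x = x"
proof (induction rule: X_word.induct)
  case (X_word_step g a l)
  then show ?case using X_at_outside[of l x a] dyadic.int_powers_pos[of l] by auto
qed simp

lemma X_word_inside: "X_word g \<Longrightarrow> 0 \<le> x \<Longrightarrow> x \<le> 1 \<Longrightarrow> 0 \<le> g x \<and> g x \<le> 1"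
proof (induction rule: X_word.induct)
  case (X_word_step g a l)
  then show ?case using X_at_range[of l 0 a 1 "g x"] dyadic.int_powers_pos[of l] by auto
qed simp

lemma X_std_PL: "X_std \<in> PL_homeo 2"
proof -
  have D: "(1/2::real) \<in> Z_inverse 2" "(1/4::real) \<in> Z_inverse 2"
    using half_Z_inverse[of 1] half_Z_inverse[of "1/2"] by auto
  have P: "(2::real) \<in> int_powers 2" "(1/2::real) \<in> int_powers 2"
    using dyadic.power_int_powers[of 1] half_int_powers[OF dyadic.one_int_powers] by auto
  have A: "(\<lambda>x. (x + 1) / 2) \<in> PL_homeo 2"
    using dyadic.PL_homeo_affine[OF P(2) D(1)] by (simp add: add_divide_distrib)
  have B: "(\<lambda>x. 2 * x) \<in> PL_homeo 2" using dyadic.PL_homeo_affine[OF P(1), of 0] by simp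
  have "(\<lambda>x. if x \<le> 0 then x else if x \<le> 1/4 then 2 * x else if x \<le> 1/2 then x + 1/4
     else if x \<le> 1 then (x + 1) / 2 else x) \<in> PL_homeo 2"
    by (intro dyadic.PL_homeo_glue dyadic.PL_homeo_translation dyadic.PL_homeo_id A B D
      dyadic.Z_inverse_0 dyadic.Z_inverse_1) auto
  then show ?thesis by (simp add: X_std_def[abs_def])
qed

lemma X_at_PL:
  assumes "a \<in> Z_inverse 2" "l \<in> int_powers 2"
  shows "X_at a l \<in> PL_homeo 2"
proof -
  have l: "l > 0" using assms dyadic.int_powers_pos by blast
  have il: "1 / l \<in> int_powers 2" using dyadic.int_powers_inverse assms by blast
  have D: "- (a / l) \<in> Z_inverse 2"
    using dyadic.Z_inverse_mult[OF assms(1) dyadic.Z_inverse_int_powers[OF il]] dyadic.Z_inverse_minus by simp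
  have "X_at a l = (\<lambda>x. l * x + a) \<circ> (X_std \<circ> (\<lambda>x. 1 / l * x + - (a / l)))"
    using l by (auto simp: X_at_def fun_eq_iff diff_divide_distrib)
  also have "\<dots> \<in> PL_homeo 2"
    by (intro dyadic.PL_homeo_comp X_std_PL dyadic.PL_homeo_affine assms il D)
  finally show ?thesis .
qed

lemma X_word_PL: "X_word g \<Longrightarrow> g \<in> PL_homeo 2"
  by (induction rule: X_word.induct) (use dyadic.PL_homeo_id dyadic.PL_homeo_comp X_at_PL in blast)+

text \<open>Serves trees whose left subtree is a leaf: the word of the right subtree then has to act
  on \<open>[1/2, 1]\<close>.\<close>

lemma X_word_right_half: "X_word g \<Longrightarrow> X_word (\<lambda>x. 1/2 + g (2 * x - 1) / 2)"
proof (induction rule: X_word.induct)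
  case X_word_id
  then show ?case using X_word.X_word_id by (simp add: field_simps)
next
  case (X_word_step g a l)
  have l: "l > 0" using X_word_step dyadic.int_powers_pos by blast
  have "X_word (X_at (1/2 + a / 2) (l / 2) \<circ> (\<lambda>x. 1/2 + g (2 * x - 1) / 2))"
    using X_word_step.IH
  proof (rule X_word.X_word_step)
    show "1/2 + a / 2 \<in> Z_inverse 2" using half_Z_inverse[of 1] half_Z_inverse[OF X_word_step.hyps(4)] by auto
  qed (use X_word_step half_int_powers in auto)
  moreover have "X_at (1/2 + a / 2) (l / 2) \<circ> (\<lambda>x. 1/2 + g (2 * x - 1) / 2) = (\<lambda>x. 1/2 + (X_at a l \<circ> g) (2 * x - 1) / 2)"
    using X_at_conj[of "1/2" l "1/2" a] l by (auto simp: fun_eq_iff)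
  ultimately show ?case by simp
qed

lemma tree_map_pos: "tree_map n p \<Longrightarrow> n \<ge> 1"
  by (induction rule: tree_map.induct) auto

text \<open>Rotating \<open>(p\<^sub>1 p\<^sub>2) q\<close> into \<open>p\<^sub>1 (p\<^sub>2 q)\<close> is precomposition with the generator, so every tree
  is carried to the right vine with the same number of leaves.\<close>

lemma tree_map_vine:
  assumes "tree_map n p"
  shows "\<exists>g. X_word g \<and> (\<forall>x\<in>{0..1}. vine (n - 1) (g x) = p x)"
  using assms
proof (induction n arbitrary: p rule: less_induct)
  case (less n)
  \<comment> \<open>Inner induction on the left subtree, for all right subtrees at once: a rotation
    shrinks the left one and enlarges the right one.\<close>
  have main: "tree_map a p1 \<Longrightarrow> (\<And>b q. tree_map b q \<Longrightarrow> a + b = n \<Longrightarrow>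
     \<exists>g. X_word g \<and> (\<forall>x\<in>{0..1}. vine (n - 1) (g x) = node_map a p1 q x))" for a p1
  proof (induction rule: tree_map.induct)
    case leaf
    \<comment> \<open>With a leaf on the left, the right subtree has one leaf less than the whole
      and the outer hypothesis applies to it.\<close>
    obtain g where g: "X_word g" "\<And>x. 0 \<le> x \<Longrightarrow> x \<le> 1 \<Longrightarrow> vine (b - 1) (g x) = q x"
      using less.IH[OF _ leaf(1)] leaf(2) by force
    have n: "n - 1 = Suc (b - 1)" using leaf(2) tree_map_pos[OF leaf(1)] by simp
    have "vine (n - 1) (1/2 + g (2 * x - 1) / 2) = node_map 1 (\<lambda>x. x) q x" if x: "x \<in> {0..1}" for x
    proof (cases "x \<le> 1/2")
      case True
      then have "g (2 * x - 1) = 2 * x - 1" using X_word_outside[OF g(1)] by simp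
      then show ?thesis unfolding n using True by (simp add: node_map_def field_simps)
    next
      case False
      have "g 0 < g (2 * x - 1)" using False dyadic.PL_homeoD(1)[OF X_word_PL[OF g(1)]] by (simp add: strict_mono_less)
      then have "g (2 * x - 1) > 0" using X_word_outside[OF g(1), of 0] by simp
      then show ?thesis unfolding n using False g(2)[of "2 * x - 1"] x by (simp add: node_map_def)
    qed
    then show ?case using X_word_right_half[OF g(1)] by blast
  next
    case (node a1 p1 a2 p2)
    obtain g where g: "X_word g" "\<And>x. 0 \<le> x \<Longrightarrow> x \<le> 1 \<Longrightarrow> vine (n - 1) (g x) = node_map a1 p1 (node_map a2 p2 q) x"
      using node.IH(1)[OF tree_map.node[OF node.hyps(2) node.prems(1)]] node.prems(2) by (auto simp: add.assoc)
    have "vine (n - 1) ((g \<circ> X_at 0 1) x) = node_map (a1 + a2) (node_map a1 p1 p2) q x" if x: "x \<in> {0..1}" for x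
    proof -
      have "vine (n - 1) ((g \<circ> X_at 0 1) x) = node_map a1 p1 (node_map a2 p2 q) (X_std x)"
        using g(2)[of "X_std x"] X_std_bounds[of x] x by (simp add: X_at_def)
      also have "\<dots> = node_map (a1 + a2) (node_map a1 p1 p2) q x"
      proof -
        \<comment> \<open>The breaks of \<open>X_std\<close> separate the three subtrees
          \<open>p1\<close>, \<open>p2\<close> and \<open>q\<close>.\<close>
        consider "x \<le> 1/4" | "1/4 < x" "x \<le> 1/2" | "1/2 < x" by linarith
        then show ?thesis
        proof cases
          case 1
          then have "X_std x = 2 * x" using x by (auto simp: X_std_def)
          then show ?thesis using 1 by (simp add: node_map_def)
        next
          case 2
          then have X: "X_std x = x + 1/4" by (simp add: X_std_def)
          have "2 * (2 * (x + 1/4) - 1) = 2 * (2 * x) - 1" by simp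
          then show ?thesis unfolding X using 2 by (simp add: node_map_def)
        next
          case 3
          then have X: "X_std x = (x + 1) / 2" using x by (simp add: X_std_def)
          have "2 * ((x + 1) / 2) - 1 = x" by (simp add: field_simps)
          then show ?thesis unfolding X using 3 by (simp only: node_map_def) simp
        qed
      qed
      finally show ?thesis .
    qed
    then show ?case using X_word_comp[OF g(1) X_word_X] by blast
  qed
  show ?case using less.prems
  proof cases
    case leaf
    then show ?thesis using X_word_id by auto
  next
    case (node a p1 b q)
    then show ?thesis using main by blast
  qed
qed

text \<open>Nonnegativity belongs to the induction because points on different sides of 1/2 are
  compared through the value 1 at 1/2.\<close>

lemma vine_strict_mono: "0 \<le> x \<Longrightarrow> x < y \<Longrightarrow> y \<le> 1 \<Longrightarrow> vine n x < vine n y \<and> 0 \<le> vine n x"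
proof (induction n arbitrary: x y)
  case (Suc n)
  show ?case
  proof (cases "x \<le> 1/2")
    case True
    have "0 \<le> vine n (2 * y - 1)" if "y > 1/2" "y < 1" using Suc.IH[of "2 * y - 1" 1] that by simp
    moreover have "0 \<le> vine n 1" using Suc.IH[of 0 1] by simp
    moreover have "y = 1 \<or> y < 1" using Suc by linarith
    moreover have "0 < vine n (2 * y - 1)" if "y > 1/2" using Suc.IH[of 0 "2 * y - 1"] that Suc.prems by simp
    ultimately show ?thesis using True Suc.prems by (auto simp: node_map_def)
  next
    case False
    then show ?thesis using Suc.IH[of "2 * x - 1" "2 * y - 1"] Suc.prems by (auto simp: node_map_def)
  qed
qed simp

lemma vine_inj: "0 \<le> x \<Longrightarrow> x \<le> 1 \<Longrightarrow> 0 \<le> y \<Longrightarrow> y \<le> 1 \<Longrightarrow> vine n x = vine n y \<Longrightarrow> x = y"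
  using vine_strict_mono[of x y n] vine_strict_mono[of y x n] by (metis less_irrefl linorder_less_linear)

text \<open>No standard dyadic interval other than \<open>[0, 1]\<close> itself has \<open>1/2\<close> in its interior, so a subdivision
  into at least two of them splits at \<open>1/2\<close>.\<close>

abbreviation standard_piece :: "(real \<Rightarrow> real) \<Rightarrow> nat \<Rightarrow> nat \<Rightarrow> int \<Rightarrow> bool" where
  "standard_piece q i k j \<equiv>
     \<forall>y\<in>{of_int j / 2 ^ k..(of_int j + 1) / 2 ^ k}. q y = real i + 2 ^ k * y - of_int j"

lemma standard_piece_ends:
  assumes "standard_piece q i k j"
  shows "q (of_int j / 2 ^ k) = real i" "q ((of_int j + 1) / 2 ^ k) = real i + 1"
proof -
  have "of_int j / 2 ^ k \<in> {of_int j / 2 ^ k..(of_int j + 1) / 2 ^ k :: real}"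
    "(of_int j + 1) / 2 ^ k \<in> {of_int j / 2 ^ k..(of_int j + 1) / 2 ^ k :: real}"
    by (auto simp: divide_right_mono)
  from assms[rule_format, OF this(1)] assms[rule_format, OF this(2)]
  show "q (of_int j / 2 ^ k) = real i" "q ((of_int j + 1) / 2 ^ k) = real i + 1" by simp_all
qed

text \<open>A piece of level 0 has integer ends inside \<open>[0, 1]\<close>, so it is the whole
  interval and the only piece.\<close>

lemma standard_piece_proper:
  assumes q: "strict_mono q" "q 0 = 0" "q 1 = real n" and n: "n \<ge> 2" "i < n"
    and piece: "standard_piece q i k j"
  shows "k \<noteq> 0"
proof
  assume "k = 0"
  then have e: "q (of_int j) = real i" "q (of_int j + 1) = real i + 1" using standard_piece_ends[OF piece] by auto
  have "q 0 \<le> q (of_int j)" using e q(2) by simp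
  then have "0 \<le> j" using q(1) by (simp add: strict_mono_less_eq)
  moreover have "q (of_int j + 1) \<le> q 1" using e q(3) n(2) by simp
  then have "j \<le> 0" using q(1) by (simp add: strict_mono_less_eq)
  ultimately have "j = 0" by simp
  then show False using e q n by simp
qed

text \<open>Induction on the bound \<open>K\<close> for the levels: after the split at 1/2, each
  half rescaled to \<open>[0, 1]\<close> has lost one level.\<close>

lemma standard_subdivision_tree_map:
  assumes "strict_mono q" "q 0 = 0" "q 1 = real n" "n \<ge> 1"
    "\<And>i. i < n \<Longrightarrow> \<exists>k\<le>K. \<exists>j::int. standard_piece q i k j"
  shows "\<exists>p. tree_map n p \<and> (\<forall>x\<in>{0..1}. q x = p x)"
proof -
  have one: "\<exists>p. tree_map n p \<and> (\<forall>x\<in>{0..1}. q x = p x)"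
    if q: "strict_mono q" "q 0 = 0" "q 1 = real n" and n: "n = 1"
      and piece: "standard_piece q 0 k j" for n q k j
  proof -
    have "q (of_int j / 2 ^ k) = q 0" "q ((of_int j + 1) / 2 ^ k) = q 1"
      using standard_piece_ends[OF piece] q n by auto
    then have "of_int j / 2 ^ k = (0::real)" "(of_int j + 1) / 2 ^ k = (1::real)"
      using q(1) by (simp_all only: strict_mono_eq)
    then have j: "j = 0" "2 ^ k = (1::real)" by (auto simp: field_simps)
    then have "q y = y" if "y \<in> {0..1}" for y using piece that by simp
    moreover have "tree_map n (\<lambda>x. x)" using tree_map.leaf n by simp
    ultimately show ?thesis by blast
  qed
  show ?thesis using assms
  proof (induction K arbitrary: n q)
    case (0 n q)
    then obtain j :: int where j: "standard_piece q 0 0 j"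
      using 0(5)[of 0] 0(4) by auto
    have "\<not> n \<ge> 2"
    proof
      assume "n \<ge> 2"
      then have "0 < n" by simp
      show False using standard_piece_proper[OF 0(1-3) \<open>n \<ge> 2\<close> \<open>0 < n\<close> j] by simp
    qed
    then have "n = 1" using 0(4) by linarith
    then show ?case using one[OF 0(1-3) _ j] by simp
  next
    case (Suc K n q)
    note mono = Suc.prems(1)
    show ?case
    proof (cases "n = 1")
      case True
      then show ?thesis using Suc.prems(5)[of 0] one[OF Suc.prems(1-3) True] by auto
    next
      case False
      then have n: "n \<ge> 2" using Suc.prems(4) by simp
      have piece: "\<exists>k\<le>K. \<exists>j::int. standard_piece q i (Suc k) j"
        if i: "i < n" for i
      proof -
        obtain k j where kj: "k \<le> Suc K"
          "standard_piece q i k j"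
          using Suc.prems(5)[OF i] by blast
        have "k \<noteq> 0" by (rule standard_piece_proper[OF Suc.prems(1-3) n i kj(2)])
        then obtain k' where "k = Suc k'" by (cases k) auto
        then show ?thesis using kj by blast
      qed
      have v: "0 < q (1/2)" "q (1/2) < real n"
        using strict_monoD[OF mono, of 0 "1/2"] strict_monoD[OF mono, of "1/2" 1] Suc.prems(2,3) by auto
      \<comment> \<open>The index of the piece containing 1/2.\<close>
      define a where "a = nat \<lfloor>q (1/2)\<rfloor>"
      have a: "real a \<le> q (1/2)" "q (1/2) < real a + 1" unfolding a_def using v by linarith+
      have "a < n" using a v by linarith
      obtain k j where kj: "standard_piece q a (Suc k) j"
        using piece[OF \<open>a < n\<close>] by blast
      note ends = standard_piece_ends[OF kj]
      have "q (of_int j / 2 ^ Suc k) \<le> q (1/2)" "q (1/2) < q ((of_int j + 1) / 2 ^ Suc k)" using ends a by auto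
      then have "of_int j / 2 ^ Suc k \<le> (1/2::real)" "(1/2::real) < (of_int j + 1) / 2 ^ Suc k"
        using mono by (simp_all only: strict_mono_less strict_mono_less_eq)
      then have "of_int j \<le> (2::real) ^ k" "(2::real) ^ k < of_int j + 1" by (simp_all add: field_simps)
      then have "real_of_int j \<le> real_of_int (2 ^ k)" "real_of_int (2 ^ k) < real_of_int (j + 1)" by simp_all
      then have "j \<le> 2 ^ k" "2 ^ k < j + 1" by (simp_all only: of_int_le_iff of_int_less_iff)
      \<comment> \<open>A piece of positive level that contains 1/2, right end excluded, must start
        at 1/2.\<close>
      then have "j = 2 ^ k" by linarith
      then have "of_int j / 2 ^ Suc k = (1/2::real)" by simp
      then have qa: "q (1/2) = real a" using ends(1) by (simp only:)
      then have a1: "a \<ge> 1" using v(1) by simp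
      define q1 where "q1 x = q (x / 2)" for x
      define q2 where "q2 x = q ((x + 1) / 2) - real a" for x
      have "\<exists>p. tree_map a p \<and> (\<forall>x\<in>{0..1}. q1 x = p x)"
      proof (rule Suc.IH)
        show "strict_mono q1" using mono by (simp add: strict_mono_def q1_def)
        show "q1 0 = 0" "q1 1 = real a" using Suc.prems(2) qa by (simp_all add: q1_def)
        fix i assume "i < a"
        then obtain k j where kj: "k \<le> K"
          "standard_piece q i (Suc k) j"
          using piece[of i] \<open>a < n\<close> by auto
        have "q1 y = real i + 2 ^ k * y - of_int j" if y: "y \<in> {of_int j / 2 ^ k..(of_int j + 1) / 2 ^ k}" for y
        proof -
          have "y / 2 \<in> {of_int j / 2 ^ Suc k..(of_int j + 1) / 2 ^ Suc k}" using y by (auto simp: field_simps)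
          from bspec[OF kj(2) this] show ?thesis by (simp add: q1_def)
        qed
        then show "\<exists>k\<le>K. \<exists>j::int. standard_piece q1 i k j"
          using kj(1) by blast
      qed (rule a1)
      then obtain p1 where p1: "tree_map a p1" "\<And>x. x \<in> {0..1} \<Longrightarrow> q1 x = p1 x" by blast
      have "\<exists>p. tree_map (n - a) p \<and> (\<forall>x\<in>{0..1}. q2 x = p x)"
      proof (rule Suc.IH)
        show "strict_mono q2" using mono by (simp add: strict_mono_def q2_def)
        show "q2 0 = 0" "q2 1 = real (n - a)" using Suc.prems(3) qa \<open>a < n\<close> by (simp_all add: q2_def of_nat_diff)
        fix i assume "i < n - a"
        then have ai: "a + i < n" by simp
        obtain k j where kj: "k \<le> K"
          "standard_piece q (a + i) (Suc k) j"
          using piece[OF ai] by blast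
        \<comment> \<open>Among intervals of level \<open>k + 1\<close>, the right half starts at
          index \<open>2 ^ k\<close>.\<close>
        define j' where "j' = j - 2 ^ k"
        have "q2 y = real i + 2 ^ k * y - of_int j'" if y: "y \<in> {of_int j' / 2 ^ k..(of_int j' + 1) / 2 ^ k}" for y
        proof -
          have "(y + 1) / 2 \<in> {of_int j / 2 ^ Suc k..(of_int j + 1) / 2 ^ Suc k}" using y by (auto simp: field_simps j'_def)
          from bspec[OF kj(2) this] show ?thesis by (simp add: q2_def j'_def algebra_simps)
        qed
        then show "\<exists>k\<le>K. \<exists>j::int. standard_piece q2 i k j"
          using kj(1) by blast
      qed (use \<open>a < n\<close> in simp)
      then obtain p2 where p2: "tree_map (n - a) p2" "\<And>x. x \<in> {0..1} \<Longrightarrow> q2 x = p2 x" by blast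
      have "tree_map (a + (n - a)) (node_map a p1 p2)" by (rule tree_map.node[OF p1(1) p2(1)])
      moreover have "q x = node_map a p1 p2 x" if "x \<in> {0..1}" for x
        using that p1(2)[of "2 * x"] p2(2)[of "2 * x - 1"] by (auto simp: node_map_def q1_def q2_def)
      ultimately show ?thesis using \<open>a < n\<close> by auto
    qed
  qed
qed

section \<open>Dyadic homeomorphisms of [0, 1] as pairs of trees\<close>

lemma uniform_tree_map: "tree_map (2 ^ N) (\<lambda>x. 2 ^ N * x)"
proof (induction N)
  case 0 then show ?case using tree_map.leaf by simp
next
  case (Suc N)
  have "node_map (2 ^ N) (\<lambda>x. 2 ^ N * x) (\<lambda>x. 2 ^ N * x) = (\<lambda>x. 2 ^ Suc N * x)"
    by (auto simp: node_map_def fun_eq_iff algebra_simps)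
  moreover have "2 ^ N + 2 ^ N = (2::nat) ^ Suc N" by simp
  ultimately show ?case using tree_map.node[OF Suc Suc] by (simp only:)
qed

lemma dyadic_multiple:
  assumes "x \<in> Z_inverse 2"
  obtains B where "\<And>N. N \<ge> B \<Longrightarrow> \<exists>M::int. x * 2 ^ N = of_int M"
proof -
  obtain M :: int and B where MB: "x * 2 ^ B = of_int M" using assms unfolding dyadic.Z_inverse_iff by auto
  have "\<exists>M::int. x * 2 ^ N = of_int M" if "N \<ge> B" for N
  proof -
    have "(2::real) ^ N = 2 ^ B * 2 ^ (N - B)" using that by (simp flip: power_add)
    then have "x * 2 ^ N = of_int (M * 2 ^ (N - B))" using MB by simp
    then show ?thesis by blast
  qed
  then show ?thesis using that by blast
qed

text \<open>Says that the \<open>i\<close>-th standard dyadic interval of level \<open>N\<close>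
  goes affinely onto the \<open>j\<close>-th one of some level \<open>k\<close>.\<close>

definition standard_at :: "(real \<Rightarrow> real) \<Rightarrow> nat \<Rightarrow> int \<Rightarrow> bool" where
  "standard_at g N i \<longleftrightarrow> (\<exists>k. \<exists>j::int. \<forall>t\<in>{of_int i / 2 ^ N..(of_int i + 1) / 2 ^ N}.
     g t = (of_int j + 2 ^ N * t - of_int i) / 2 ^ k)"

text \<open>A fine grid contains the breaks, so none of its intervals straddles one. On a piece
  \<open>s * t + b\<close> the image mesh is \<open>s / 2 ^ N\<close>, and \<open>b\<close> is a
  multiple of it once it is fine enough.\<close>

lemma eventually_standard:
  assumes g: "g \<in> PL_homeo 2" and "(dyadic.affine_step g)\<^sup>*\<^sup>* x y"
  shows "\<exists>N0. \<forall>N\<ge>N0. \<forall>i. x \<le> of_int i / 2 ^ N \<and> (of_int i + 1) / 2 ^ N \<le> y \<longrightarrow> standard_at g N i"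
  using assms(2)
proof (induction)
  case base
  have "\<not> (of_int i + 1) / 2 ^ N \<le> of_int i / (2::real) ^ N" for i N by (simp add: divide_le_cancel)
  then show ?case by (meson order_trans)
next
  case (step y z)
  obtain N0 where N0: "\<And>N i. N \<ge> N0 \<Longrightarrow> x \<le> of_int i / 2 ^ N \<Longrightarrow> (of_int i + 1) / 2 ^ N \<le> y \<Longrightarrow> standard_at g N i"
    using step.IH by blast
  obtain s where s: "y \<in> Z_inverse 2" "s \<in> int_powers 2" "\<And>w. y \<le> w \<Longrightarrow> w \<le> z \<Longrightarrow> g w = g y + s * (w - y)"
    "z \<in> Z_inverse 2" "y < z"
    using step.hyps(2) unfolding dyadic.affine_step_def by (metis atLeastAtMost_iff)
  obtain e where e: "s = 2 powi e" using s(2) unfolding int_powers_def by auto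
  define b where "b = g y - s * y"
  have "b \<in> Z_inverse 2" unfolding b_def
    using dyadic.PL_homeoD(5)[OF g] s(1) dyadic.Z_inverse_int_powers[OF s(2)] by auto
  then obtain B where B: "\<And>N. N \<ge> B \<Longrightarrow> \<exists>M::int. b * 2 ^ N = of_int M" using dyadic_multiple by blast
  obtain C where C: "\<And>N. N \<ge> C \<Longrightarrow> \<exists>M::int. y * 2 ^ N = of_int M" using dyadic_multiple[OF s(1)] by blast
  have "standard_at g N i"
    \<comment> \<open>\<open>C\<close> puts the break \<open>y\<close> on the grid; \<open>B\<close>
      and the absolute value of \<open>e\<close> make the image level \<open>k = N - e\<close> at
      least \<open>B\<close>.\<close>
    if N: "N \<ge> N0 + C + B + nat \<bar>e\<bar>" and i: "x \<le> of_int i / 2 ^ N" "(of_int i + 1) / 2 ^ N \<le> z" for N i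
  proof -
    obtain Y :: int where Y: "y * 2 ^ N = of_int Y" using C[of N] N by auto
    show ?thesis
    proof (cases "i < Y")
      case True
      then have "of_int i + 1 \<le> y * 2 ^ N" unfolding Y by linarith
      then have "(of_int i + 1) / 2 ^ N \<le> y" by (simp add: field_simps)
      then show ?thesis using N0[of N i] N i by simp
    next
      case False
      then have "y * 2 ^ N \<le> of_int i" unfolding Y by linarith
      then have yi: "y \<le> of_int i / 2 ^ N" by (simp add: field_simps)
      define k where "k = nat (int N - e)"
      have k: "int k = int N - e" "k \<ge> B" unfolding k_def using N by linarith+
      obtain M :: int where M: "b * 2 ^ k = of_int M" using B[OF k(2)] by blast
      have "s * 2 ^ k = 2 powi e * 2 powi (int k)" unfolding e by simp
      also have "\<dots> = 2 powi (int N)" unfolding k(1) by (simp flip: power_int_add)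
      finally have sk: "s * 2 ^ k = 2 ^ N" by simp
      have "g t = (of_int (M + i) + 2 ^ N * t - of_int i) / 2 ^ k"
        if t: "t \<in> {of_int i / 2 ^ N..(of_int i + 1) / 2 ^ N}" for t
      proof -
        have "y \<le> t" "t \<le> z" using t yi i(2) by auto
        then have "g t = g y + s * (t - y)" by (rule s(3))
        then have "g t = s * t + b" by (simp add: b_def algebra_simps)
        then have "g t * 2 ^ k = (s * 2 ^ k) * t + b * 2 ^ k" by (simp add: algebra_simps)
        then have "g t * 2 ^ k = 2 ^ N * t + of_int M" unfolding sk M .
        then show ?thesis by (simp add: field_simps)
      qed
      then show ?thesis unfolding standard_at_def by blast
    qed
  qed
  then show ?case by blast
qed

text \<open>The domain gets the uniform subdivision of level \<open>N\<close>; for \<open>N\<close>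
  large its image is a standard subdivision, described by \<open>2 ^ N\<close> times the inverse of
  \<open>g\<close>.\<close>

lemma PL_homeo_tree_maps:
  assumes g: "g \<in> PL_homeo 2" "g 0 = 0" "g 1 = 1"
  obtains n p q where "tree_map n p" "tree_map n q" "\<And>x. 0 \<le> x \<Longrightarrow> x \<le> 1 \<Longrightarrow> q (g x) = p x"
proof -
  have mono: "strict_mono g" by (rule dyadic.PL_homeoD(1)[OF g(1)])
  have gg: "g (finv g x) = x" "finv g (g x) = x" for x
    using dyadic.PL_homeoD(2,3)[OF g(1)] by (auto simp: surj_f_inv_f)
  obtain N where N: "\<And>i::int. 0 \<le> of_int i / (2::real) ^ N \<Longrightarrow> (of_int i + 1) / (2::real) ^ N \<le> 1 \<Longrightarrow> standard_at g N i"
    using eventually_standard[OF g(1) dyadic.affine_chain[OF g(1), of 0 1]] by auto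
  define q where "q y = 2 ^ N * finv g y" for y
  have "\<exists>k. \<exists>j::int. standard_piece q i k j"
    if i: "i < 2 ^ N" for i
  proof -
    have "real (i + 1) \<le> real (2 ^ N)" using i by (intro of_nat_mono) simp
    then have "(of_int (int i) + 1) / (2::real) ^ N \<le> 1" by simp
    then have "standard_at g N (int i)" by (intro N) simp_all
    then obtain k and j :: int where kj: "\<And>t. t \<in> {of_int (int i) / 2 ^ N..(of_int (int i) + 1) / 2 ^ N} \<Longrightarrow>
      g t = (of_int j + 2 ^ N * t - of_int (int i)) / 2 ^ k" unfolding standard_at_def by blast
    have "q y = real i + 2 ^ k * y - of_int j" if y: "y \<in> {of_int j / 2 ^ k..(of_int j + 1) / 2 ^ k}" for y
    proof -
      define t where "t = (real i + 2 ^ k * y - of_int j) / 2 ^ N"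
      have "of_int j \<le> y * 2 ^ k" "y * 2 ^ k \<le> of_int j + 1" using y by (auto simp: field_simps)
      then have "t \<in> {of_int (int i) / 2 ^ N..(of_int (int i) + 1) / 2 ^ N}"
        by (auto simp: t_def algebra_simps intro!: divide_right_mono)
      then have "g t = (of_int j + 2 ^ N * t - of_int (int i)) / 2 ^ k" by (rule kj)
      also have "\<dots> = y" by (simp add: t_def)
      finally have "finv g y = t" using gg(2)[of t] by simp
      then show ?thesis by (simp add: q_def t_def)
    qed
    then show ?thesis by blast
  qed
  then obtain k where k: "\<And>i. i < 2 ^ N \<Longrightarrow> \<exists>j::int. standard_piece q i (k i) j"
    by metis
  define K where "K = Max (k ` {..<2 ^ N})"
  have K: "k i \<le> K" if "i < 2 ^ N" for i unfolding K_def using that by (intro Max_ge) auto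
  have "finv g 0 = 0" "finv g 1 = 1" using gg g by metis+
  then have "\<exists>p. tree_map (2 ^ N) p \<and> (\<forall>x\<in>{0..1}. q x = p x)"
  proof (intro standard_subdivision_tree_map[of q "2 ^ N" K])
    show "strict_mono q" using dyadic.PL_homeoD(1)[OF dyadic.PL_homeo_inv[OF g(1)]]
      by (simp add: strict_mono_def q_def)
    show "\<exists>k\<le>K. \<exists>j::int. standard_piece q i k j"
      if "i < 2 ^ N" for i using k[OF that] K[OF that] by blast
  qed (simp_all add: q_def)
  then obtain p where p: "tree_map (2 ^ N) p" "\<And>x. x \<in> {0..1} \<Longrightarrow> q x = p x" by blast
  have "p (g x) = 2 ^ N * x" if x: "0 \<le> x" "x \<le> 1" for x
  proof -
    have "g 0 \<le> g x" "g x \<le> g 1" using x mono by (simp_all only: strict_mono_less_eq)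
    then have "g x \<in> {0..1}" using g(2,3) by simp
    then have "p (g x) = q (g x)" using p(2) by simp
    then show ?thesis by (simp only: q_def gg(2))
  qed
  then show ?thesis using that[OF uniform_tree_map p(1)] by blast
qed

text \<open>Both trees have the same number of leaves, so they reduce to the same vine, which
  cancels by injectivity.\<close>

lemma PL_homeo_X_words:
  assumes g: "g \<in> PL_homeo 2" "g 0 = 0" "g 1 = 1"
  obtains u v where "X_word u" "X_word v" "\<And>x. 0 \<le> x \<Longrightarrow> x \<le> 1 \<Longrightarrow> v (g x) = u x"
proof -
  obtain n p q where pq: "tree_map n p" "tree_map n q" "\<And>x. 0 \<le> x \<Longrightarrow> x \<le> 1 \<Longrightarrow> q (g x) = p x"
    using PL_homeo_tree_maps[OF g] by blast
  obtain u where u: "X_word u" "\<And>x. x \<in> {0..1} \<Longrightarrow> vine (n - 1) (u x) = p x" using tree_map_vine[OF pq(1)] by blast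
  obtain v where v: "X_word v" "\<And>x. x \<in> {0..1} \<Longrightarrow> vine (n - 1) (v x) = q x" using tree_map_vine[OF pq(2)] by blast
  have "v (g x) = u x" if x: "0 \<le> x" "x \<le> 1" for x
  proof -
    have "g 0 \<le> g x" "g x \<le> g 1" using x dyadic.PL_homeoD(1)[OF g(1)] by (simp_all only: strict_mono_less_eq)
    then have gx: "0 \<le> g x" "g x \<le> 1" using g(2,3) by simp_all
    have "vine (n - 1) (v (g x)) = vine (n - 1) (u x)" using u(2)[of x] v(2)[of "g x"] pq(3)[OF x] x gx by simp
    moreover have "0 \<le> v (g x)" "v (g x) \<le> 1" "0 \<le> u x" "u x \<le> 1"
      using X_word_inside[OF u(1) x] X_word_inside[OF v(1) gx] by simp_all
    ultimately show ?thesis using vine_inj by blast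
  qed
  then show ?thesis using that u(1) v(1) by blast
qed

subsection \<open>Quotients of Thompson's group\<close>

text \<open>A homomorphism from Thompson's group T to any group, written on lifts; killing the
  integer translations makes it factor through the quotient.\<close>

locale Thompson_hom = group G + Brown_Thompson_lifts 2 1 for G (structure) +
  fixes \<eta> :: "(real \<Rightarrow> real) \<Rightarrow> 'a"
  assumes eta_closed: "F \<in> lifts \<Longrightarrow> \<eta> F \<in> carrier G"
    and eta_mult: "F \<in> lifts \<Longrightarrow> H \<in> lifts \<Longrightarrow> \<eta> (F \<circ> H) = \<eta> F \<otimes> \<eta> H"
    and eta_translation: "\<eta> (\<lambda>x. x + of_int n) = \<one>"
begin

declare One_nat_def [simp del]

lemma periodic: "F \<in> lifts \<Longrightarrow> F (x + 1) = F x + 1" "F \<in> lifts \<Longrightarrow> F (x + of_int n) = F x + of_int n"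
  "F \<in> lifts \<Longrightarrow> F (x - 1) = F x - 1"
  using liftsD(2)[of F x] lifts_int[of F x n] lifts_int[of F x "- 1"] by simp_all

lemma eta_id: "\<eta> (\<lambda>x. x) = \<one>" using eta_translation[of 0] by simp

lemma lifts_agree:
  assumes F: "F \<in> lifts" and H: "H \<in> lifts" and eq: "\<And>x. c \<le> x \<Longrightarrow> x \<le> c + 1 \<Longrightarrow> F x = H x"
  shows "F = H"
proof
  fix x
  define n where "n = \<lfloor>x - c\<rfloor>"
  have "F (x - of_int n) = H (x - of_int n)" unfolding n_def by (rule eq) linarith+
  then show "F x = H x" using periodic(2)[OF F, of "x - of_int n" n] periodic(2)[OF H, of "x - of_int n" n] by simp
qed

lemma eta_eq_one_of_conj:
  assumes F: "F \<in> lifts" and s: "s \<in> lifts" and eta: "\<eta> F = \<one>" and eq: "s \<circ> F = H \<circ> s" and H: "H \<in> lifts"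
  shows "\<eta> H = \<one>"
proof -
  have "\<eta> s \<otimes> \<eta> F = \<eta> H \<otimes> \<eta> s" using eta_mult F H s eq by metis
  then have "\<one> \<otimes> \<eta> s = \<eta> H \<otimes> \<eta> s" using eta eta_closed[OF s] by simp
  then show ?thesis using eta_closed[OF s] eta_closed[OF H] right_cancel one_closed by metis
qed

text \<open>The conjugate of \<open>g\<close> by \<open>x\<close> has the same image as
  \<open>g\<close>, and it fixes \<open>A\<close> pointwise while \<open>s\<close> moves only points
  of \<open>A\<close>.\<close>

lemma eta_commute:
  assumes g: "g \<in> lifts" and s: "s \<in> lifts" and x: "x \<in> lifts" "\<eta> x = \<one>"
    and supp: "\<And>y. y \<notin> A \<Longrightarrow> g y = y" "\<And>y. y \<notin> A \<Longrightarrow> s y = y" and disp: "\<And>y. y \<in> A \<Longrightarrow> x y \<notin> A"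
  shows "\<eta> g \<otimes> \<eta> s = \<eta> s \<otimes> \<eta> g"
proof -
  define g' where "g' = x \<circ> g \<circ> finv x"
  have g': "g' \<in> lifts" unfolding g'_def using g x lifts_comp lifts_inv by blast
  have "g' \<circ> x = x \<circ> g" unfolding g'_def using x(1) by (auto simp: fun_eq_iff)
  then have "\<eta> g' \<otimes> \<eta> x = \<eta> x \<otimes> \<eta> g" using eta_mult g g' x by metis
  then have eg: "\<eta> g' = \<eta> g" using x eta_closed g g' by simp
  have inj: "g y = g z \<Longrightarrow> y = z" "s y = s z \<Longrightarrow> y = z" for y z
    using g s by (metis finv_lifts(1))+
  have off: "finv x y \<notin> A" if "y \<in> A" for y
    using disp[of "finv x y"] x(1) that by auto
  have 1: "g' y = y" if "y \<in> A" for y unfolding g'_def using off[OF that] supp(1) x(1) by simp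
  have 2: "g' y \<notin> A" if "y \<notin> A" for y
  proof
    assume a: "g' y \<in> A"
    define w where "w = finv x (g' y)"
    have "w \<notin> A" unfolding w_def by (rule off[OF a])
    then have "g w = w" by (rule supp(1))
    moreover have "w = g (finv x y)" using x(1) by (simp add: w_def g'_def)
    ultimately have "finv x y = w" using inj(1) by metis
    then have "y = g' y" unfolding w_def using x(1) by (metis finv_lifts(2))
    then show False using a that by simp
  qed
  have 3: "s y \<in> A" if "y \<in> A" for y
    using supp(2)[of "s y"] inj(2)[of "s y" y] that by metis
  have "g' (s y) = s (g' y)" for y
    by (cases "y \<in> A") (use 1 2 3 supp(2) in simp_all)
  then have "g' \<circ> s = s \<circ> g'" by auto
  then have "\<eta> g' \<otimes> \<eta> s = \<eta> s \<otimes> \<eta> g'" using eta_mult g' s by metis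
  then show ?thesis unfolding eg .
qed

text \<open>The fundamental domain starts at \<open>a\<close>, so this is a copy of the generator on
  an arc even if the arc passes through the base point.\<close>

definition X_circle :: "real \<Rightarrow> real \<Rightarrow> real \<Rightarrow> real" where
  "X_circle a l = periodic_ext a 1 1 (X_at a l)"

lemma X_circle_lifts:
  assumes a: "a \<in> D" and l: "l \<in> slopes" "l \<le> 1"
  shows "X_circle a l \<in> lifts"
proof (rule liftsI)
  have l0: "l > 0" using l int_powers_pos by blast
  have eq: "X_at a l (a + 1) = X_at a l a + 1" using X_at_outside[OF l0] l(2) by simp
  show "X_circle a l \<in> PL_homeo 2" unfolding X_circle_def
    using X_at_PL[OF a l(1)] a eq by (intro PL_homeo_periodic_ext) auto
  show "X_circle a l (x + real 1) = X_circle a l x + real 1" for x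
    unfolding X_circle_def using periodic_ext_shift[of 1 a 1 "X_at a l" x] by simp
qed

lemma X_circle_eq:
  assumes a: "a \<in> D" and l: "l \<in> slopes" and c: "c \<le> a" "a + l \<le> c + 1" and x: "c \<le> x" "x \<le> c + 1"
  shows "X_circle a l x = X_at a l x"
proof -
  have l0: "l > 0" using l int_powers_pos by blast
  have eq: "X_at a l (a + 1) = X_at a l a + 1" using X_at_outside[OF l0] c by simp
  have L: "X_circle a l \<in> lifts" using X_circle_lifts a l c by simp
  have on: "X_circle a l y = X_at a l y" if "a \<le> y" "y \<le> a + 1" for y
    unfolding X_circle_def using periodic_ext_eq[of 1 "X_at a l" a 1 y] eq that by simp
  show ?thesis
  proof (cases "a \<le> x")
    case True
    then show ?thesis using on x c by simp
  next
    case False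
    have "a \<le> x + 1" using c x l0 by linarith
    then have "X_circle a l (x + 1) = x + 1" using on[of "x + 1"] False x c X_at_outside[OF l0, of "x + 1" a] by simp
    then have "X_circle a l x = x" using periodic(1)[OF L] by simp
    then show ?thesis using X_at_outside[OF l0] False by simp
  qed
qed

abbreviation arc :: "real \<Rightarrow> real \<Rightarrow> real set" where
  "arc a b \<equiv> {y. \<exists>n::int. a \<le> y + of_int n \<and> y + of_int n \<le> b}"

lemma X_circle_support:
  assumes a: "a \<in> D" and l: "l \<in> slopes" "l \<le> 1" and J: "b \<le> a" "a + l \<le> d"
    and y: "y \<notin> arc b d"
  shows "X_circle a l y = y"
proof -
  have l0: "l > 0" using l int_powers_pos by blast
  define n where "n = - \<lfloor>y - a\<rfloor>"
  have n: "a \<le> y + of_int n" "y + of_int n \<le> a + 1" unfolding n_def by linarith+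
  have "\<not> (b \<le> y + of_int n \<and> y + of_int n \<le> d)" using y by blast
  then have "a + l \<le> y + of_int n" using n J by linarith
  then have "X_at a l (y + of_int n) = y + of_int n" using X_at_outside[OF l0] by simp
  then have "X_circle a l (y + of_int n) = y + of_int n" using X_circle_eq[OF a l(1), of a] n l(2) by simp
  then show ?thesis using periodic(2)[OF X_circle_lifts[OF a l], of y n] by simp
qed

text \<open>Were \<open>x z - z\<close> an integer for every \<open>z\<close>, then \<open>x\<close>
  would lift the identity and be a translation. At another \<open>z\<close>, continuity moves a
  whole short arc off itself.\<close>

lemma displaced_interval:
  assumes x: "x \<in> lifts" and nontriv: "\<not> (\<exists>k::int. \<forall>y. x y = y + of_int k)"
  obtains a l where "a \<in> D" "l \<in> slopes" "l \<le> 1/4"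
    "\<And>y. y \<in> arc a (a + l) \<Longrightarrow>
         x y \<notin> arc a (a + l)"
proof -
  have "\<exists>z. \<forall>n::int. x z - z \<noteq> of_int n"
  proof (rule ccontr)
    assume "\<not> ?thesis"
    then have "\<forall>z. \<exists>n::int. x z = z + real 1 * of_int n" by (auto simp: algebra_simps)
    then have "circle_proj 1 z = circle_proj 1 (x z)" for z unfolding circle_proj_eq by blast
    then have "is_lift 1 (induced 1 (\<lambda>x. x)) x"
      using induced_circle_proj[of "\<lambda>x. x" 1]
        strict_mono_surj_continuous[OF PL_homeoD(1,2)[OF liftsD(1)[OF x]]] unfolding is_lift_def by simp
    then obtain k :: int where "\<And>y. x y = y + real 1 * of_int k"
      using lifts_differ_by_multiple[OF _ _ is_lift_induced[OF lifts_id]] by blast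
    then show False using nontriv by auto
  qed
  then obtain z where z: "\<And>n::int. x z - z \<noteq> of_int n" by blast
  define w where "w = x z - z"
  \<comment> \<open>The distance from \<open>w\<close> to the nearest integer.\<close>
  define e where "e = min (frac w) (1 - frac w)"
  have "frac w > 0" using z[of "\<lfloor>w\<rfloor>"] unfolding w_def[symmetric] frac_def by linarith
  then have e: "e > 0" unfolding e_def using frac_lt_1[of w] by simp
  have far: "e \<le> \<bar>of_int i - w\<bar>" for i :: int
  proof (cases "i \<le> \<lfloor>w\<rfloor>")
    case True
    then have "real_of_int i \<le> of_int \<lfloor>w\<rfloor>" by simp
    then show ?thesis unfolding e_def frac_def by linarith
  next
    case False
    then have "real_of_int i \<ge> of_int \<lfloor>w\<rfloor> + 1" by linarith
    then show ?thesis unfolding e_def frac_def by linarith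
  qed
  have "isCont x z" using strict_mono_surj_continuous[OF PL_homeoD(1,2)[OF liftsD(1)[OF x]]]
    by (simp add: continuous_on_eq_continuous_at)
  then obtain d where d: "d > 0" "\<And>y. \<bar>y - z\<bar> < d \<Longrightarrow> \<bar>x y - x z\<bar> < e / 2"
    unfolding continuous_at_eps_delta dist_real_def using e by (meson half_gt_zero)
  define d' where "d' = min (1/4) (min d (e / 2))"
  have d': "d' > 0" "d' \<le> d" "d' \<le> e / 2" "d' \<le> 1/4" unfolding d'_def using d e by auto
  obtain n where n: "1 / real 2 ^ n < d'" using small_power[OF d'(1)] by blast
  define l where "l = 1 / real 2 ^ n"
  have l: "l \<in> slopes" "l < d'" "l > 0"
    using int_powers_inverse[OF power_int_powers[of n]] n by (simp_all add: l_def)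
  obtain a where a: "a \<in> D" "z - d' < a" "a < z" using Z_inverse_dense[of "z - d'" z] d' by auto
  have near: "\<bar>y - z\<bar> < d'" if "a \<le> y" "y \<le> a + l" for y using that a l by linarith
  show ?thesis
  proof (rule that[OF a(1) l(1)])
    show "l \<le> 1/4" using l d' by simp
    fix y assume "y \<in> arc a (a + l)"
    then obtain n :: int where n: "a \<le> y + of_int n" "y + of_int n \<le> a + l" by blast
    show "x y \<notin> arc a (a + l)"
    proof
      assume "x y \<in> arc a (a + l)"
      then obtain k :: int where k: "a \<le> x y + of_int k" "x y + of_int k \<le> a + l" by blast
      \<comment> \<open>Two errors below \<open>e / 2\<close> would put \<open>w\<close> closer than
        \<open>e\<close> to an integer.\<close>
      have "\<bar>x (y + of_int n) - x z\<bar> < e / 2" using near[OF n] d' by (intro d(2)) simp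
      then have "\<bar>x y + of_int n - x z\<bar> < e / 2" using periodic(2)[OF x] by simp
      moreover have "\<bar>x y + of_int k - z\<bar> < e / 2" using near[OF k] d' by simp
      ultimately have "\<bar>of_int (n - k) - w\<bar> < e" unfolding w_def of_int_diff by linarith
      then show False using far[of "n - k"] by linarith
    qed
  qed
qed

text \<open>The copy on \<open>[c, c + 2 * k]\<close> expands \<open>[c, c + k / 2]\<close> to
  \<open>[c, c + k]\<close>, and the copy on \<open>[a, a + 2 * k]\<close> shrinks
  \<open>[c, c + k]\<close> to \<open>[c + k / 2, c + k]\<close>. Conjugation by them is invisible
  to \<open>\<eta>\<close>, as all supports lie in the displaced arc.\<close>

lemma eta_X_circle_small:
  assumes x: "x \<in> lifts" "\<eta> x = \<one>" "\<not> (\<exists>k::int. \<forall>y. x y = y + of_int k)"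
  obtains c k where "c \<in> D" "k \<in> slopes" "k \<le> 1/4" "\<eta> (X_circle c k) = \<one>"
proof -
  obtain a l where a: "a \<in> D" and l: "l \<in> slopes" "l \<le> 1/4" and
    disp: "\<And>y. y \<in> arc a (a + l) \<Longrightarrow>
         x y \<notin> arc a (a + l)"
    using displaced_interval[OF x(1,3)] by blast
  have comm: "\<eta> (X_circle b h) \<otimes> \<eta> (X_circle b' h') = \<eta> (X_circle b' h') \<otimes> \<eta> (X_circle b h)"
    if "b \<in> D" "h \<in> slopes" "b' \<in> D" "h' \<in> slopes"
      "a \<le> b" "b + h \<le> a + l" "a \<le> b'" "b' + h' \<le> a + l" for b h b' h'
  proof (rule eta_commute[OF _ _ x(1,2) _ _ disp])
    have le: "h \<le> 1" "h' \<le> 1" using that l by linarith+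
    show "X_circle b h \<in> lifts" "X_circle b' h' \<in> lifts" using X_circle_lifts that le by auto
    show "X_circle b h y = y" "X_circle b' h' y = y"
      if "y \<notin> arc a (a + l)" for y
      using X_circle_support[of _ _ a "a + l", OF _ _ _ _ _ that] \<open>b \<in> D\<close> \<open>h \<in> slopes\<close> le
        \<open>b' \<in> D\<close> \<open>h' \<in> slopes\<close> \<open>a \<le> b\<close> \<open>b + h \<le> a + l\<close> \<open>a \<le> b'\<close> \<open>b' + h' \<le> a + l\<close> by auto
  qed
  \<comment> \<open>A quarter leaves room for both conjugators, on \<open>[a, a + 2 * k]\<close> and
    \<open>[a + k, a + 3 * k]\<close>.\<close>
  define k where "k = l / 4"
  have kP: "k \<in> slopes" "2 * k \<in> slopes" "k / 2 \<in> slopes"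
    using half_int_powers[OF half_int_powers[OF l(1)]] half_int_powers[OF l(1)] half_int_powers[OF half_int_powers[OF half_int_powers[OF l(1)]]]
    by (simp_all add: k_def)
  have kD: "k \<in> D" "k / 2 \<in> D" using kP Z_inverse_int_powers by auto
  have k0: "k > 0" "l = 4 * k" using int_powers_pos[OF kP(1)] by (simp_all add: k_def)
  define c where "c = a + k"
  have "c \<in> D" unfolding c_def using a kD(1) by (rule Z_inverse_add)
  then have cD: "c \<in> D" "c + k / 2 \<in> D" using Z_inverse_add[OF _ kD(2)] by simp_all
  have XL: "X_circle a (2 * k) \<in> lifts" "X_circle c (2 * k) \<in> lifts" "X_circle c k \<in> lifts" "X_circle c (k / 2) \<in> lifts"
    "X_circle (c + k / 2) (k / 2) \<in> lifts"
    using a cD kP l k0 by (auto intro!: X_circle_lifts)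
  have Xeq: "X_circle b h y = X_at b h y" if "b \<in> D" "h \<in> slopes" "a \<le> b" "b + h \<le> a + 1" "a \<le> y" "y \<le> a + 1" for b h y
    using X_circle_eq[OF that(1,2,3,4,5,6)] .
  have Xr: "a \<le> X_at b h y \<and> X_at b h y \<le> a + 1" if "h \<in> slopes" "a \<le> b" "b + h \<le> a + 1" "a \<le> y" "y \<le> a + 1" for b h y
    using X_at_range[of h a b "a + 1" y] int_powers_pos[OF that(1)] that by simp
  have bounds: "a \<le> a" "a + 2 * k \<le> a + 1" "a \<le> c" "c + 2 * k \<le> a + 1" "c + k \<le> a + 1" "c + k / 2 \<le> a + 1"
    "a \<le> c + k / 2" "c + k / 2 + k / 2 \<le> a + 1"
    using k0 l by (auto simp: c_def)
  note simps = Xeq Xr a cD kP bounds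
  have rel1: "X_circle c (2 * k) \<circ> X_circle c (k / 2) = X_circle c k \<circ> X_circle c (2 * k)"
    using XL
  proof (intro lifts_agree[of _ _ a] lifts_comp)
    fix y assume "a \<le> y" "y \<le> a + 1"
    then show "(X_circle c (2 * k) \<circ> X_circle c (k / 2)) y = (X_circle c k \<circ> X_circle c (2 * k)) y"
      using X_relations(1)[of "2 * k" c y] k0 by (simp add: simps)
  qed
  have rel2: "X_circle a (2 * k) \<circ> X_circle c k = X_circle (c + k / 2) (k / 2) \<circ> X_circle a (2 * k)"
    using XL
  proof (intro lifts_agree[of _ _ a] lifts_comp)
    fix y assume y: "a \<le> y" "y \<le> a + 1"
    have e: "a + k = c" "2 * k / 2 = k" "a + 2 * k * 3 / 4 = c + k / 2" "2 * k / 4 = k / 2" by (auto simp: c_def)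
    have "2 * k > 0" using k0 by simp
    then have "X_at a (2 * k) (X_at c k y) = X_at (c + k / 2) (k / 2) (X_at a (2 * k) y)"
      using X_relations(2)[of "2 * k" a y] unfolding e by blast
    then have rel: "X_at a (2 * k) (X_at c k y) = X_at (c + k / 2) (k / 2) (X_at a (2 * k) y)" by blast
    have r: "a \<le> X_at c k y" "X_at c k y \<le> a + 1" "a \<le> X_at a (2 * k) y" "X_at a (2 * k) y \<le> a + 1"
      using Xr[OF kP(1) bounds(3,5) y] Xr[OF kP(2) bounds(1,2) y] by blast+
    show "(X_circle a (2 * k) \<circ> X_circle c k) y = (X_circle (c + k / 2) (k / 2) \<circ> X_circle a (2 * k)) y"
      unfolding comp_apply Xeq[OF cD(1) kP(1) bounds(3,5) y] Xeq[OF a kP(2) bounds(1,2) r(1,2)]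
        Xeq[OF a kP(2) bounds(1,2) y] Xeq[OF cD(2) kP(3) bounds(7,8) r(3,4)] by (rule rel)
  qed
  have rel3: "X_circle c k \<circ> X_circle c k = X_circle (c + k / 2) (k / 2) \<circ> (X_circle c k \<circ> X_circle c (k / 2))"
    using XL
  proof (intro lifts_agree[of _ _ a] lifts_comp)
    fix y assume y: "a \<le> y" "y \<le> a + 1"
    have r: "a \<le> X_at c k y" "X_at c k y \<le> a + 1" "a \<le> X_at c (k / 2) y" "X_at c (k / 2) y \<le> a + 1"
      using Xr[OF kP(1) bounds(3,5) y] Xr[OF kP(3) bounds(3,6) y] by blast+
    have r': "a \<le> X_at c k (X_at c (k / 2) y)" "X_at c k (X_at c (k / 2) y) \<le> a + 1"
      using Xr[OF kP(1) bounds(3,5) r(3,4)] by blast+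
    show "(X_circle c k \<circ> X_circle c k) y = (X_circle (c + k / 2) (k / 2) \<circ> (X_circle c k \<circ> X_circle c (k / 2))) y"
      unfolding comp_apply Xeq[OF cD(1) kP(1) bounds(3,5) y] Xeq[OF cD(1) kP(1) bounds(3,5) r(1,2)]
        Xeq[OF cD(1) kP(3) bounds(3,6) y] Xeq[OF cD(1) kP(1) bounds(3,5) r(3,4)] Xeq[OF cD(2) kP(3) bounds(7,8) r']
      by (rule X_relations(3)[OF k0(1)])
  qed
  define A where "A = \<eta> (X_circle c k)"
  have C: "A \<in> carrier G" "\<eta> (X_circle a (2 * k)) \<in> carrier G" "\<eta> (X_circle c (2 * k)) \<in> carrier G"
    "\<eta> (X_circle c (k / 2)) \<in> carrier G" "\<eta> (X_circle (c + k / 2) (k / 2)) \<in> carrier G"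
    unfolding A_def using XL eta_closed by auto
  have "\<eta> (X_circle c (2 * k)) \<otimes> \<eta> (X_circle c (k / 2)) = A \<otimes> \<eta> (X_circle c (2 * k))"
    unfolding A_def using rel1 eta_mult XL by metis
  also have "\<dots> = \<eta> (X_circle c (2 * k)) \<otimes> A"
    unfolding A_def by (rule comm) (use a cD kP k0 in \<open>auto simp: c_def\<close>)
  finally have 1: "\<eta> (X_circle c (k / 2)) = A" using C by simp
  have "\<eta> (X_circle (c + k / 2) (k / 2)) \<otimes> \<eta> (X_circle a (2 * k)) = \<eta> (X_circle a (2 * k)) \<otimes> A"
    unfolding A_def using rel2 eta_mult XL by metis
  also have "\<dots> = A \<otimes> \<eta> (X_circle a (2 * k))"
    unfolding A_def by (rule comm) (use a cD kP k0 in \<open>auto simp: c_def\<close>)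
  finally have 2: "\<eta> (X_circle (c + k / 2) (k / 2)) = A" using C by simp
  have "A \<otimes> A = \<eta> (X_circle (c + k / 2) (k / 2)) \<otimes> (A \<otimes> \<eta> (X_circle c (k / 2)))"
    unfolding A_def using rel3 eta_mult XL lifts_comp by metis
  \<comment> \<open>Both half-size copies have the image \<open>A\<close>, and cancellation in the
    pentagon relation leaves \<open>A = A \<otimes> A\<close>.\<close>
  then have "A \<otimes> A = A \<otimes> (A \<otimes> A)" unfolding 1 2 .
  then have "A = A \<otimes> A" using C by simp
  then have "A = \<one>" using C by (metis r_cancel_one')
  then show ?thesis using that[OF cD(1) kP(1)] l k0 A_def by simp
qed

section \<open>From one killed generator to the whole of T\<close>

lemma PL_homeo_interval_dyadic:
  assumes "a \<in> D" "b \<in> D" "c \<in> D" "d \<in> D" "a < b" "c < d"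
  obtains F where "F \<in> PL_homeo 2" "F a = c" "F b = d"
  using PL_homeo_interval[OF assms, of "(d - c) - (b - a)"] assms by (auto intro: Z_inverse_diff)

lemma periodic_ext_lifts:
  assumes "F \<in> PL_homeo 2" "a \<in> D" "F (a + 1) = F a + 1"
  shows "periodic_ext a 1 1 F \<in> lifts" "\<And>x. a \<le> x \<Longrightarrow> x \<le> a + 1 \<Longrightarrow> periodic_ext a 1 1 F x = F x"
proof -
  have "periodic_ext a 1 1 F \<in> PL_homeo 2" using assms by (intro PL_homeo_periodic_ext) auto
  moreover have "periodic_ext a 1 1 F (x + real 1) = periodic_ext a 1 1 F x + real 1" for x
    using periodic_ext_shift[of 1 a 1 F x] by simp
  ultimately show "periodic_ext a 1 1 F \<in> lifts" by (rule liftsI)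
  show "\<And>x. a \<le> x \<Longrightarrow> x \<le> a + 1 \<Longrightarrow> periodic_ext a 1 1 F x = F x"
    using periodic_ext_eq[of 1 F a 1] assms(3) by simp
qed

text \<open>A lift carrying \<open>[c, c + k]\<close> affinely onto \<open>[b, b + l]\<close>
  conjugates one copy of the generator to the other, and kernels are normal.\<close>

lemma eta_X_circle:
  assumes c: "c \<in> D" "k \<in> slopes" "k \<le> 1/4" "\<eta> (X_circle c k) = \<one>"
    and b: "b \<in> D" "l \<in> slopes" "l \<le> 1/2"
  shows "\<eta> (X_circle b l) = \<one>"
proof -
  have pos: "k > 0" "l > 0" using c b int_powers_pos by auto
  have D: "k \<in> D" "l \<in> D" using c b Z_inverse_int_powers by auto
  \<comment> \<open>The complementary intervals can be matched because \<open>m = 2\<close> leaves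
    no congruence condition.\<close>
  obtain F where F: "F \<in> PL_homeo 2" "F (c + k) = b + l" "F (c + 1) = b + 1"
    using PL_homeo_interval_dyadic[of "c + k" "c + 1" "b + l" "b + 1"] c b D by auto
  have lk: "l / k \<in> slopes" using int_powers_mult[OF b(2) int_powers_inverse[OF c(2)]] by simp
  define s0 where "s0 x = (if x \<le> c + k then l / k * x + (b - l / k * c) else F x)" for x
  have "b - l / k * c \<in> D"
    using Z_inverse_diff[OF b(1) Z_inverse_mult[OF Z_inverse_int_powers[OF lk] c(1)]] .
  moreover have "c + k \<in> D" using c(1) D(1) by (rule Z_inverse_add)
  moreover have "l / k * (c + k) + (b - l / k * c) = F (c + k)" using pos F(2) by (simp add: distrib_left)
  ultimately have "s0 \<in> PL_homeo 2" unfolding s0_def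
    by (intro PL_homeo_glue PL_homeo_affine lk F(1))
  moreover have s0: "s0 (c + 1) = b + 1" "s0 c = b" using F c pos by (simp_all add: s0_def)
  ultimately have s: "periodic_ext c 1 1 s0 \<in> lifts" "\<And>x. c \<le> x \<Longrightarrow> x \<le> c + 1 \<Longrightarrow> periodic_ext c 1 1 s0 x = s0 x"
    using periodic_ext_lifts[of s0 c] c by auto
  define s where "s = periodic_ext c 1 1 s0"
  have L: "s \<in> lifts" "X_circle c k \<in> lifts" "X_circle b l \<in> lifts"
    using s c b X_circle_lifts by (auto simp: s_def)
  have "s (X_circle c k x) = X_circle b l (s x)" if x: "c \<le> x" "x \<le> c + 1" for x
  proof (cases "x \<le> c + k")
    case True
    have X: "X_circle c k x = X_at c k x" using X_circle_eq[of c k c x] c x by simp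
    have r: "c \<le> X_at c k x" "X_at c k x \<le> c + k" using X_at_inside[OF pos(1) x(1) True] by auto
    have "s (X_circle c k x) = l / k * X_at c k x + (b - l / k * c)"
      unfolding X s_def using s(2)[of "X_at c k x"] r c by (simp add: s0_def)
    also have "\<dots> = b + l * X_std ((x - c) / k)" using pos by (simp add: X_at_def field_simps)
    finally have 1: "s (X_circle c k x) = b + l * X_std ((x - c) / k)" .
    have sx: "s x = b + l * ((x - c) / k)" unfolding s_def using s(2)[OF x] True pos by (simp add: s0_def field_simps)
    have "0 \<le> (x - c) / k" "(x - c) / k \<le> 1" using x True pos by (auto simp: field_simps)
    then have "0 \<le> l * ((x - c) / k)" "l * ((x - c) / k) \<le> l * 1" using pos
      by (intro mult_nonneg_nonneg mult_left_mono; simp)+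
    then have "b \<le> s x" "s x \<le> b + 1" unfolding sx using b by linarith+
    then have "X_circle b l (s x) = X_at b l (s x)" using X_circle_eq[of b l b] b by simp
    also have "\<dots> = b + l * X_std ((x - c) / k)" unfolding sx X_at_def using pos by simp
    finally show ?thesis using 1 by simp
  next
    case False
    have X: "X_circle c k x = x" using X_circle_eq[of c k c x] X_at_outside[OF pos(1), of x c] c x False by simp
    have sx: "s x = F x" unfolding s_def using s(2)[OF x] False by (simp add: s0_def)
    have "b + l \<le> F x" "F x \<le> b + 1" using F False x PL_homeoD(1)[OF F(1)] by (metis less_imp_le not_le strict_mono_less_eq)+
    then have "X_circle b l (F x) = F x" using X_circle_eq[of b l b "F x"] X_at_outside[OF pos(2), of "F x" b] b pos by simp
    then show ?thesis using X sx by simp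
  qed
  then have "s \<circ> X_circle c k = X_circle b l \<circ> s"
    using L by (intro lifts_agree[of _ _ c] lifts_comp) auto
  then show ?thesis using eta_eq_one_of_conj[OF L(2,1) c(4) _ L(3)] by blast
qed

text \<open>Doubling turns \<open>f\<close> into a homeomorphism of \<open>[0, 1]\<close>, described
  by two words. Halving again gives letters of length at most 1/2, all of which are killed.\<close>

lemma eta_half_support:
  assumes X: "\<And>b l. b \<in> D \<Longrightarrow> l \<in> slopes \<Longrightarrow> l \<le> 1/2 \<Longrightarrow> \<eta> (X_circle b l) = \<one>"
    and f: "f \<in> lifts" "\<And>x. 1/2 \<le> x \<Longrightarrow> x \<le> 1 \<Longrightarrow> f x = x"
  shows "\<eta> f = \<one>"
proof -
  have word: "\<exists>F\<in>lifts. \<eta> F = \<one> \<and> (\<forall>x. 0 \<le> x \<and> x \<le> 1/2 \<longrightarrow> F x = u (2 * x) / 2) \<and>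
      (\<forall>x. 1/2 \<le> x \<and> x \<le> 1 \<longrightarrow> F x = x)" if "X_word u" for u
    using that
  proof (induction rule: X_word.induct)
    case X_word_id
    show ?case using lifts_id eta_id by (intro bexI[of _ "\<lambda>x. x"]) auto
  next
    case (X_word_step g a l)
    then obtain F where F: "F \<in> lifts" "\<eta> F = \<one>" "\<And>x. 0 \<le> x \<Longrightarrow> x \<le> 1/2 \<Longrightarrow> F x = g (2 * x) / 2"
      "\<And>x. 1/2 \<le> x \<Longrightarrow> x \<le> 1 \<Longrightarrow> F x = x" by blast
    have l0: "l > 0" using X_word_step int_powers_pos by blast
    have D: "a / 2 \<in> D" "l / 2 \<in> slopes" using X_word_step half_Z_inverse half_int_powers by auto
    have L: "X_circle (a / 2) (l / 2) \<in> lifts" using X_circle_lifts D X_word_step by simp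
    have on: "X_circle (a / 2) (l / 2) y = X_at (a / 2) (l / 2) y" if "0 \<le> y" "y \<le> 1" for y
      using X_circle_eq[OF D, of 0 y] X_word_step that by simp
    have "\<eta> (X_circle (a / 2) (l / 2) \<circ> F) = \<one>"
      using eta_mult[OF L F(1)] F(2) X[OF D] X_word_step by simp
    moreover have "(X_circle (a / 2) (l / 2) \<circ> F) x = (X_at a l \<circ> g) (2 * x) / 2" if x: "0 \<le> x" "x \<le> 1/2" for x
    proof -
      have "0 \<le> g (2 * x)" "g (2 * x) \<le> 1" using X_word_inside[OF X_word_step.hyps(1), of "2 * x"] x by auto
      then show ?thesis unfolding comp_apply F(3)[OF x]
        using on[of "g (2 * x) / 2"] X_at_conj[of "1/2" l 0 a "g (2 * x)"] l0 by simp
    qed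
    moreover have "(X_circle (a / 2) (l / 2) \<circ> F) x = x" if x: "1/2 \<le> x" "x \<le> 1" for x
      using F(4)[OF x] on[of x] x X_at_outside[of "l / 2" x "a / 2"] l0 X_word_step by simp
    ultimately show ?case using lifts_comp[OF L F(1)] by blast
  qed
  define g where "g x = 2 * f (x / 2)" for x
  have two: "(2::real) \<in> slopes" using power_int_powers[of 1] by simp
  have "g = (\<lambda>x. 2 * x + 0) \<circ> (f \<circ> (\<lambda>x. 1 / 2 * x + 0))" by (auto simp: g_def)
  also have "\<dots> \<in> PL_homeo 2"
    by (intro PL_homeo_comp PL_homeo_affine two int_powers_inverse liftsD(1)[OF f(1)] Z_inverse_0)
  finally have g: "g \<in> PL_homeo 2" .
  have f0: "f 0 = 0" "f (1/2) = 1/2" using periodic(3)[OF f(1), of 1] f(2)[of 1] f(2)[of "1/2"] by simp_all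
  then have "g 0 = 0" "g 1 = 1" by (simp_all add: g_def)
  then obtain u v where uv: "X_word u" "X_word v" "\<And>x. 0 \<le> x \<Longrightarrow> x \<le> 1 \<Longrightarrow> v (g x) = u x"
    using PL_homeo_X_words[OF g] by blast
  obtain U where U: "U \<in> lifts" "\<eta> U = \<one>" "\<And>x. 0 \<le> x \<Longrightarrow> x \<le> 1/2 \<Longrightarrow> U x = u (2 * x) / 2"
      "\<And>x. 1/2 \<le> x \<Longrightarrow> x \<le> 1 \<Longrightarrow> U x = x" using word[OF uv(1)] by blast
  obtain V where V: "V \<in> lifts" "\<eta> V = \<one>" "\<And>x. 0 \<le> x \<Longrightarrow> x \<le> 1/2 \<Longrightarrow> V x = v (2 * x) / 2"
      "\<And>x. 1/2 \<le> x \<Longrightarrow> x \<le> 1 \<Longrightarrow> V x = x" using word[OF uv(2)] by blast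
  have "(V \<circ> f) x = U x" if x: "0 \<le> x" "x \<le> 1" for x
  proof (cases "x \<le> 1/2")
    case True
    have "f 0 \<le> f x" "f x \<le> f (1/2)"
      using True x PL_homeoD(1)[OF liftsD(1)[OF f(1)]] by (simp_all only: strict_mono_less_eq)
    then have "0 \<le> f x" "f x \<le> 1/2" using f0 by simp_all
    then have "V (f x) = v (2 * f x) / 2" by (rule V(3))
    also have "2 * f x = g (2 * x)" by (simp add: g_def)
    also have "v (g (2 * x)) = u (2 * x)" using uv(3)[of "2 * x"] x True by simp
    finally show ?thesis using U(3)[OF x(1) True] by simp
  next
    case False
    then show ?thesis using f(2)[of x] U(4)[of x] V(4)[of x] x by simp
  qed
  then have "V \<circ> f = U" using V(1) U(1) f(1) by (intro lifts_agree[of _ _ 0] lifts_comp) auto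
  then have "\<eta> V \<otimes> \<eta> f = \<eta> U" using eta_mult V(1) f(1) by metis
  then show ?thesis using U(2) V(2) eta_closed[OF f(1)] by simp
qed

text \<open>Conjugation moves the fixed interval, shifted to \<open>[a + 1, b + 1]\<close>, onto
  \<open>[1/2, 1]\<close>.\<close>

lemma eta_fixing_interval:
  assumes half: "\<And>f. f \<in> lifts \<Longrightarrow> (\<And>x. 1/2 \<le> x \<Longrightarrow> x \<le> 1 \<Longrightarrow> f x = x) \<Longrightarrow> \<eta> f = \<one>"
    and f: "f \<in> lifts" and ab: "a \<in> D" "b \<in> D" "a < b" "b < a + 1"
    and fixed: "\<And>x. a \<le> x \<Longrightarrow> x \<le> b \<Longrightarrow> f x = x"
  shows "\<eta> f = \<one>"
proof -
  have h: "(1/2::real) \<in> D" using half_Z_inverse[of 1] by simp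
  have D: "a + 1 \<in> D" "b + 1 \<in> D" using ab by auto
  obtain F where F: "F \<in> PL_homeo 2" "F b = 0" "F (a + 1) = 1/2"
    using PL_homeo_interval_dyadic[of b "a + 1" 0 "1/2"] ab h by auto
  obtain H where H: "H \<in> PL_homeo 2" "H (a + 1) = 1/2" "H (b + 1) = 1"
    using PL_homeo_interval_dyadic[of "a + 1" "b + 1" "1/2" 1] ab h by auto
  define s0 where "s0 x = (if x \<le> a + 1 then F x else H x)" for x
  have "s0 \<in> PL_homeo 2" unfolding s0_def using F H D by (intro PL_homeo_glue) auto
  moreover have "s0 (b + 1) = s0 b + 1" using F H ab by (simp add: s0_def)
  ultimately have s: "periodic_ext b 1 1 s0 \<in> lifts" "\<And>x. b \<le> x \<Longrightarrow> x \<le> b + 1 \<Longrightarrow> periodic_ext b 1 1 s0 x = s0 x"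
    using periodic_ext_lifts[of s0 b] ab by auto
  define s where "s = periodic_ext b 1 1 s0"
  have sL: "s \<in> lifts" using s by (simp add: s_def)
  have s_ends: "s (a + 1) = 1/2" "s (b + 1) = 1"
    using s(2)[of "a + 1"] s(2)[of "b + 1"] ab F H by (simp_all add: s_def s0_def)
  define f' where "f' = s \<circ> f \<circ> finv s"
  have f'L: "f' \<in> lifts" unfolding f'_def using f sL lifts_comp lifts_inv by blast
  have "\<eta> f' = \<one>"
  proof (rule half[OF f'L])
    fix x :: real assume x: "1/2 \<le> x" "x \<le> 1"
    define y where "y = finv s x"
    have sy: "s y = x" using sL by (simp add: y_def)
    have "s (a + 1) \<le> s y" "s y \<le> s (b + 1)" unfolding s_ends sy using x by auto
    then have "a + 1 \<le> y" "y \<le> b + 1" using PL_homeoD(1)[OF liftsD(1)[OF sL]] by (simp_all only: strict_mono_less_eq)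
    then have "f (y - 1) = y - 1" by (intro fixed) auto
    then have "f y = y" using periodic(3)[OF f, of y] by simp
    then show "f' x = x" using sy by (simp add: f'_def y_def)
  qed
  moreover have "finv s \<circ> f' = f \<circ> finv s" using sL by (auto simp: f'_def fun_eq_iff)
  ultimately show ?thesis using eta_eq_one_of_conj[OF f'L lifts_inv[OF sL] _ _ f] by blast
qed

text \<open>After normalization, \<open>t\<close> is a product of two elements that each fix an
  interval: \<open>s\<close> agrees with \<open>t\<close> on \<open>[0, d]\<close> and is the
  identity on a later interval, while \<open>finv s \<circ> t\<close> fixes
  \<open>[0, d]\<close>.\<close>

theorem eta_trivial:
  assumes x: "x \<in> lifts" "\<eta> x = \<one>" "\<not> (\<exists>k::int. \<forall>y. x y = y + of_int k)" and t: "t \<in> lifts"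
  shows "\<eta> t = \<one>"
proof -
  obtain c k where ck: "c \<in> D" "k \<in> slopes" "k \<le> 1/4" "\<eta> (X_circle c k) = \<one>"
    using eta_X_circle_small[OF x] by blast
  have half: "\<eta> f = \<one>" if "f \<in> lifts" "\<And>x. 1/2 \<le> x \<Longrightarrow> x \<le> 1 \<Longrightarrow> f x = x" for f
    using eta_half_support[OF eta_X_circle[OF ck] that] .
  note fixing = eta_fixing_interval[OF half]
  have base: "\<eta> t = \<one>" if t: "t \<in> lifts" and t0: "0 \<le> t 0" "t 0 < 1" for t
  proof -
    note tH = liftsD(1)[OF t]
    note mono = PL_homeoD(1)[OF tH]
    \<comment> \<open>The midpoint of \<open>t 0\<close> and 1; a small \<open>d\<close> keeps
      \<open>t d\<close> below it, which leaves a gap before 1.\<close>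
    define m0 where "m0 = (1 + t 0) / 2"
    have "isCont t 0" using strict_mono_surj_continuous[OF PL_homeoD(1,2)[OF tH]]
      by (simp add: continuous_on_eq_continuous_at)
    then obtain r where r: "r > 0" "\<And>y. \<bar>y\<bar> < r \<Longrightarrow> \<bar>t y - t 0\<bar> < (1 - t 0) / 2"
      unfolding continuous_at_eps_delta dist_real_def using t0 by (metis diff_0_right diff_gt_0_iff_gt half_gt_zero)
    obtain d where d: "d \<in> D" "0 < d" "d < min r (1/2)" using Z_inverse_dense[of 0 "min r (1/2)"] r by auto
    have "\<bar>t d - t 0\<bar> < (1 - t 0) / 2" using r(2)[of d] d by simp
    then have "t d - t 0 < (1 - t 0) / 2" by (rule le_less_trans[OF abs_ge_self])
    then have td: "t d < m0" unfolding m0_def by (simp add: field_simps)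
    have "max d m0 < 1" using d t0 by (simp add: m0_def)
    then obtain u where u: "u \<in> D" "max d m0 < u" "u < 1" using Z_inverse_dense by blast
    \<comment> \<open>Half of \<open>[u, 1]\<close> is to be fixed by \<open>s\<close>; the other
      half, seen as \<open>[- e, 0]\<close>, is stretched to reach \<open>t 0\<close>.\<close>
    define e where "e = (1 - u) / 2"
    have e: "e > 0" "e \<in> D" "u = 1 - 2 * e" unfolding e_def
      using u half_Z_inverse[OF Z_inverse_diff[OF Z_inverse_1 u(1)]] by (simp_all add: field_simps)
    have D: "t 0 \<in> D" "t d \<in> D" using PL_homeoD(5)[OF tH] d by auto
    have eD: "- e \<in> D" "1 - e \<in> D" using e by auto
    obtain A where A: "A \<in> PL_homeo 2" "A (- e) = - e" "A 0 = t 0"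
      using PL_homeo_interval_dyadic[of "- e" 0 "- e" "t 0"] e eD D t0 by auto
    obtain B where B: "B \<in> PL_homeo 2" "B d = t d" "B u = u"
      using PL_homeo_interval_dyadic[of d u "t d" u] u D d td by auto
    define s0 where "s0 x = (if x \<le> 0 then A x else if x \<le> d then t x else if x \<le> u then B x else x)" for x
    have "s0 \<in> PL_homeo 2" unfolding s0_def
      using A B d u e tH by (intro PL_homeo_glue PL_homeo_id) auto
    moreover have ends: "s0 (- e) = - e" "s0 (- e + 1) = - e + 1" using A e u d by (auto simp: s0_def)
    ultimately have s: "periodic_ext (- e) 1 1 s0 \<in> lifts"
      "\<And>x. - e \<le> x \<Longrightarrow> x \<le> - e + 1 \<Longrightarrow> periodic_ext (- e) 1 1 s0 x = s0 x"
      using periodic_ext_lifts[of s0 "- e"] eD by auto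
    define s where "s = periodic_ext (- e) 1 1 s0"
    have sL: "s \<in> lifts" using s by (simp add: s_def)
    have "\<eta> s = \<one>"
    proof (rule fixing[OF _ _ sL u(1) eD(2)])
      show "u < 1 - e" "1 - e < u + 1" using e u d by auto
      show "s x = x" if "u \<le> x" "x \<le> 1 - e" for x
      proof -
        have "s x = s0 x" unfolding s_def using that e u d by (intro s(2)) auto
        then show ?thesis using that B(3) u d by (cases "x = u") (auto simp: s0_def)
      qed
    qed
    moreover have "\<eta> (finv s \<circ> t) = \<one>"
    proof (rule fixing[OF _ _ lifts_comp[OF lifts_inv[OF sL] t] Z_inverse_0 d(1)])
      show "0 < d" "d < 0 + 1" using d by auto
      show "(finv s \<circ> t) x = x" if "0 \<le> x" "x \<le> d" for x
      proof -
        have "s x = s0 x" unfolding s_def using that e u d by (intro s(2)) auto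
        also have "\<dots> = t x" using that A(3) by (cases "x = 0") (auto simp: s0_def)
        finally have "s x = t x" .
        then show ?thesis using finv_lifts(1)[OF sL, of x] by simp
      qed
    qed
    moreover have "s \<circ> (finv s \<circ> t) = t" using sL by auto
    ultimately show ?thesis using eta_mult[OF sL lifts_comp[OF lifts_inv[OF sL] t]] by simp
  qed
  \<comment> \<open>The integer translation that brings \<open>t 0\<close> into
    \<open>[0, 1)\<close> has trivial image.\<close>
  define n where "n = - \<lfloor>t 0\<rfloor>"
  have T: "(\<lambda>x. x + of_int n) \<in> lifts" by (intro lifts_translation) auto
  have "\<eta> ((\<lambda>x. x + of_int n) \<circ> t) = \<one>"
  proof (rule base)
    show "(\<lambda>x. x + of_int n) \<circ> t \<in> lifts" by (rule lifts_comp[OF T t])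
    show "0 \<le> ((\<lambda>x. x + of_int n) \<circ> t) 0" "((\<lambda>x. x + of_int n) \<circ> t) 0 < 1" unfolding n_def by simp_all linarith+
  qed
  then show ?thesis using eta_mult[OF T t] eta_translation[of n] eta_closed[OF t] by simp
qed

end

subsection \<open>Conjugacy classes and homomorphisms\<close>

context Brown_Thompson_lifts
begin

text \<open>Comparing \<open>q\<close>-th powers gives \<open>j + k * q = 1\<close>, so
  \<open>j\<close> is 1 modulo \<open>q\<close> and the surplus translation cancels. Conjugate
  cyclic subgroups thus have conjugate normalized generators.\<close>

lemma translation_roots_conj_power:
  assumes A: "A \<in> lifts" "\<And>x. (A ^^ q) x = x + real r" and B: "B \<in> lifts" "\<And>x. (B ^^ q) x = x + real r"
    and q: "q \<ge> 2" and K: "K \<in> lifts" and eq: "induced r B = induced r (K \<circ> A ^^ j \<circ> finv K)"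
  shows "B = K \<circ> A \<circ> finv K"
proof -
  define E where "E = K \<circ> A ^^ j \<circ> finv K"
  have E: "E \<in> lifts" unfolding E_def using A K by (intro lifts_comp lifts_funpow lifts_inv)
  obtain k :: int where "\<And>x. B x = E x + real r * of_int k"
    using eq induced_eq_iff[OF B(1) E] unfolding E_def by blast
  then have k: "B = (\<lambda>x. E x + real r * of_int k)" by auto
  have Eq: "(E ^^ q) x = x + real r * real j" for x
  proof -
    have "(E ^^ q) x = K (((A ^^ j) ^^ q) (finv K x))" unfolding E_def by (rule conj_funpow[OF K])
    also have "(A ^^ j) ^^ q = A ^^ (q * j)" by (simp add: funpow_mult mult.commute)
    also have "(A ^^ (q * j)) (finv K x) = finv K x + real r * of_int (int j)"
      using funpow_translation[OF A(2), of j "finv K x"] by simp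
    finally show ?thesis using lifts_int[OF K, of "finv K x" "int j"] K by simp
  qed
  have "(B ^^ q) 0 = (E ^^ q) 0 + real r * of_int (k * int q)"
    unfolding k by (rule funpow_shift) (rule lifts_int[OF E])
  then have "real r * 1 = real r * of_int (int j + k * int q)" using B(2)[of 0] Eq[of 0] by (simp add: algebra_simps)
  then have "real_of_int 1 = real_of_int (int j + k * int q)" using r_pos by simp
  then have jk: "int j + k * int q = 1" by (simp only: of_int_eq_iff)
  \<comment> \<open>As \<open>j\<close> is natural and \<open>q\<close> at least 2, a positive
    \<open>k\<close> would overshoot 1.\<close>
  have "k \<le> 0"
  proof (rule ccontr)
    assume "\<not> k \<le> 0"
    then have "1 * int q \<le> k * int q" by (intro mult_right_mono) auto
    then show False using jk q by linarith
  qed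
  then obtain n where n: "k = - int n" by (metis int_ops(1) nonpos_int_cases)
  have "int j = int (1 + q * n)" using jk n by (simp add: algebra_simps)
  then have "j = 1 + q * n" by (simp only: of_nat_eq_iff)
  then have j: "j = Suc (q * n)" by simp
  have "(A ^^ j) x = A x + real r * of_int (int n)" for x
  proof -
    have "(A ^^ j) x = A ((A ^^ (q * n)) x)" unfolding j by simp
    also have "(A ^^ (q * n)) x = x + real r * of_int (int n)" using funpow_translation[OF A(2), of n x] by simp
    finally show ?thesis by (simp only: lifts_int[OF A(1)])
  qed
  then have "E x = K (A (finv K x)) + real r * of_int (int n)" for x
    unfolding E_def comp_apply by (simp only: lifts_int[OF K])
  then show ?thesis unfolding k n by (simp add: fun_eq_iff)
qed

text \<open>The \<open>q\<close>-th roots of translation by \<open>r\<close> exist and are all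
  conjugate; \<open>p\<close>-th powers lead from \<open>1 / q\<close> to \<open>p / q\<close>, and
  Bezout leads back.\<close>

lemma unique_class_with_rational_rotation:
  assumes m2: "m = 2" and t: "\<theta> \<in> circle_proj 1 ` \<rat>"
  shows "\<exists>!C. has_rotation \<theta> C"
proof -
  obtain x where "x \<in> \<rat>" "\<theta> = circle_proj 1 x" using t by blast
  then obtain p q :: nat where pq: "p \<ge> 1" "q \<ge> 1" "coprime p q" "\<theta> = circle_proj 1 (real p / real q)"
    by (metis circle_proj_1_of_nat_fraction)
  have "mod_cong (1 * real q) (real r)" unfolding mod_cong_def
    using m2 by (intro bexI[of _ "real r - real q"]) (auto intro: Z_inverse_diff)
  then obtain A where A: "A \<in> lifts" "\<And>x. (A ^^ q) x = x + real r"
    using translation_root[OF Z_inverse_1 _ pq(2)] by (metis zero_less_one)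
  have Ap: "A ^^ p \<in> lifts" by (rule lifts_funpow[OF A(1)])
  show ?thesis
  proof (rule ex1I)
    have "((A ^^ p) ^^ q) x = x + real r * of_int (int p)" for x
      using funpow_translation[OF A(2), of p x] by (simp add: funpow_mult mult.commute)
    then show "has_rotation \<theta> (conj_class (A ^^ p))"
      using has_rotation_conj_class[OF Ap pq(2), of "int p"] pq(4) by simp
    fix C assume "has_rotation \<theta> C"
    then obtain F where F: "F \<in> lifts" "C = conj_class F" "\<And>x. (F ^^ q) x = x + real r * real p"
      using has_rotationE pq(2,4) by metis
    obtain B s where B: "B \<in> lifts" "\<And>x. (B ^^ q) x = x + real r" "induced r B = induced r (F ^^ s)" "B ^^ p = F"
      using translation_root_of_power[OF F(1) pq(1-3) F(3)] by blast
    obtain K where K: "K \<in> lifts" "B = K \<circ> A \<circ> finv K"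
      using translation_roots_conjugate[OF m2 A(1) B(1) pq(2) A(2) B(2)] by blast
    have "F = K \<circ> A ^^ p \<circ> finv K" unfolding B(4)[symmetric] K(2) by (simp add: fun_eq_iff conj_funpow[OF K(1)])
    then have FT: "induced r F = induced r K \<otimes>\<^bsub>T\<^esub> induced r (A ^^ p) \<otimes>\<^bsub>T\<^esub> inv\<^bsub>T\<^esub> (induced r K)"
      using conj_induced[OF Ap K(1)] by simp
    show "C = conj_class (A ^^ p)" unfolding F(2) conj_class_def
      by (rule group.conjugacy_class_eq[OF group_Brown_Thompson induced_in_carrier[OF Ap]
          induced_in_carrier[OF K(1)] FT])
  qed
qed

text \<open>At rotation number \<open>1 / (m - 1)\<close> existence forces \<open>m - 1\<close> to
  divide \<open>r\<close>, and then two non-conjugate roots contradict uniqueness.\<close>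

lemma no_unique_class:
  assumes m: "m > 2"
  shows "\<not> (\<exists>!C. has_rotation (circle_proj 1 (real 1 / real (m - 1))) C)"
proof
  assume ex1: "\<exists>!C. has_rotation (circle_proj 1 (real 1 / real (m - 1))) C"
  have q: "m - 1 \<ge> 1" "m - 1 \<ge> 2" using m by auto
  obtain F where F: "F \<in> lifts" "\<And>x. (F ^^ (m - 1)) x = x + real r * real 1"
    using ex1 has_rotationE[OF _ q(1)] by metis
  then have "(m - 1) dvd r" by (intro translation_root_dvd[of F]) auto
  then obtain A B where AB: "A \<in> lifts" "B \<in> lifts" "\<And>x. (A ^^ (m - 1)) x = x + real r"
    "\<And>x. (B ^^ (m - 1)) x = x + real r" "\<And>C. C \<in> lifts \<Longrightarrow> B \<noteq> C \<circ> A \<circ> finv C"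
    using two_translation_roots[OF m] by blast
  have "has_rotation (circle_proj 1 (real 1 / real (m - 1))) (conj_class A)"
    "has_rotation (circle_proj 1 (real 1 / real (m - 1))) (conj_class B)"
    using has_rotation_conj_class[OF AB(1) q(1), of 1] has_rotation_conj_class[OF AB(2) q(1), of 1] AB(3,4) by simp_all
  then have "induced r B \<in> conj_class A" using ex1 conj_class_self[OF AB(2)] by auto
  then obtain K where K: "K \<in> lifts" "induced r B = induced r (K \<circ> A \<circ> finv K)"
    unfolding conj_class_eq[OF AB(1)] by blast
  then have "B = K \<circ> A \<circ> finv K"
    using translation_roots_conj_power[OF AB(1,3,2,4) q(2) K(1), of 1] by simp
  then show False using AB(5)[OF K(1)] by blast
qed

end

interpretation Thompson: Brown_Thompson_lifts 2 1 by unfold_locales auto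

lemma Thompson_T_root:
  assumes "q \<ge> 1"
  obtains A where "A \<in> Thompson.lifts" "\<And>x. (A ^^ q) x = x + 1"
proof -
  have "dyadic.mod_cong (1 * real q) (real 1)" unfolding dyadic.mod_cong_def
    by (intro bexI[of _ "1 - real q"]) (auto intro: dyadic.Z_inverse_diff)
  then show ?thesis using Thompson.translation_root[OF dyadic.Z_inverse_1 _ assms] that by (metis of_nat_1 zero_less_one)
qed

context Brown_Thompson_lifts
begin

lemma group_hom_Thompson: "h \<in> hom Thompson_T T \<Longrightarrow> group_hom Thompson_T T h"
  unfolding group_hom_def group_hom_axioms_def Thompson_T_def
  using Thompson.group_Brown_Thompson group_Brown_Thompson by simp

text \<open>If the image of an element of order \<open>m - 1\<close> kept that exact order, a root
  of translation by \<open>r\<close> of degree \<open>m - 1\<close> would exist and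
  \<open>m - 1\<close> would divide \<open>r\<close>.\<close>

lemma Thompson_hom_kernel:
  assumes m: "m > 2" and r: "\<not> (m - 1) dvd r" and h: "h \<in> hom Thompson_T T"
  obtains x where "x \<in> carrier Thompson_T" "x \<noteq> \<one>\<^bsub>Thompson_T\<^esub>" "h x = \<one>\<^bsub>T\<^esub>"
proof -
  interpret h: group_hom Thompson_T T h
    using h by (rule group_hom_Thompson)
  have q: "m - 1 \<ge> 1" using m by simp
  obtain A where A: "A \<in> Thompson.lifts" "\<And>x. (A ^^ (m - 1)) x = x + real 1" using Thompson_T_root[OF q] by auto
  define x where "x = induced 1 A"
  have xT: "x \<in> carrier Thompson_T" unfolding x_def Thompson_T_def by (rule Thompson.induced_in_carrier[OF A(1)])
  note ord = Thompson.translation_root_order[OF A(1) q A(2), folded x_def Thompson_T_def]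
  have "\<not> (\<forall>d. 0 < d \<longrightarrow> d < m - 1 \<longrightarrow> h x [^]\<^bsub>T\<^esub> d \<noteq> \<one>\<^bsub>T\<^esub>)"
  proof
    assume *: "\<forall>d. 0 < d \<longrightarrow> d < m - 1 \<longrightarrow> h x [^]\<^bsub>T\<^esub> d \<noteq> \<one>\<^bsub>T\<^esub>"
    have "h x [^]\<^bsub>T\<^esub> (m - 1) = \<one>\<^bsub>T\<^esub>" using ord(1) h.hom_nat_pow[OF xT] h.hom_one by metis
    then obtain B where "B \<in> lifts" "\<And>x. (B ^^ (m - 1)) x = x + real r"
      using exact_order_translation_root[OF h.hom_closed[OF xT] q] * by metis
    then show False using translation_root_dvd r by blast
  qed
  then obtain d where d: "0 < d" "d < m - 1" "h x [^]\<^bsub>T\<^esub> d = \<one>\<^bsub>T\<^esub>" by blast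
  show ?thesis
  proof (rule that)
    show "x [^]\<^bsub>Thompson_T\<^esub> d \<in> carrier Thompson_T" using xT by simp
    show "x [^]\<^bsub>Thompson_T\<^esub> d \<noteq> \<one>\<^bsub>Thompson_T\<^esub>" using ord(2) d by blast
    show "h (x [^]\<^bsub>Thompson_T\<^esub> d) = \<one>\<^bsub>T\<^esub>" using h.hom_nat_pow[OF xT] d(3) by simp
  qed
qed

theorem Thompson_hom_trivial:
  assumes m: "m > 2" and r: "\<not> (m - 1) dvd r" and h: "h \<in> hom Thompson_T T" and g: "g \<in> carrier Thompson_T"
  shows "h g = \<one>\<^bsub>T\<^esub>"
proof -
  interpret h: group_hom Thompson_T T h
    using h by (rule group_hom_Thompson)
  interpret eta: Thompson_hom T "\<lambda>F. h (induced 1 F)"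
  proof unfold_locales
    fix F H assume F: "F \<in> Thompson.lifts" and H: "H \<in> Thompson.lifts"
    note FH = Thompson.induced_in_carrier[OF F] Thompson.induced_in_carrier[OF H]
    show "h (induced 1 (F \<circ> H)) = h (induced 1 F) \<otimes>\<^bsub>T\<^esub> h (induced 1 H)"
      using h.hom_mult[of "induced 1 F" "induced 1 H"] FH Thompson.mult_Brown_Thompson[OF F H]
      unfolding Thompson_T_def by simp
  next
    fix F assume "F \<in> Thompson.lifts"
    then show "h (induced 1 F) \<in> carrier T"
      using h.hom_closed Thompson.induced_in_carrier unfolding Thompson_T_def by blast
  next
    fix n :: int
    have "(\<lambda>x. x + of_int n) \<in> Thompson.lifts" by (intro Thompson.lifts_translation) auto
    then have "induced 1 (\<lambda>x. x + of_int n) = \<one>\<^bsub>Thompson_T\<^esub>"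
      unfolding Thompson_T_def using Thompson.induced_eq_one_iff by auto
    then show "h (induced 1 (\<lambda>x. x + of_int n)) = \<one>\<^bsub>T\<^esub>" by simp
  qed
  obtain x where x: "x \<in> carrier Thompson_T" "x \<noteq> \<one>\<^bsub>Thompson_T\<^esub>" "h x = \<one>\<^bsub>T\<^esub>"
    using Thompson_hom_kernel[OF m r h] by blast
  obtain F where F: "F \<in> Thompson.lifts" "x = induced 1 F"
    using Thompson.Brown_Thompson_induced x(1) unfolding Thompson_T_def by blast
  obtain H where H: "H \<in> Thompson.lifts" "g = induced 1 H"
    using Thompson.Brown_Thompson_induced g unfolding Thompson_T_def by blast
  have "\<not> (\<exists>k::int. \<forall>y. F y = y + of_int k)"
    using x(2) F Thompson.induced_eq_one_iff[OF F(1)] unfolding Thompson_T_def by simp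
  then show ?thesis using eta.eta_trivial[OF F(1) _ _ H(1)] F(2) x(3) H(2) by simp
qed

text \<open>Injectivity forces \<open>m - 1\<close> to divide \<open>r\<close>. The cyclic groups of
  the two non-conjugate roots then pull back to conjugate subgroups of T, which makes the roots
  conjugate after all.\<close>

theorem Thompson_not_iso:
  assumes m: "m > 2"
  shows "\<not> Thompson_T \<cong> T"
proof
  assume "Thompson_T \<cong> T"
  then obtain f where f: "f \<in> iso Thompson_T T" unfolding is_iso_def by blast
  interpret f: group_hom Thompson_T T f
    using f by (intro group_hom_Thompson) (simp add: iso_def)
  have bij: "bij_betw f (carrier Thompson_T) (carrier T)" and fh: "f \<in> hom Thompson_T T" using f by (auto simp: iso_def)
  have q: "m - 1 \<ge> 1" "m - 1 \<ge> 2" using m by auto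
  have one: "\<one>\<^bsub>Thompson_T\<^esub> \<in> carrier Thompson_T" by simp
  have "(m - 1) dvd r"
  proof (rule ccontr)
    assume "\<not> (m - 1) dvd r"
    then obtain x where x: "x \<in> carrier Thompson_T" "x \<noteq> \<one>\<^bsub>Thompson_T\<^esub>" "f x = \<one>\<^bsub>T\<^esub>"
      using Thompson_hom_kernel[OF m _ fh] by blast
    then have "f x = f \<one>\<^bsub>Thompson_T\<^esub>" by simp
    then show False using inj_onD[OF bij_betw_imp_inj_on[OF bij] _ x(1) one] x(2) by blast
  qed
  then obtain A B where AB: "A \<in> lifts" "B \<in> lifts" "\<And>x. (A ^^ (m - 1)) x = x + real r"
    "\<And>x. (B ^^ (m - 1)) x = x + real r" "\<And>C. C \<in> lifts \<Longrightarrow> B \<noteq> C \<circ> A \<circ> finv C"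
    using two_translation_roots[OF m] by blast
  \<comment> \<open>The preimage of the cyclic group of \<open>H\<close> has a normalized generator
    \<open>C\<close>; the exponents \<open>s\<close> and \<open>p\<close> record the change of
    generator.\<close>
  have pre: "\<exists>C s p. C \<in> Thompson.lifts \<and> (\<forall>x. (C ^^ (m - 1)) x = x + real 1) \<and>
      f (induced 1 C) = induced r H [^]\<^bsub>T\<^esub> (s::nat) \<and> induced r H = f (induced 1 C) [^]\<^bsub>T\<^esub> (p::nat)"
    if H: "H \<in> lifts" "\<And>x. (H ^^ (m - 1)) x = x + real r" for H
  proof -
    obtain t where t: "t \<in> carrier Thompson_T" "f t = induced r H"
      using bij induced_in_carrier[OF H(1)] unfolding bij_betw_def by (metis imageE)
    have tp: "t [^]\<^bsub>Thompson_T\<^esub> d = \<one>\<^bsub>Thompson_T\<^esub> \<longleftrightarrow> induced r H [^]\<^bsub>T\<^esub> d = \<one>\<^bsub>T\<^esub>" for d :: nat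
    proof -
      have "f (t [^]\<^bsub>Thompson_T\<^esub> d) = induced r H [^]\<^bsub>T\<^esub> d" using f.hom_nat_pow[OF t(1)] t(2) by simp
      moreover have "t [^]\<^bsub>Thompson_T\<^esub> d \<in> carrier Thompson_T" using t(1) by simp
      ultimately show ?thesis using bij f.hom_one by (metis bij_betw_imp_inj_on one inj_onD)
    qed
    note ord = translation_root_order[OF H(1) q(1) H(2)]
    obtain C s p where C: "C \<in> Thompson.lifts" "\<And>x. (C ^^ (m - 1)) x = x + real 1"
      "induced 1 C = t [^]\<^bsub>Thompson_T\<^esub> (s::nat)" "t = induced 1 C [^]\<^bsub>Thompson_T\<^esub> (p::nat)"
      using Thompson.exact_order_translation_root[folded Thompson_T_def, OF t(1) q(1)] tp ord by metis
    have CT: "induced 1 C \<in> carrier Thompson_T"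
      unfolding Thompson_T_def by (rule Thompson.induced_in_carrier[OF C(1)])
    have "f (induced 1 C) = induced r H [^]\<^bsub>T\<^esub> s" unfolding C(3) using f.hom_nat_pow[OF t(1)] t(2) by simp
    moreover have "induced r H = f (induced 1 C) [^]\<^bsub>T\<^esub> p"
      using f.hom_nat_pow[OF CT, of p] C(4) t(2) by simp
    ultimately show ?thesis using C(1,2) by blast
  qed
  obtain C s p where C: "C \<in> Thompson.lifts" "\<And>x. (C ^^ (m - 1)) x = x + real 1"
    "f (induced 1 C) = induced r A [^]\<^bsub>T\<^esub> (s::nat)" using pre[OF AB(1,3)] by blast
  obtain E s' p' where E: "E \<in> Thompson.lifts" "\<And>x. (E ^^ (m - 1)) x = x + real 1"
    "induced r B = f (induced 1 E) [^]\<^bsub>T\<^esub> (p'::nat)" using pre[OF AB(2,4)] by blast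
  obtain K where K: "K \<in> Thompson.lifts" "E = K \<circ> C \<circ> finv K"
    using Thompson.translation_roots_conjugate[OF refl C(1) E(1) q(1) C(2) E(2)] by blast
  have KC: "induced 1 K \<in> carrier Thompson_T" "induced 1 C \<in> carrier Thompson_T"
    unfolding Thompson_T_def using Thompson.induced_in_carrier K(1) C(1) by auto
  obtain M where M: "M \<in> lifts" "f (induced 1 K) = induced r M" using Brown_Thompson_induced f.hom_closed[OF KC(1)] by metis
  have "induced 1 E = induced 1 K \<otimes>\<^bsub>Thompson_T\<^esub> induced 1 C \<otimes>\<^bsub>Thompson_T\<^esub> inv\<^bsub>Thompson_T\<^esub> (induced 1 K)"
    unfolding Thompson_T_def using Thompson.conj_induced[OF C(1) K(1)] K(2) by simp
  then have "f (induced 1 E) = induced r M \<otimes>\<^bsub>T\<^esub> (induced r A [^]\<^bsub>T\<^esub> s) \<otimes>\<^bsub>T\<^esub> inv\<^bsub>T\<^esub> (induced r M)"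
    using KC M(2) C(3) by (simp add: f.hom_mult f.hom_inv)
  \<comment> \<open>The power \<open>p'\<close> turns the conjugacy between generators into one
    between \<open>B\<close> and a power of \<open>A\<close>.\<close>
  then have "induced r B = induced r M \<otimes>\<^bsub>T\<^esub> ((induced r A [^]\<^bsub>T\<^esub> s) [^]\<^bsub>T\<^esub> p') \<otimes>\<^bsub>T\<^esub> inv\<^bsub>T\<^esub> (induced r M)"
    using E(3) induced_in_carrier[OF AB(1)] induced_in_carrier[OF M(1)]
    by (simp add: group.conj_pow[OF group_Brown_Thompson])
  also have "\<dots> = induced r (M \<circ> A ^^ (s * p') \<circ> finv M)"
    using conj_induced[OF lifts_funpow[OF AB(1)] M(1)] AB(1)
    by (simp add: pow_Brown_Thompson lifts_funpow funpow_mult mult.commute)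
  finally have "B = M \<circ> A \<circ> finv M"
    by (rule translation_roots_conj_power[OF AB(1,3,2,4) q(2) M(1)])
  then show False using AB(5)[OF M(1)] by blast
qed

end

theorem mainTheorem2:
  shows
    "(\<forall>r m :: nat. r \<ge> 1 \<longrightarrow> m \<ge> 2 \<longrightarrow>
        ((\<forall>\<theta> \<in> circle_proj 1 ` \<rat>.
            \<exists>!C. C \<in> conjugacy_classes (Brown_Thompson r m) \<and>
                 (\<forall>f\<in>C. finite_order (Brown_Thompson r m) f \<and> rotation_number r f = \<theta>))
         \<longleftrightarrow> m = 2))
     \<and>
     (\<forall>r m :: nat. r \<ge> 1 \<longrightarrow> m \<ge> 2 \<longrightarrow> m \<noteq> 2 \<longrightarrow>
        \<not> (Thompson_T \<cong> Brown_Thompson r m))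
     \<and>
     (\<forall>r m :: nat. r \<ge> 1 \<longrightarrow> m \<ge> 2 \<longrightarrow> m \<noteq> 2 \<longrightarrow> \<not> [r = 0] (mod (m - 1)) \<longrightarrow>
        (\<forall>h \<in> hom Thompson_T (Brown_Thompson r m).
           \<forall>g \<in> carrier Thompson_T. h g = \<one>\<^bsub>Brown_Thompson r m\<^esub>))"
proof (intro conjI allI impI)
  fix r m :: nat assume "r \<ge> 1" "m \<ge> 2"
  then interpret B: Brown_Thompson_lifts m r by unfold_locales
  have "(\<forall>\<theta> \<in> circle_proj 1 ` \<rat>. \<exists>!C. B.has_rotation \<theta> C) \<longleftrightarrow> m = 2"
  proof
    assume *: "\<forall>\<theta> \<in> circle_proj 1 ` \<rat>. \<exists>!C. B.has_rotation \<theta> C"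
    show "m = 2"
    proof (rule ccontr)
      assume "m \<noteq> 2"
      then have "m > 2" using \<open>m \<ge> 2\<close> by simp
      moreover have "real 1 / real (m - 1) \<in> \<rat>" by (intro Rats_divide Rats_of_nat)
      ultimately show False using * B.no_unique_class by blast
    qed
  qed (use B.unique_class_with_rational_rotation in blast)
  then show "(\<forall>\<theta> \<in> circle_proj 1 ` \<rat>.
            \<exists>!C. C \<in> conjugacy_classes (Brown_Thompson r m) \<and>
                 (\<forall>f\<in>C. finite_order (Brown_Thompson r m) f \<and> rotation_number r f = \<theta>))
         \<longleftrightarrow> m = 2" unfolding B.has_rotation_def .
next
  fix r m :: nat assume "r \<ge> 1" "m \<ge> 2" "m \<noteq> 2"
  then interpret B: Brown_Thompson_lifts m r by unfold_locales
  show "\<not> Thompson_T \<cong> Brown_Thompson r m" by (rule B.Thompson_not_iso) (use \<open>m \<ge> 2\<close> \<open>m \<noteq> 2\<close> in simp)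
next
  fix r m :: nat
  assume *: "r \<ge> 1" "m \<ge> 2" "m \<noteq> 2" "\<not> [r = 0] (mod (m - 1))"
  interpret B: Brown_Thompson_lifts m r using *(1,2) by unfold_locales
  have m: "m > 2" using *(2,3) by linarith
  have r: "\<not> (m - 1) dvd r"
  proof
    assume "(m - 1) dvd r"
    then have "[r = 0] (mod (m - 1))" by (rule cong_0_iff[THEN iffD2])
    with *(4) show False by (rule notE)
  qed
  show "\<forall>h \<in> hom Thompson_T (Brown_Thompson r m).
           \<forall>g \<in> carrier Thompson_T. h g = \<one>\<^bsub>Brown_Thompson r m\<^esub>"
  proof (rule ballI)
    fix h assume h: "h \<in> hom Thompson_T (Brown_Thompson r m)"
    show "\<forall>g \<in> carrier Thompson_T. h g = \<one>\<^bsub>Brown_Thompson r m\<^esub>"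
    proof (rule ballI)
      fix g assume "g \<in> carrier Thompson_T"
      with B.Thompson_hom_trivial[OF m r h] show "h g = \<one>\<^bsub>Brown_Thompson r m\<^esub>" .
    qed
  qed
qed

end
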